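(* There exists an absolute constant $C$ such that the following holds. Let $F$ and $G$ be distribution functions with mean zero and variances $v_1^2,v_2^2$, respectively $(v_1,v_2>0)$, such that $v_1^2+v_2^2=1$. Let $0<\sigma\le1$ and $0<\varepsilon\le1$. If the regularized distributions satisfy $$\frac12\,\big\|F_\sigma*G_\sigma-N(0,1+2\sigma^2)\big\|_{\mathrm{TV}}\le\varepsilon,$$ then $$\big\|F_\sigma-N(0,v_1^2+\sigma^2)\big\|_{\mathrm{TV}}\le\frac{C}{\sigma}\Big(\frac{1}{\log\frac1\varepsilon}\Big)^{1/4},\qquad \big\|G_\sigma-N(0,v_2^2+\sigma^2)\big\|_{\mathrm{TV}}\le\frac{C}{\sigma}\Big(\frac{1}{\log\frac1\varepsilon}\Big)^{1/4}$$ (the right-hand sides being $+\infty$ when $\varepsilon=1$).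
   Context: For a distribution function $F$ and $\sigma>0$, $F_\sigma=F*N(0,\sigma^2)$ denotes the distribution (function) of $X+\sigma Z$, where $X$ has distribution function $F$ and $Z$ is standard normal independent of $X$; similarly $G_\sigma$. $*$ denotes convolution of distributions and $N(a,v^2)$ denotes the normal law with mean $a$ and variance $v^2$ (also its distribution function). The total variation distance is $$\|F-G\|_{\mathrm{TV}}=\sup\sum_k\big|(F(x_k)-G(x_k))-(F(y_k)-G(y_k))\big|,$$ the supremum over all finite collections of points $y_1<x_1<\dots<y_n<x_n$ (so it is the full total variation of the signed measure, with values in $[0,2]$). $\log$ is the natural logarithm. *)

theory Defs
  imports "HOL-Probability.Probability"
begin

text \<open>The second parameter is the variance, whereas \<^const>\<open>normal_density\<close> takes the
  standard deviation.\<close>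

definition normal_law :: "real \<Rightarrow> real \<Rightarrow> real measure" where
  "normal_law a s = density lborel (normal_density a (sqrt s))"

definition regularized :: "real measure \<Rightarrow> real \<Rightarrow> real measure" where
  "regularized F \<sigma> = (F \<star> normal_law 0 (\<sigma>\<^sup>2))"

text \<open>Integrability is part of the condition because the Bochner integral of a non-integrable
  function is 0.\<close>

definition has_mean_variance :: "real measure \<Rightarrow> real \<Rightarrow> real \<Rightarrow> bool" where
  "has_mean_variance F m s \<longleftrightarrow>
     integrable F (\<lambda>x. x) \<and> integrable F (\<lambda>x. x\<^sup>2) \<and>
     prob_space.expectation F (\<lambda>x. x) = m \<and> prob_space.variance F (\<lambda>x. x) = s"

text \<open>The supremum ranges over points \<open>y 0 < x 0 < y 1 < x 1 < \<dots> < y (n - 1) < x (n - 1)\<close>, so this is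
  the full variation of the signed measure \<open>F - G\<close> (at most 2 for probability measures), without
  a factor 1/2.  It is taken in the extended reals so that no boundedness is needed for it to
  be meaningful.\<close>

definition tv_dist :: "real measure \<Rightarrow> real measure \<Rightarrow> ereal" where
  "tv_dist F G =
     Sup {ereal (\<Sum>k<n. \<bar>(cdf F (x k) - cdf G (x k)) - (cdf F (y k) - cdf G (y k))\<bar>) | n x y.
            n \<ge> 1 \<and> (\<forall>k<n. y k < x k) \<and> (\<forall>k. Suc k < n \<longrightarrow> x k < y (Suc k))}"

text \<open>The quantity \<open>(1 / log (1/\<epsilon>)) ^ (1/4)\<close> for \<open>0 < \<epsilon> \<le> 1\<close>, which is infinite at \<open>\<epsilon> = 1\<close>
  (real division would give 0 there).\<close>

definition inv_log_root :: "real \<Rightarrow> ereal" where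
  "inv_log_root \<epsilon> = (if \<epsilon> < 1 then ereal ((1 / ln (1 / \<epsilon>)) powr (1/4)) else \<infinity>)"

end

theory Submission
  imports Defs "HOL-Complex_Analysis.Complex_Analysis"
begin

text \<open>
  The idea is a quantitative form of the complex-analytic proof of Cramer's theorem.  If \<open>X + Y\<close> were
  exactly normal, the Laplace transforms \<open>\<phi>\<close>, \<open>\<psi>\<close> of \<open>X\<close>, \<open>Y\<close> would be entire, without zeros and of
  order two, so their logarithms would be quadratic polynomials.  Here \<open>X + Y\<close> is normal only up to
  \<open>\<epsilon> = exp (-L)\<close>, and the same argument works on a disc of radius \<open>T\<close> proportional to \<open>sqrt L\<close>.

  \<^emph>\<open>Truncation.\<close>  The law of \<open>S = X + Y + \<sigma> sqrt 2 Z\<close> is within \<open>2 \<epsilon>\<close> of a normal law in Kolmogorov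
  distance, which forces \<open>X\<close> and \<open>Y\<close> to have tails of order \<open>\<epsilon>\<close> beyond \<open>N = 5 sqrt L\<close>.  Cutting \<open>X\<close> and
  \<open>Y\<close> there costs \<open>O(\<epsilon>)\<close> and makes \<open>\<phi>\<close> and \<open>\<psi>\<close> entire.  Integration by parts turns closeness of
  distribution functions into closeness of Laplace transforms in the complex plane; as \<open>N T\<close> is a
  small multiple of \<open>L\<close>, the exponential losses are beaten by \<open>\<epsilon>\<close>, and \<open>\<phi> \<psi> exp (-z\<^sup>2/2)\<close> stays within
  \<open>1/2\<close> of \<open>1\<close> for \<open>\<bar>z\<bar> \<le> T\<close> (\<open>laplace_product_close\<close>).  The Gaussian factor \<open>exp (\<sigma>\<^sup>2 z\<^sup>2)\<close> occurs on
  both sides and cancels.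

  \<^emph>\<open>The logarithm is nearly quadratic\<close> (\<open>log_cubic_remainder\<close>).  Now \<open>log \<phi>\<close> exists on the disc.  Its
  real part is at most \<open>log \<phi>(Re z) \<le> T\<^sup>2\<close>, because \<open>\<psi>\<close> is bounded below by Jensen's inequality, and
  the Borel-Caratheodory theorem gives a fourth derivative of order \<open>T\<^sup>-\<^sup>2\<close>.  On the real axis the second
  derivative of \<open>log \<phi>\<close> is the variance of an exponentially tilted law, hence nonnegative.  A nonnegative
  function that is at most \<open>v\<^sup>2\<close> at \<open>0\<close> and has second derivative \<open>O(T\<^sup>-\<^sup>2)\<close> remains \<open>O(v\<^sup>2)\<close> on an
  interval of length of order \<open>v T\<close>.  This gain of \<open>v\<^sup>2\<close>, fed into Borel-Caratheodory on the disc of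
  radius \<open>v T / 4\<close>, yields a cubic remainder \<open>O(v \<bar>z\<bar>\<^sup>3 / T)\<close>.

  \<^emph>\<open>Back to distributions.\<close>  Put \<open>d = 1 / (2 T)\<close>.  The expansion and Levy's inversion formula bound the
  difference \<open>D\<close> of the distribution functions of \<open>F \<star> N(0, d)\<close> and \<open>N(0, v\<^sup>2 + d)\<close> by
  \<open>O(1 / (v\<^sup>2 T))\<close> (\<open>smoothed_cdf_close\<close>).  Together with Chebyshev tails this gives
  \<open>\<integral>\<bar>D\<bar> = O(T powr (-1/2))\<close>; when \<open>v\<^sup>2 T < 1\<close> the tails alone suffice.  Finally, convolution with
  \<open>N(0, \<tau>\<^sup>2)\<close> turns \<open>\<integral>\<bar>D\<bar>\<close> into total variation at the price of a factor of order \<open>1 / \<tau>\<close>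
  (\<open>tv_dist_convolution_normal_law_le\<close>), and \<open>\<tau>\<^sup>2 = \<sigma>\<^sup>2 - d\<close> is at least \<open>\<sigma>\<^sup>2 / 2\<close> if \<open>\<sigma>\<^sup>2 \<ge> 1 / T\<close>.  In the
  remaining range of the parameters the claimed bound exceeds \<open>2\<close>, the largest possible value.
\<close>

section \<open>Total variation of a difference of distribution functions\<close>

text \<open>A monotone \<open>V\<close> that dominates all increments of the difference bounds every sum in the supremum,
  because the intervals are ordered and the sum over \<open>V\<close> telescopes.\<close>

lemma tv_dist_le_variation:
  assumes mono: "mono V" and range: "\<And>x y. V x - V y \<le> B"
    and inc: "\<And>x y. y < x \<Longrightarrow> \<bar>(cdf F x - cdf G x) - (cdf F y - cdf G y)\<bar> \<le> V x - V y"
  shows "tv_dist F G \<le> ereal B"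
proof -
  have "(\<Sum>k<n. \<bar>(cdf F (x k) - cdf G (x k)) - (cdf F (y k) - cdf G (y k))\<bar>) \<le> B"
    if n: "n \<ge> 1" and yx: "\<And>k. k < n \<Longrightarrow> y k < x k" and xy: "\<And>k. Suc k < n \<Longrightarrow> x k < y (Suc k)"
    for n x y
  proof -
    have "(\<Sum>k<n. \<bar>(cdf F (x k) - cdf G (x k)) - (cdf F (y k) - cdf G (y k))\<bar>) \<le> V (x (n - 1)) - V (y 0)"
      using n yx xy
    proof (induction n rule: nat_induct_at_least)
      case base
      then show ?case using inc by simp
    next
      case (Suc n)
      have "V (x (n - 1)) \<le> V (y n)"
        using Suc.hyps Suc.prems(2)[of "n - 1"] by (intro monoD[OF mono]) simp
      moreover have "\<bar>(cdf F (x n) - cdf G (x n)) - (cdf F (y n) - cdf G (y n))\<bar> \<le> V (x n) - V (y n)"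
        using Suc.prems(1) by (intro inc) simp
      ultimately show ?case using Suc.IH[OF Suc.prems(1) Suc.prems(2)] by simp
    qed
    then show ?thesis using range order_trans by blast
  qed
  then show ?thesis unfolding tv_dist_def by (intro Sup_least) auto
qed

lemma tv_dist_le_2:
  assumes "real_distribution F" "real_distribution G"
  shows "tv_dist F G \<le> 2"
proof -
  interpret F: real_distribution F by fact
  interpret G: real_distribution G by fact
  have "tv_dist F G \<le> ereal 2"
  proof (rule tv_dist_le_variation[where V = "\<lambda>x. cdf F x + cdf G x"])
    show "mono (\<lambda>x. cdf F x + cdf G x)"
      by (intro monoI add_mono F.cdf_nondecreasing G.cdf_nondecreasing)
    show "cdf F x + cdf G x - (cdf F y + cdf G y) \<le> 2" for x y
      using F.cdf_bounded_prob[of x] G.cdf_bounded_prob[of x] F.cdf_nonneg[of y] G.cdf_nonneg[of y] by linarith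
    show "\<bar>cdf F x - cdf G x - (cdf F y - cdf G y)\<bar> \<le> cdf F x + cdf G x - (cdf F y + cdf G y)" if "y < x" for x y
      using F.cdf_nondecreasing[of y x] G.cdf_nondecreasing[of y x] that by linarith
  qed
  then show ?thesis by simp
qed

text \<open>Let the left end point of a single interval tend to \<open>-\<infinity>\<close>, where both distribution functions vanish.\<close>

lemma cdf_diff_le_tv_dist:
  assumes "real_distribution F" "real_distribution G" and tv: "tv_dist F G \<le> ereal c"
  shows "\<bar>cdf F x - cdf G x\<bar> \<le> c"
proof -
  interpret F: real_distribution F by fact
  interpret G: real_distribution G by fact
  have "\<bar>(cdf F x - cdf G x) - (cdf F y - cdf G y)\<bar> \<le> c" if "y < x" for y
  proof -
    have "ereal (\<Sum>k<(1::nat). \<bar>(cdf F ((\<lambda>_. x) k) - cdf G ((\<lambda>_. x) k)) - (cdf F ((\<lambda>_. y) k) - cdf G ((\<lambda>_. y) k))\<bar>)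
       \<le> tv_dist F G"
      unfolding tv_dist_def
      by (rule Sup_upper, rule CollectI, rule exI[of _ 1], rule exI[of _ "\<lambda>_. x"], rule exI[of _ "\<lambda>_. y"])
        (use that in simp)
    then have "ereal \<bar>(cdf F x - cdf G x) - (cdf F y - cdf G y)\<bar> \<le> ereal c"
      by (intro order_trans[OF _ tv]) simp
    then show ?thesis by simp
  qed
  then have "eventually (\<lambda>y. \<bar>(cdf F x - cdf G x) - (cdf F y - cdf G y)\<bar> \<le> c) at_bot"
    using eventually_at_bot_dense by blast
  moreover have "((\<lambda>y. \<bar>(cdf F x - cdf G x) - (cdf F y - cdf G y)\<bar>) \<longlongrightarrow> \<bar>(cdf F x - cdf G x) - (0 - 0)\<bar>) at_bot"
    by (intro tendsto_intros F.cdf_lim_at_bot G.cdf_lim_at_bot)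
  ultimately have "\<bar>(cdf F x - cdf G x) - (0 - 0)\<bar> \<le> c"
    by (intro tendsto_upperbound) auto
  then show ?thesis by simp
qed

section \<open>Convolutions with normal laws and Laplace transforms\<close>

lemma real_distribution_normal_law: "0 < s \<Longrightarrow> real_distribution (normal_law a s)"
  unfolding normal_law_def real_distribution_def real_distribution_axioms_def
  using prob_space_normal_density[of "sqrt s" a] by simp

lemma real_distribution_convolution:
  assumes "real_distribution M" "real_distribution N"
  shows "real_distribution (M \<star> N)"
proof -
  interpret M: real_distribution M by fact
  interpret N: real_distribution N by fact
  interpret P: pair_prob_space M N ..
  show ?thesis unfolding convolution_def
    by (intro P.real_distribution_distr) measurable
qed

lemma real_distribution_finite: "real_distribution M \<Longrightarrow> finite_measure M"
  by (simp add: real_distribution_def prob_space.finite_measure)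

lemma real_distribution_sets: "real_distribution M \<Longrightarrow> sets M = sets borel"
  by (simp add: real_distribution.events_eq_borel)

lemma normal_law_convolution:
  assumes "0 < s" "0 < t"
  shows "(normal_law 0 s \<star> normal_law 0 t) = normal_law 0 (s + t)"
proof -
  note fin = real_distribution_finite[OF real_distribution_normal_law]
  have "(normal_law 0 s \<star> normal_law 0 t) =
      density lborel (\<lambda>x. \<integral>\<^sup>+y. ennreal (normal_density 0 (sqrt s) (x - y)) * ennreal (normal_density 0 (sqrt t) y) \<partial>lborel)"
    using fin[of s 0] fin[of t 0] assms unfolding normal_law_def by (intro convolution_density) auto
  also have "\<dots> = density lborel (\<lambda>x. ennreal (normal_density 0 (sqrt (s + t)) x))"
    using conv_normal_density_zero_mean[of "sqrt s" "sqrt t"] assms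
    by (simp add: ennreal_mult' fun_eq_iff)
  finally show ?thesis by (simp add: normal_law_def)
qed

text \<open>The two-sided Laplace transform at a complex point; the characteristic function is its restriction to
  the imaginary axis.\<close>

definition laplace :: "real measure \<Rightarrow> complex \<Rightarrow> complex" where
  "laplace M z = (CLINT x|M. exp (z * of_real x))"

lemma char_eq_laplace: "char M t = laplace M (\<i> * of_real t)"
  by (simp add: char_def laplace_def mult.assoc)

text \<open>The modulus of the complex exponential depends on \<open>Re z\<close> only, so integrability is a real question.\<close>

lemma integrable_cexp_iff:
  assumes "real_distribution M"
  shows "integrable M (\<lambda>x. exp (z * complex_of_real x)) \<longleftrightarrow> integrable M (\<lambda>x. exp (Re z * x))"
proof -
  interpret real_distribution M by fact
  have "integrable M (\<lambda>x. exp (z * complex_of_real x)) \<longleftrightarrow> integrable M (\<lambda>x. cmod (exp (z * complex_of_real x)))"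
    by (intro integrable_norm_iff[symmetric]) simp
  then show ?thesis by simp
qed

lemma laplace_convolution:
  assumes M: "real_distribution M" and N: "real_distribution N"
    and int: "integrable M (\<lambda>x. exp (Re z * x))" "integrable N (\<lambda>x. exp (Re z * x))"
  shows "laplace (M \<star> N) z = laplace M z * laplace N z"
    and "integrable (M \<star> N) (\<lambda>x. exp (Re z * x))"
proof -
  interpret M: real_distribution M by fact
  interpret N: real_distribution N by fact
  interpret P: pair_prob_space M N ..
  let ?e = "\<lambda>x. exp (z * complex_of_real x)"
  have intC: "integrable M ?e" "integrable N ?e"
    using int integrable_cexp_iff M N by auto
  have [measurable]: "?e \<in> borel_measurable borel" by simp
  have prod: "integrable (M \<Otimes>\<^sub>M N) (\<lambda>(x, y). ?e x * ?e y)"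
  proof (rule P.Fubini_integrable)
    show "(\<lambda>(x, y). ?e x * ?e y) \<in> borel_measurable (M \<Otimes>\<^sub>M N)" by measurable
    show "integrable M (\<lambda>x. \<integral>y. cmod (case (x, y) of (x, y) \<Rightarrow> ?e x * ?e y) \<partial>N)"
      using int(1) by (simp add: norm_mult)
    show "AE x in M. integrable N (\<lambda>y. case (x, y) of (x, y) \<Rightarrow> ?e x * ?e y)"
      using intC(2) by simp
  qed
  have eq: "(\<lambda>w. ?e (case w of (x, y) \<Rightarrow> x + y)) = (\<lambda>(x, y). ?e x * ?e y)"
    by (auto simp: distrib_left exp_add)
  have meas: "(\<lambda>(x, y). x + y :: real) \<in> measurable (M \<Otimes>\<^sub>M N) borel" by measurable
  have "laplace (M \<star> N) z = (\<integral>w. ?e (case w of (x, y) \<Rightarrow> x + y) \<partial>(M \<Otimes>\<^sub>M N))"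
    unfolding laplace_def convolution_def by (rule integral_distr[OF meas]) simp
  also have "\<dots> = (\<integral>(x, y). ?e x * ?e y \<partial>(M \<Otimes>\<^sub>M N))" by (simp only: eq)
  also have "\<dots> = (\<integral>x. (\<integral>y. ?e x * ?e y \<partial>N) \<partial>M)" using P.integral_fst[OF prod] by simp
  also have "\<dots> = laplace M z * laplace N z" by (simp add: laplace_def)
  finally show "laplace (M \<star> N) z = laplace M z * laplace N z" .
  have "integrable (M \<star> N) ?e"
    unfolding convolution_def by (subst integrable_distr_eq[OF meas]) (simp_all add: eq prod)
  then show "integrable (M \<star> N) (\<lambda>x. exp (Re z * x))"
    using integrable_cexp_iff[OF real_distribution_convolution[OF M N]] by simp
qed

text \<open>Completing the square: tilting a centred normal density by \<open>exp (a x)\<close> shifts it to mean \<open>a s\<close>.\<close>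

lemma normal_density_exp_tilt:
  assumes "0 < s"
  shows "normal_density 0 (sqrt s) x * exp (a * x) = exp (a\<^sup>2 * s / 2) * normal_density (a * s) (sqrt s) x"
proof -
  have "- (x - 0)\<^sup>2 / (2 * (sqrt s)\<^sup>2) + a * x = a\<^sup>2 * s / 2 + - (x - a * s)\<^sup>2 / (2 * (sqrt s)\<^sup>2)"
    using assms by (simp add: field_simps power2_eq_square)
  then show ?thesis unfolding normal_density_def
    by (simp add: mult.left_commute flip: exp_add)
qed

text \<open>For real part \<open>c\<close> and imaginary part \<open>b\<close> of \<open>z\<close>, tilting by \<open>exp (c x)\<close> leaves a shifted normal law,
  whose characteristic function at \<open>b\<close> is known; no contour has to be moved.\<close>

lemma laplace_normal_law:
  assumes s: "0 < s"
  shows "integrable (normal_law 0 s) (\<lambda>x. exp (a * x))"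
    and "laplace (normal_law 0 s) z = exp (of_real s * z\<^sup>2 / 2)"
proof -
  have "integrable lborel (\<lambda>x. normal_density 0 (sqrt s) x * exp (a * x))"
    using s by (simp add: normal_density_exp_tilt)
  then show "integrable (normal_law 0 s) (\<lambda>x. exp (a * x))"
    by (simp add: normal_law_def integrable_density)
  define c b where "c = Re z" and "b = Im z"
  have z: "z = of_real c + \<i> * of_real b" by (simp add: c_def b_def complex_eq)
  have "laplace (normal_law 0 s) z = (\<integral>x. normal_density 0 (sqrt s) x *\<^sub>R exp (z * of_real x) \<partial>lborel)"
    unfolding laplace_def normal_law_def by (subst integral_density) auto
  also have "\<dots> = (\<integral>x. of_real (exp (c\<^sup>2 * s / 2)) * (normal_density (c * s) (sqrt s) x *\<^sub>R iexp (b * x)) \<partial>lborel)"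
  proof (rule Bochner_Integration.integral_cong[OF refl])
    fix x
    have "normal_density 0 (sqrt s) x *\<^sub>R exp (z * of_real x) =
        of_real (normal_density 0 (sqrt s) x * exp (c * x)) * iexp (b * x)"
      by (simp add: z scaleR_conv_of_real exp_add distrib_right exp_of_real mult.assoc flip: exp_of_real)
    then show "normal_density 0 (sqrt s) x *\<^sub>R exp (z * of_real x) =
        of_real (exp (c\<^sup>2 * s / 2)) * (normal_density (c * s) (sqrt s) x *\<^sub>R iexp (b * x))"
      unfolding normal_density_exp_tilt[OF s] by (simp add: scaleR_conv_of_real mult.assoc)
  qed
  also have "\<dots> = of_real (exp (c\<^sup>2 * s / 2)) * (\<integral>x. normal_density (c * s) (sqrt s) x *\<^sub>R iexp (b * x) \<partial>lborel)"
    by (rule integral_mult_right_zero)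
  also have "(\<integral>x. normal_density (c * s) (sqrt s) x *\<^sub>R iexp (b * x) \<partial>lborel) =
     \<bar>sqrt s\<bar> *\<^sub>R (\<integral>y. normal_density (c * s) (sqrt s) (c * s + sqrt s * y) *\<^sub>R iexp (b * (c * s + sqrt s * y)) \<partial>lborel)"
    using s by (intro lborel_integral_real_affine) simp
  also have "\<dots> = (\<integral>y. iexp (b * (c * s)) * (std_normal_density y *\<^sub>R iexp ((b * sqrt s) * y)) \<partial>lborel)"
  proof (subst integral_scaleR_right[symmetric], rule Bochner_Integration.integral_cong[OF refl])
    fix y
    have "sqrt s * normal_density (c * s) (sqrt s) (c * s + sqrt s * y) = std_normal_density y"
      using s by (simp add: normal_density_def real_sqrt_mult power_mult_distrib)
    then show "\<bar>sqrt s\<bar> *\<^sub>R (normal_density (c * s) (sqrt s) (c * s + sqrt s * y) *\<^sub>R iexp (b * (c * s + sqrt s * y)))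
       = iexp (b * (c * s)) * (std_normal_density y *\<^sub>R iexp ((b * sqrt s) * y))"
      using s by (simp add: distrib_left exp_add mult.assoc)
  qed
  also have "\<dots> = iexp (b * (c * s)) * (\<integral>y. (std_normal_density y *\<^sub>R iexp ((b * sqrt s) * y)) \<partial>lborel)"
    by (rule integral_mult_right_zero)
  also have "(\<integral>y. (std_normal_density y *\<^sub>R iexp ((b * sqrt s) * y)) \<partial>lborel) = char std_normal_distribution (b * sqrt s)"
    unfolding char_def by (subst integral_density) auto
  also have "\<dots> = of_real (exp (- (b\<^sup>2 * s) / 2))"
    using s by (simp add: char_std_normal_distribution power_mult_distrib)
  also have "of_real (exp (c\<^sup>2 * s / 2)) * (iexp (b * (c * s)) * of_real (exp (- (b\<^sup>2 * s) / 2))) =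
      exp (of_real s * z\<^sup>2 / 2)"
    unfolding exp_of_real[symmetric] exp_add[symmetric]
    by (rule arg_cong[where f = exp]) (simp add: z power2_eq_square algebra_simps complex_eq_iff)
  finally show "laplace (normal_law 0 s) z = exp (of_real s * z\<^sup>2 / 2)" .
qed

section \<open>Smoothing a difference of distribution functions\<close>

lemma cdf_measurable[measurable]:
  assumes "real_distribution M" shows "cdf M \<in> borel_measurable borel"
  using assms real_distribution.finite_borel_measure_M finite_borel_measure.cdf_nondecreasing
  by (intro borel_measurable_mono monoI) blast

lemma cdf_convolution:
  assumes M: "real_distribution M" and N: "real_distribution N"
  shows "cdf (M \<star> N) x = (\<integral>y. cdf M (x - y) \<partial>N)"
    and "integrable N (\<lambda>y. cdf M (x - y))"
proof -
  interpret M: real_distribution M by fact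
  interpret N: real_distribution N by fact
  note [measurable] = cdf_measurable[OF M]
  show int: "integrable N (\<lambda>y. cdf M (x - y))"
    by (rule N.integrable_const_bound[of _ 1]) (use M.cdf_bounded_prob M.cdf_nonneg in auto)
  have "emeasure (M \<star> N) {..x} = emeasure (N \<star> M) {..x}"
    using real_distribution_finite real_distribution_sets M N by (subst convolution_commutative) auto
  also have "\<dots> = (\<integral>\<^sup>+y. emeasure M {a. a + y \<in> {..x}} \<partial>N)"
    using real_distribution_finite real_distribution_sets M N by (subst convolution_emeasure) auto
  also have "\<dots> = (\<integral>\<^sup>+y. ennreal (cdf M (x - y)) \<partial>N)"
    by (intro nn_integral_cong)
      (auto simp: cdf_def2 M.emeasure_eq_measure algebra_simps intro!: arg_cong[where f = "measure M"])
  also have "\<dots> = ennreal (\<integral>y. cdf M (x - y) \<partial>N)"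
    by (rule nn_integral_eq_integral[OF int]) (simp add: M.cdf_nonneg)
  finally show "cdf (M \<star> N) x = (\<integral>y. cdf M (x - y) \<partial>N)"
    unfolding cdf_def2 measure_def by (simp add: integral_nonneg_AE M.cdf_nonneg)
qed

lemma cdf_convolution_normal_law:
  assumes M: "real_distribution M" and s: "0 < s"
  shows "cdf (M \<star> normal_law 0 s) x = (\<integral>w. cdf M w * normal_density 0 (sqrt s) (x - w) \<partial>lborel)"
    and "integrable lborel (\<lambda>w. cdf M w * normal_density 0 (sqrt s) (x - w))"
proof -
  note [measurable] = cdf_measurable[OF M]
  let ?n = "normal_density 0 (sqrt s)"
  let ?f = "\<lambda>y. ?n y * cdf M (x - y)"
  have int: "integrable lborel ?f"
    using cdf_convolution(2)[OF M real_distribution_normal_law[OF s], of 0 x]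
    unfolding normal_law_def by (subst (asm) integrable_density) auto
  have "cdf (M \<star> normal_law 0 s) x = (\<integral>y. ?f y \<partial>lborel)"
    using cdf_convolution(1)[OF M real_distribution_normal_law[OF s], of 0 x]
    unfolding normal_law_def by (subst (asm) integral_density) auto
  also have "\<dots> = (\<integral>w. ?f (x - w) \<partial>lborel)"
    using lborel_integral_real_affine[of "-1" ?f x] by simp
  finally show "cdf (M \<star> normal_law 0 s) x = (\<integral>w. cdf M w * ?n (x - w) \<partial>lborel)"
    by (simp add: mult.commute)
  show "integrable lborel (\<lambda>w. cdf M w * ?n (x - w))"
    using lborel_integrable_real_affine[OF int, of "-1" x] by (simp add: mult.commute)
qed

lemma cdf_diff_convolution_le:
  assumes M: "real_distribution M" and M': "real_distribution M'" and N: "real_distribution N"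
    and le: "\<And>x. \<bar>cdf M x - cdf M' x\<bar> \<le> c"
  shows "\<bar>cdf (M \<star> N) x - cdf (M' \<star> N) x\<bar> \<le> c"
proof -
  interpret N: real_distribution N by fact
  note i = cdf_convolution(2)[OF M N, of x] cdf_convolution(2)[OF M' N, of x]
  have "\<bar>cdf (M \<star> N) x - cdf (M' \<star> N) x\<bar> = \<bar>\<integral>y. cdf M (x - y) - cdf M' (x - y) \<partial>N\<bar>"
    using i by (simp add: cdf_convolution(1)[OF M N] cdf_convolution(1)[OF M' N])
  also have "\<dots> \<le> (\<integral>y. \<bar>cdf M (x - y) - cdf M' (x - y)\<bar> \<partial>N)" by (rule integral_abs_bound)
  also have "\<dots> \<le> (\<integral>y. c \<partial>N)" using i by (intro integral_mono le) auto
  finally show ?thesis using N.prob_space by simp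
qed

text \<open>The variation of the centred normal density over \<open>(-\<infinity>, x]\<close>: the density increases up to \<open>0\<close> and
  decreases afterwards.\<close>

definition normal_density_variation :: "real \<Rightarrow> real \<Rightarrow> real" where
  "normal_density_variation \<tau> x =
     (if x \<le> 0 then normal_density 0 \<tau> x else 2 * normal_density 0 \<tau> 0 - normal_density 0 \<tau> x)"

lemma normal_density_0_antimono:
  assumes "0 < \<tau>" "\<bar>x\<bar> \<le> \<bar>y\<bar>" shows "normal_density 0 \<tau> y \<le> normal_density 0 \<tau> x"
proof -
  have "x\<^sup>2 \<le> y\<^sup>2" using assms(2) by (simp add: abs_le_square_iff)
  then have "y\<^sup>2 / (2 * \<tau>\<^sup>2) \<ge> x\<^sup>2 / (2 * \<tau>\<^sup>2)" by (intro divide_right_mono) auto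
  then show ?thesis unfolding normal_density_def by (intro mult_left_mono) auto
qed

lemma normal_density_variation:
  assumes \<tau>: "0 < \<tau>"
  shows "y \<le> x \<Longrightarrow> \<bar>normal_density 0 \<tau> x - normal_density 0 \<tau> y\<bar>
            \<le> normal_density_variation \<tau> x - normal_density_variation \<tau> y"
    and "0 \<le> normal_density_variation \<tau> x"
    and "normal_density_variation \<tau> x \<le> 2 / (\<tau> * sqrt (2 * pi))"
proof -
  have le0: "normal_density 0 \<tau> x \<le> normal_density 0 \<tau> 0" for x
    using \<tau> by (intro normal_density_0_antimono) auto
  have n0: "2 * normal_density 0 \<tau> 0 = 2 / (\<tau> * sqrt (2 * pi))"
    using \<tau> by (simp add: normal_density_def real_sqrt_mult mult.commute)
  show "0 \<le> normal_density_variation \<tau> x" "normal_density_variation \<tau> x \<le> 2 / (\<tau> * sqrt (2 * pi))"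
    unfolding n0[symmetric] normal_density_variation_def
    using le0[of x] normal_density_nonneg[of 0 \<tau> x] normal_density_nonneg[of 0 \<tau> 0]
    by (cases "x \<le> 0"; simp only: if_True if_False; linarith)+
  assume "y \<le> x"
  then show "\<bar>normal_density 0 \<tau> x - normal_density 0 \<tau> y\<bar>
            \<le> normal_density_variation \<tau> x - normal_density_variation \<tau> y"
    using normal_density_0_antimono[OF \<tau>, of x y] normal_density_0_antimono[OF \<tau>, of y x] le0[of x] le0[of y]
    by (auto simp: normal_density_variation_def)
qed

lemma normal_density_variation_measurable[measurable]:
  "normal_density_variation \<tau> \<in> borel_measurable borel"
  unfolding normal_density_variation_def by measurable

text \<open>The smoothed difference is \<open>\<integral> D w * n (x - w) dw\<close>, so its increments are dominated by those of
  \<open>\<integral> \<bar>D w\<bar> * U (x - w) dw\<close>, where \<open>U\<close> is the variation function of the normal density \<open>n\<close>.  That function is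
  monotone with total increase at most \<open>\<integral>\<bar>D\<bar>\<close> times the total variation of \<open>n\<close>, which is twice its
  maximum.\<close>

lemma tv_dist_convolution_normal_law_le:
  assumes M: "real_distribution M" and N: "real_distribution N" and s: "0 < s"
    and int: "integrable lborel (\<lambda>w. cdf M w - cdf N w)"
  shows "tv_dist (M \<star> normal_law 0 s) (N \<star> normal_law 0 s)
           \<le> ereal (2 / (sqrt s * sqrt (2 * pi)) * (\<integral>w. \<bar>cdf M w - cdf N w\<bar> \<partial>lborel))"
proof -
  note [measurable] = cdf_measurable[OF M] cdf_measurable[OF N]
  define n U D where "n = normal_density 0 (sqrt s)" and "U = normal_density_variation (sqrt s)"
    and "D = (\<lambda>w. cdf M w - cdf N w)"
  define B where "B = 2 / (sqrt s * sqrt (2 * pi))"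
  have ss: "0 < sqrt s" using s by simp
  note U = normal_density_variation[OF ss, folded n_def U_def B_def]
  have [measurable]: "n \<in> borel_measurable borel" "U \<in> borel_measurable borel" "D \<in> borel_measurable borel"
    by (simp_all add: n_def U_def D_def)
  have intD: "integrable lborel (\<lambda>w. \<bar>D w\<bar>)" using int by (simp add: D_def)
  have intU: "integrable lborel (\<lambda>w. \<bar>D w\<bar> * U (x - w))" for x
  proof (rule Bochner_Integration.integrable_bound[of _ "\<lambda>w. B * \<bar>D w\<bar>"])
    have "\<bar>D w\<bar> * U (x - w) \<le> B * \<bar>D w\<bar>" for w
      using mult_left_mono[OF U(3)[of "x - w"], of "\<bar>D w\<bar>"] by (simp add: mult.commute)
    then show "AE w in lborel. norm (\<bar>D w\<bar> * U (x - w)) \<le> norm (B * \<bar>D w\<bar>)"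
      by (intro AE_I2) (simp add: U(2) order_trans[OF _ abs_ge_self])
  qed (use intD in auto)
  define V where "V = (\<lambda>x. \<integral>w. \<bar>D w\<bar> * U (x - w) \<partial>lborel)"
  have V0: "0 \<le> V x" for x unfolding V_def by (intro integral_nonneg_AE AE_I2) (simp add: U)
  have VB: "V x \<le> B * (\<integral>w. \<bar>D w\<bar> \<partial>lborel)" for x
  proof -
    have "V x \<le> (\<integral>w. B * \<bar>D w\<bar> \<partial>lborel)"
      unfolding V_def using intD
      by (intro integral_mono intU integrable_mult_right) (auto simp: mult.commute[of B] intro!: mult_left_mono U)
    then show ?thesis by simp
  qed
  have intn: "integrable lborel (\<lambda>w. D w * n (x - w))"
    and cdf_eq: "cdf (M \<star> normal_law 0 s) x - cdf (N \<star> normal_law 0 s) x = (\<integral>w. D w * n (x - w) \<partial>lborel)" for x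
    using cdf_convolution_normal_law[OF M s, of x] cdf_convolution_normal_law[OF N s, of x]
    by (auto simp: D_def n_def left_diff_distrib)
  have inc: "\<bar>(\<integral>w. D w * n (x - w) \<partial>lborel) - (\<integral>w. D w * n (y - w) \<partial>lborel)\<bar> \<le> V x - V y" if "y \<le> x" for x y
  proof -
    have "\<bar>(\<integral>w. D w * n (x - w) \<partial>lborel) - (\<integral>w. D w * n (y - w) \<partial>lborel)\<bar>
        = \<bar>\<integral>w. D w * n (x - w) - D w * n (y - w) \<partial>lborel\<bar>"
      using intn by simp
    also have "\<dots> \<le> (\<integral>w. \<bar>D w\<bar> * U (x - w) - \<bar>D w\<bar> * U (y - w) \<partial>lborel)"
    proof (rule integral_abs_bound[THEN order_trans], rule integral_mono)
      fix w
      have "\<bar>D w * n (x - w) - D w * n (y - w)\<bar> = \<bar>D w\<bar> * \<bar>n (x - w) - n (y - w)\<bar>"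
        by (simp add: abs_mult flip: right_diff_distrib)
      also have "\<dots> \<le> \<bar>D w\<bar> * (U (x - w) - U (y - w))"
        using that by (intro mult_left_mono U) auto
      finally show "\<bar>D w * n (x - w) - D w * n (y - w)\<bar> \<le> \<bar>D w\<bar> * U (x - w) - \<bar>D w\<bar> * U (y - w)"
        by (simp add: right_diff_distrib)
    qed (use intn intU in auto)
    also have "\<dots> = V x - V y" unfolding V_def using intU by simp
    finally show ?thesis .
  qed
  have "tv_dist (M \<star> normal_law 0 s) (N \<star> normal_law 0 s) \<le> ereal (B * (\<integral>w. \<bar>D w\<bar> \<partial>lborel))"
  proof (rule tv_dist_le_variation[where V = V])
    show "mono V"
    proof (rule monoI)
      fix x y :: real assume "x \<le> y"
      from inc[OF this] show "V x \<le> V y" by linarith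
    qed
    show "V x - V y \<le> B * (\<integral>w. \<bar>D w\<bar> \<partial>lborel)" for x y using V0[of y] VB[of x] by linarith
    show "\<bar>cdf (M \<star> normal_law 0 s) x - cdf (N \<star> normal_law 0 s) x -
          (cdf (M \<star> normal_law 0 s) y - cdf (N \<star> normal_law 0 s) y)\<bar> \<le> V x - V y" if "y < x" for x y
      unfolding cdf_eq using inc that by simp
  qed
  then show ?thesis by (simp add: B_def D_def)
qed

section \<open>Tails, Chebyshev bounds and Levy inversion\<close>

text \<open>Markov's inequality for a set on which the test function is bounded below; it yields both the
  Chebyshev and the Chernoff tail bounds.\<close>

lemma measure_le_integral_div:
  assumes M: "real_distribution M" and A: "A \<in> sets borel" and h: "integrable M h" "\<And>y. 0 \<le> h y"
    and c: "0 < c" "\<And>y. y \<in> A \<Longrightarrow> c \<le> h y"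
  shows "measure M A \<le> (\<integral>y. h y \<partial>M) / c"
proof -
  interpret real_distribution M by fact
  have [measurable]: "A \<in> sets M" using A by simp
  have i: "integrable M (\<lambda>y. c * indicator A y)"
    by (intro integrable_mult_right integrable_real_indicator) (simp_all add: A emeasure_eq_measure)
  have "c * measure M A = (\<integral>y. c * indicator A y \<partial>M)" by simp
  also have "\<dots> \<le> (\<integral>y. h y \<partial>M)"
    using h(2) c(2) by (intro integral_mono i h(1)) (simp split: split_indicator)
  finally show ?thesis using c by (simp add: pos_le_divide_eq mult.commute)
qed

text \<open>The Heaviside function minus the distribution function is the right tail on the positive axis and minus
  the left tail on the negative one.  This single function makes both tails accessible to one estimate and is
  also what integration by parts produces.\<close>

lemma cdf_tail_eq:
  assumes "real_distribution M"
  shows "x < 0 \<Longrightarrow> indicator {0..} x - cdf M x = - measure M {..x}"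
    and "0 \<le> x \<Longrightarrow> indicator {0..} x - cdf M x = measure M {x<..}"
proof -
  interpret real_distribution M by fact
  have "1 - cdf M x = measure M {x<..}"
    using prob_compl[of "{..x}"] by (simp add: cdf_def2 Compl_eq_Diff_UNIV[symmetric] flip: Compl_atMost)
  then show "x < 0 \<Longrightarrow> indicator {0..} x - cdf M x = - measure M {..x}"
    and "0 \<le> x \<Longrightarrow> indicator {0..} x - cdf M x = measure M {x<..}"
    by (simp_all add: cdf_def2)
qed

text \<open>The two tails have the same sign, so their difference is bounded by the larger one, not by the sum.\<close>

lemma cdf_diff_le_tail:
  assumes "real_distribution M" "real_distribution N"
    and "\<bar>indicator {0..} x - cdf M x\<bar> \<le> c" "\<bar>indicator {0..} x - cdf N x\<bar> \<le> c"
  shows "\<bar>cdf M x - cdf N x\<bar> \<le> c"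
  using assms cdf_tail_eq[OF assms(1), of x] cdf_tail_eq[OF assms(2), of x]
    measure_nonneg[of M "{..x}"] measure_nonneg[of N "{..x}"]
    measure_nonneg[of M "{x<..}"] measure_nonneg[of N "{x<..}"] by linarith

lemma cdf_tail_le_second_moment:
  assumes M: "real_distribution M" and int: "integrable M (\<lambda>x. x\<^sup>2)"
    and le: "(\<integral>x. x\<^sup>2 \<partial>M) \<le> V2" and x: "x \<noteq> 0"
  shows "\<bar>indicator {0..} x - cdf M x\<bar> \<le> V2 / x\<^sup>2"
proof -
  define A where "A = (if x < 0 then {..x} else {x<..})"
  have "measure M A \<le> (\<integral>y. y\<^sup>2 \<partial>M) / x\<^sup>2"
  proof (rule measure_le_integral_div[OF M _ int])
    show "x\<^sup>2 \<le> y\<^sup>2" if "y \<in> A" for y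
      using abs_le_square_iff[of x y] that by (auto simp: A_def split: if_splits)
  qed (use x in \<open>auto simp: A_def\<close>)
  also have "\<dots> \<le> V2 / x\<^sup>2" by (intro divide_right_mono le) simp
  finally show ?thesis using cdf_tail_eq[OF M, of x] by (cases "x < 0") (simp_all add: A_def)
qed

lemma cdf_tail_le_exp:
  assumes M: "real_distribution M" and int: "integrable M (\<lambda>x. exp (w * x))" "integrable M (\<lambda>x. exp (- w * x))"
    and le: "(\<integral>x. exp (w * x) \<partial>M) \<le> B" "(\<integral>x. exp (- w * x) \<partial>M) \<le> B" and w: "0 \<le> w"
  shows "\<bar>indicator {0..} x - cdf M x\<bar> \<le> B * exp (- w * \<bar>x\<bar>)"
proof (cases "x < 0")
  case True
  have "measure M {..x} \<le> (\<integral>y. exp (- w * y) \<partial>M) / exp (- w * x)"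
    by (rule measure_le_integral_div[OF M _ int(2)]) (use w in \<open>auto intro: mult_left_mono\<close>)
  also have "\<dots> \<le> B / exp (- w * x)" by (intro divide_right_mono le) simp
  finally show ?thesis unfolding cdf_tail_eq(1)[OF M True] using True by (simp add: exp_minus field_simps)
next
  case False
  have "measure M {x<..} \<le> (\<integral>y. exp (w * y) \<partial>M) / exp (w * x)"
    by (rule measure_le_integral_div[OF M _ int(1)]) (use w in \<open>auto intro: mult_left_mono\<close>)
  also have "\<dots> \<le> B / exp (w * x)" by (intro divide_right_mono le) simp
  finally show ?thesis unfolding cdf_tail_eq(2)[OF M False[unfolded not_less]] using False by (simp add: exp_minus field_simps)
qed

text \<open>The Cauchy density interpolates between a constant on \<open>[-A, A]\<close> and \<open>1/x\<^sup>2\<close> outside, and so serves as a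
  common majorant in the following lemma.\<close>

lemma integral_cauchy_density:
  fixes A :: real
  assumes A: "0 < A"
  shows "integrable lborel (\<lambda>x. 1 / (A\<^sup>2 + x\<^sup>2))" "(\<integral>x. 1 / (A\<^sup>2 + x\<^sup>2) \<partial>lborel) = pi / A"
proof -
  have ei: "einterval (-\<infinity>) \<infinity> = (UNIV :: real set)" by (auto simp: einterval_def)
  have 1: "integrable lborel (\<lambda>x::real. inverse (1 + x\<^sup>2))"
      "integral\<^sup>L lborel (\<lambda>x::real. inverse (1 + x\<^sup>2)) = pi"
    using integrable_inverse_1_plus_square LBINT_inverse_1_plus_square
    by (simp_all add: set_integrable_def interval_lebesgue_integral_def set_lebesgue_integral_def ei)
  have eq: "inverse (A\<^sup>2) * inverse (1 + (0 + inverse A * x)\<^sup>2) = 1 / (A\<^sup>2 + x\<^sup>2)" for x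
    using A by (simp add: field_simps power2_eq_square)
  have "integrable lborel (\<lambda>x. inverse (A\<^sup>2) * inverse (1 + (0 + inverse A * x)\<^sup>2))"
    by (intro integrable_mult_right lborel_integrable_real_affine 1) (use A in auto)
  then show "integrable lborel (\<lambda>x. 1 / (A\<^sup>2 + x\<^sup>2))" unfolding eq .
  have "pi = \<bar>inverse A\<bar> *\<^sub>R (\<integral>x. inverse (1 + (0 + inverse A * x)\<^sup>2) \<partial>lborel)"
    using lborel_integral_real_affine[of "inverse A" "\<lambda>x. inverse (1 + x\<^sup>2)" 0] A 1 by simp
  also have "\<dots> = A * (\<integral>x. inverse (A\<^sup>2) * inverse (1 + (0 + inverse A * x)\<^sup>2) \<partial>lborel)"
    using A by (simp add: power2_eq_square)
  finally show "(\<integral>x. 1 / (A\<^sup>2 + x\<^sup>2) \<partial>lborel) = pi / A" unfolding eq using A by (simp add: field_simps)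
qed

text \<open>The uniform bound is used on \<open>[-A, A]\<close> and Chebyshev's inequality outside; \<open>A\<close> is free for
  optimisation.\<close>

lemma integral_cdf_diff_le:
  assumes M: "real_distribution M" and N: "real_distribution N"
    and M2: "integrable M (\<lambda>x. x\<^sup>2)" "(\<integral>x. x\<^sup>2 \<partial>M) \<le> V2"
    and N2: "integrable N (\<lambda>x. x\<^sup>2)" "(\<integral>x. x\<^sup>2 \<partial>N) \<le> V2"
    and s: "\<And>x. \<bar>cdf M x - cdf N x\<bar> \<le> s" and A: "0 < A"
  shows "integrable lborel (\<lambda>x. cdf M x - cdf N x)"
    and "(\<integral>x. \<bar>cdf M x - cdf N x\<bar> \<partial>lborel) \<le> 2 * pi * (s * A + V2 / A)"
proof -
  interpret M: real_distribution M by fact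
  interpret N: real_distribution N by fact
  note [measurable] = cdf_measurable[OF M] cdf_measurable[OF N]
  have V2: "0 \<le> V2" using M2(2) by (rule order_trans[rotated]) simp
  have s0: "0 \<le> s" using s[of 0] by simp
  define B where "B = 2 * (s * A\<^sup>2 + V2)"
  have B0: "0 \<le> B" using s0 V2 by (simp add: B_def)
  have bound: "\<bar>cdf M x - cdf N x\<bar> \<le> B * (1 / (A\<^sup>2 + x\<^sup>2))" for x
  proof (cases "\<bar>x\<bar> \<le> A")
    case True
    then have "x\<^sup>2 \<le> A\<^sup>2" using A abs_le_square_iff[of x A] by simp
    then have "s * (A\<^sup>2 + x\<^sup>2) \<le> s * (2 * A\<^sup>2)" using s0 by (intro mult_left_mono) auto
    then have "s * (A\<^sup>2 + x\<^sup>2) \<le> B" using V2 by (simp add: B_def)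
    then have "s \<le> B / (A\<^sup>2 + x\<^sup>2)" using A by (simp add: pos_le_divide_eq add_pos_nonneg)
    then show ?thesis using s[of x] by simp
  next
    case False
    then have x0: "x \<noteq> 0" using A by auto
    have "A\<^sup>2 \<le> x\<^sup>2" using False A abs_le_square_iff[of A x] by simp
    have "\<bar>cdf M x - cdf N x\<bar> \<le> V2 / x\<^sup>2"
      by (intro cdf_diff_le_tail cdf_tail_le_second_moment M N M2 N2 x0)
    also have "\<dots> = (2 * V2) / (2 * x\<^sup>2)" by simp
    also have "\<dots> \<le> B / (A\<^sup>2 + x\<^sup>2)"
      using V2 s0 A x0 \<open>A\<^sup>2 \<le> x\<^sup>2\<close> by (intro frac_le) (auto simp: B_def add_pos_nonneg)
    finally show ?thesis by simp
  qed
  show int: "integrable lborel (\<lambda>x. cdf M x - cdf N x)"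
    by (rule Bochner_Integration.integrable_bound[OF integrable_mult_right[OF integral_cauchy_density(1)[OF A], of B]])
      (use bound B0 in \<open>auto intro!: AE_I2\<close>)
  have "(\<integral>x. \<bar>cdf M x - cdf N x\<bar> \<partial>lborel) \<le> (\<integral>x. B * (1 / (A\<^sup>2 + x\<^sup>2)) \<partial>lborel)"
    using bound int by (intro integral_mono integrable_mult_right integral_cauchy_density[OF A]) auto
  also have "\<dots> = B * (pi / A)" by (simp only: integral_mult_right_zero integral_cauchy_density(2)[OF A])
  also have "\<dots> = 2 * pi * (s * A + V2 / A)" using A by (simp add: B_def field_simps power2_eq_square)
  finally show "(\<integral>x. \<bar>cdf M x - cdf N x\<bar> \<partial>lborel) \<le> 2 * pi * (s * A + V2 / A)" .
qed

text \<open>Levy's inversion formula for both laws, subtracted before taking absolute values: the kernel is at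
  most \<open>2 / \<bar>t\<bar>\<close>, and the left end point of the interval is sent to \<open>-\<infinity>\<close>.\<close>

lemma cdf_diff_le_integral_char_diff:
  assumes M: "real_distribution M" and N: "real_distribution N"
    and M0: "\<And>x. measure M {x} = 0" and N0: "\<And>x. measure N {x} = 0"
    and g: "integrable lborel g" "\<And>t. t \<noteq> 0 \<Longrightarrow> cmod (char M t - char N t) / \<bar>t\<bar> \<le> g t"
  shows "\<bar>cdf M x - cdf N x\<bar> \<le> (\<integral>t. g t \<partial>lborel)"
proof -
  interpret M: real_distribution M by fact
  interpret N: real_distribution N by fact
  note [measurable] = M.char_measurable N.char_measurable
  have main: "\<bar>(cdf M b - cdf M a) - (cdf N b - cdf N a)\<bar> \<le> (\<integral>t. g t \<partial>lborel)" if ab: "a < b" for a b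
  proof -
    define F where "F = (\<lambda>t. (iexp (-(t * a)) - iexp (-(t * b))) / (\<i> * of_real t))"
    have [measurable]: "F \<in> borel_measurable borel" unfolding F_def by measurable
    have F1: "cmod (F t) \<le> b - a" for t
    proof (cases "t = 0")
      case False
      show ?thesis using Levy_Inversion_aux2[of "-b" "-a" t] ab False by (simp add: F_def)
    qed (use ab in \<open>simp add: F_def\<close>)
    have F2: "cmod (F t) \<le> 2 / \<bar>t\<bar>" for t
    proof -
      have "cmod (iexp (-(t * a)) - iexp (-(t * b))) \<le> 1 + 1"
        by (rule order_trans[OF norm_triangle_ineq4 add_mono]) (simp_all add: norm_exp_i_times del: of_real_minus of_real_mult)
      then show ?thesis by (simp add: F_def norm_divide norm_mult divide_right_mono)
    qed
    have int: "interval_lebesgue_integrable lborel (ereal (- T)) (ereal T) (\<lambda>t. F t * char L t)"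
      if "real_distribution L" for L and T :: real
    proof -
      interpret L: real_distribution L by fact
      note [measurable] = L.char_measurable
      have "set_integrable lborel {u<..<v} (\<lambda>t. F t * char L t)" for u v :: real
        unfolding set_integrable_def
      proof (rule Bochner_Integration.integrable_bound[of _ "\<lambda>t. (b - a) * indicator {u<..<v} t"])
        show "AE t in lborel. norm (indicator {u<..<v} t *\<^sub>R (F t * char L t)) \<le> norm ((b - a) * indicator {u<..<v} t)"
        proof (rule AE_I2)
          fix t
          have "cmod (F t * char L t) \<le> (b - a) * 1"
            unfolding norm_mult using ab by (intro mult_mono F1 L.cmod_char_le_1) auto
          then show "norm (indicator {u<..<v} t *\<^sub>R (F t * char L t)) \<le> norm ((b - a) * indicator {u<..<v} t)"
            using ab by (auto simp: indicator_def)
        qed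
      qed (auto intro!: integrable_mult_right integrable_real_indicator emeasure_bounded_finite)
      then show ?thesis by (simp add: interval_lebesgue_integrable_def)
    qed
    define J where "J = (\<lambda>L T. CLBINT t=ereal (- T)..ereal T. F t * char L t)"
    have "(\<lambda>n. 1 / (2 * pi) * J M (real n)) \<longlonglongrightarrow> of_real (measure M {a<..b})"
      "(\<lambda>n. 1 / (2 * pi) * J N (real n)) \<longlonglongrightarrow> of_real (measure N {a<..b})"
      using M.Levy_Inversion[of a b] N.Levy_Inversion[of a b] ab M0 N0 by (simp_all add: J_def F_def)
    from tendsto_diff[OF this]
    have lim: "(\<lambda>n. cmod (1 / (2 * pi) * J M (real n) - 1 / (2 * pi) * J N (real n)))
        \<longlonglongrightarrow> cmod (of_real (measure M {a<..b}) - of_real (measure N {a<..b}))"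
      by (rule tendsto_norm)
    have le: "cmod (1 / (2 * pi) * J M (real n) - 1 / (2 * pi) * J N (real n)) \<le> (\<integral>t. g t \<partial>lborel)" for n
    proof -
      define T where "T = real n"
      have T: "0 \<le> T" by (simp add: T_def)
      have "J M T - J N T = (CLBINT t=ereal (- T)..ereal T. F t * char M t - F t * char N t)"
        unfolding J_def by (rule interval_lebesgue_integral_diff(2)[symmetric]; rule int; fact)
      also have "\<dots> = (\<integral>t. indicator {-T<..<T} t *\<^sub>R (F t * (char M t - char N t)) \<partial>lborel)"
        using T by (simp add: interval_lebesgue_integral_def set_lebesgue_integral_def right_diff_distrib)
      finally have "cmod (J M T - J N T) \<le> (\<integral>t. norm (indicator {-T<..<T} t *\<^sub>R (F t * (char M t - char N t))) \<partial>lborel)"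
        using integral_norm_bound by metis
      also have "\<dots> \<le> (\<integral>t. 2 * g t \<partial>lborel)"
      proof (rule integral_mono_AE')
        have "AE t in lborel. t \<noteq> (0::real)" by (rule AE_lborel_singleton)
        then show "AE t in lborel. norm (indicator {-T<..<T} t *\<^sub>R (F t * (char M t - char N t))) \<le> 2 * g t"
        proof eventually_elim
          case (elim t)
          have "norm (F t * (char M t - char N t)) \<le> (2 / \<bar>t\<bar>) * cmod (char M t - char N t)"
            unfolding norm_mult by (intro mult_right_mono F2) simp
          also have "\<dots> \<le> 2 * g t" using g(2)[OF elim] by simp
          finally show ?case using norm_ge_zero[of "F t * (char M t - char N t)"]
            by (simp add: indicator_def del: norm_ge_zero)
        qed
        have "AE t in lborel. t \<noteq> (0::real)" by (rule AE_lborel_singleton)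
        then show "AE t in lborel. 0 \<le> 2 * g t"
        proof eventually_elim
          case (elim t)
          have "0 \<le> cmod (char M t - char N t) / \<bar>t\<bar>" by simp
          then show ?case using g(2)[OF elim] by linarith
        qed
      qed (use g in auto)
      finally have "cmod (J M T - J N T) \<le> 2 * (\<integral>t. g t \<partial>lborel)" by simp
      moreover have "cmod (1 / (2 * pi) * J M T - 1 / (2 * pi) * J N T) = cmod (J M T - J N T) / (2 * pi)"
        by (simp add: norm_divide flip: diff_divide_distrib)
      ultimately have "cmod (1 / (2 * pi) * J M T - 1 / (2 * pi) * J N T) \<le> 2 * (\<integral>t. g t \<partial>lborel) / (2 * pi)"
        using divide_right_mono[of "cmod (J M T - J N T)" "2 * (\<integral>t. g t \<partial>lborel)" "2 * pi"] by simp
      also have "\<dots> \<le> (\<integral>t. g t \<partial>lborel)"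
      proof -
        have "0 \<le> (\<integral>t. g t \<partial>lborel)"
          using \<open>cmod (J M T - J N T) \<le> 2 * (\<integral>t. g t \<partial>lborel)\<close> norm_ge_zero[of "J M T - J N T"] by linarith
        then have "(\<integral>t. g t \<partial>lborel) * 1 \<le> (\<integral>t. g t \<partial>lborel) * pi"
          using pi_ge_two by (intro mult_left_mono) auto
        then show ?thesis by (simp add: pos_divide_le_eq)
      qed
      finally show ?thesis by (simp add: T_def)
    qed
    have "cmod (of_real (measure M {a<..b}) - of_real (measure N {a<..b})) \<le> (\<integral>t. g t \<partial>lborel)"
      by (rule tendsto_upperbound[OF lim]) (use le in auto)
    then show ?thesis using ab
      by (simp add: M.cdf_diff_eq N.cdf_diff_eq flip: of_real_diff)
  qed
  have "eventually (\<lambda>y. \<bar>(cdf M x - cdf M y) - (cdf N x - cdf N y)\<bar> \<le> (\<integral>t. g t \<partial>lborel)) at_bot"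
    using eventually_at_bot_dense main by blast
  moreover have "((\<lambda>y. \<bar>(cdf M x - cdf M y) - (cdf N x - cdf N y)\<bar>) \<longlongrightarrow> \<bar>(cdf M x - 0) - (cdf N x - 0)\<bar>) at_bot"
    by (intro tendsto_intros M.cdf_lim_at_bot N.cdf_lim_at_bot)
  ultimately have "\<bar>(cdf M x - 0) - (cdf N x - 0)\<bar> \<le> (\<integral>t. g t \<partial>lborel)"
    by (intro tendsto_upperbound) auto
  then show ?thesis by simp
qed

lemma measure_singleton_normal_law:
  assumes "0 < s" shows "emeasure (normal_law a s) {x} = 0"
  unfolding normal_law_def by (subst emeasure_density) (auto intro!: nn_integral_null_set simp: null_sets_def)

lemma measure_singleton_convolution_normal_law:
  assumes M: "real_distribution M" and s: "0 < s"
  shows "measure (M \<star> normal_law a s) {x} = 0"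
proof -
  note N = real_distribution_normal_law[OF s, of a]
  have "emeasure (M \<star> normal_law a s) {x} = (\<integral>\<^sup>+y. emeasure (normal_law a s) {b. b + y \<in> {x}} \<partial>M)"
    using real_distribution_finite real_distribution_sets M N real_distribution.space_eq_univ
    by (subst convolution_emeasure) auto
  also have "\<dots> = (\<integral>\<^sup>+y. emeasure (normal_law a s) {x - y} \<partial>M)"
    by (intro nn_integral_cong arg_cong[where f = "emeasure (normal_law a s)"]) (auto simp: algebra_simps)
  also have "\<dots> = 0" using s by (simp add: measure_singleton_normal_law)
  finally show ?thesis by (simp add: measure_def)
qed

section \<open>Exponential moments of bounded distributions\<close>

lemma (in real_distribution) prob_UNIV: "measure M UNIV = 1"
  using prob_space by simp

locale bounded_distribution = real_distribution M for M :: "real measure" +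
  fixes N :: real
  assumes bounded: "AE x in M. \<bar>x\<bar> \<le> N" and N_nonneg: "0 \<le> N"
begin

lemma integrable_exp_moment:
  "integrable M (\<lambda>x. of_real x ^ k * exp (z * complex_of_real x))"
proof (rule integrable_const_bound)
  show "AE x in M. norm (of_real x ^ k * exp (z * complex_of_real x)) \<le> N ^ k * exp (cmod z * N)"
    using bounded
  proof eventually_elim
    case (elim x)
    have "Re z * x \<le> \<bar>Re z\<bar> * \<bar>x\<bar>" by (metis abs_ge_self abs_mult)
    also have "\<dots> \<le> cmod z * N" using elim abs_Re_le_cmod by (intro mult_mono) auto
    finally show ?case unfolding norm_mult norm_power
      using elim N_nonneg by (intro mult_mono power_mono) auto
  qed
qed simp

lemma integrable_real_exp_moment: "integrable M (\<lambda>x. x ^ k * exp (u * x))"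
  using integrable_Re[OF integrable_exp_moment[of k "of_real u"]]
  by (simp add: exp_of_real flip: of_real_mult of_real_power)

lemmas integrable_moment = integrable_real_exp_moment[of _ 0, simplified]
lemmas integrable_exp = integrable_real_exp_moment[of 0, simplified]

text \<open>The \<open>k\<close>-th derivative of the Laplace transform.\<close>

definition exp_moment :: "nat \<Rightarrow> complex \<Rightarrow> complex" where
  "exp_moment k z = (\<integral>x. of_real x ^ k * exp (z * complex_of_real x) \<partial>M)"

definition real_exp_moment :: "nat \<Rightarrow> real \<Rightarrow> real" where
  "real_exp_moment k u = (\<integral>x. x ^ k * exp (u * x) \<partial>M)"

lemma exp_moment_0: "exp_moment 0 z = laplace M z"
  by (simp add: exp_moment_def laplace_def)

lemma exp_moment_of_real: "exp_moment k (of_real u) = of_real (real_exp_moment k u)"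
  unfolding exp_moment_def real_exp_moment_def
  by (simp add: exp_of_real flip: of_real_mult of_real_power)

text \<open>On a bounded support the second-order Taylor remainder of \<open>exp (h x)\<close> is \<open>O(\<bar>h\<bar>\<^sup>2)\<close> uniformly in \<open>x\<close>, which
  justifies differentiation under the integral sign.\<close>

lemma DERIV_exp_moment: "(exp_moment k has_field_derivative exp_moment (Suc k) z) (at z)"
proof -
  define K where "K = N ^ k * exp (cmod z * N) * (exp N * N\<^sup>2)"
  have K0: "0 \<le> K" using N_nonneg by (simp add: K_def)
  have quot: "cmod ((exp_moment k (z + h) - exp_moment k z) / h - exp_moment (Suc k) z) \<le> K * cmod h"
    if h: "h \<noteq> 0" "cmod h \<le> 1" for h
  proof -
    note i1 = integrable_exp_moment[of k "z + h"] and i2 = integrable_exp_moment[of k z]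
      and i3 = integrable_mult_right[OF integrable_exp_moment[of "Suc k" z], of h]
    have "exp_moment k (z + h) - exp_moment k z - h * exp_moment (Suc k) z =
      (\<integral>x. of_real x ^ k * exp ((z + h) * complex_of_real x) - of_real x ^ k * exp (z * complex_of_real x)
         - h * (of_real x ^ Suc k * exp (z * complex_of_real x)) \<partial>M)"
      unfolding exp_moment_def integral_mult_right_zero[symmetric]
      using Bochner_Integration.integral_diff[OF Bochner_Integration.integrable_diff[OF i1 i2] i3]
        Bochner_Integration.integral_diff[OF i1 i2] by simp
    also have "cmod \<dots> \<le> (\<integral>x. K * (cmod h)\<^sup>2 \<partial>M)"
    proof (rule integral_norm_bound[THEN order_trans], rule integral_mono_AE)
      show "AE x in M. norm (of_real x ^ k * exp ((z + h) * complex_of_real x) - of_real x ^ k * exp (z * complex_of_real x)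
         - h * (of_real x ^ Suc k * exp (z * complex_of_real x))) \<le> K * (cmod h)\<^sup>2"
        using bounded
      proof eventually_elim
        case (elim x)
        define w where "w = h * complex_of_real x"
        have w: "cmod w \<le> cmod h * N" using elim by (simp add: w_def norm_mult mult_left_mono)
        have "Re z * x \<le> \<bar>Re z\<bar> * \<bar>x\<bar>" by (metis abs_ge_self abs_mult)
        also have "\<dots> \<le> cmod z * N" using elim abs_Re_le_cmod by (intro mult_mono) auto
        finally have 1: "cmod (of_real x ^ k * exp (z * complex_of_real x)) \<le> N ^ k * exp (cmod z * N)"
          unfolding norm_mult norm_power using elim N_nonneg by (intro mult_mono power_mono) auto
        have "cmod (exp w - (1 + w)) \<le> exp \<bar>Re w\<bar> * (cmod w)\<^sup>2"
          using Taylor_exp[of w 1] by (simp add: numeral_2_eq_2)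
        also have "\<dots> \<le> exp N * ((cmod h)\<^sup>2 * N\<^sup>2)"
        proof (intro mult_mono)
          have "\<bar>Re w\<bar> \<le> cmod h * N" using w abs_Re_le_cmod[of w] by linarith
          also have "\<dots> \<le> 1 * N" using h N_nonneg by (intro mult_right_mono)
          finally show "exp \<bar>Re w\<bar> \<le> exp N" by simp
          show "(cmod w)\<^sup>2 \<le> (cmod h)\<^sup>2 * N\<^sup>2" using power_mono[OF w, of 2] by (simp add: power_mult_distrib)
        qed auto
        finally have 2: "cmod (exp w - (1 + w)) \<le> exp N * N\<^sup>2 * (cmod h)\<^sup>2" by (simp add: mult_ac)
        have "of_real x ^ k * exp ((z + h) * complex_of_real x) - of_real x ^ k * exp (z * complex_of_real x)
           - h * (of_real x ^ Suc k * exp (z * complex_of_real x))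
           = of_real x ^ k * exp (z * complex_of_real x) * (exp w - (1 + w))"
          by (simp add: w_def exp_add algebra_simps)
        also have "cmod \<dots> \<le> N ^ k * exp (cmod z * N) * (exp N * N\<^sup>2 * (cmod h)\<^sup>2)"
          unfolding norm_mult[of "_ * _" "_ - _"] by (intro mult_mono 1 2) (use N_nonneg in auto)
        finally show ?case by (simp add: K_def mult_ac)
      qed
    qed (rule integrable_norm[OF Bochner_Integration.integrable_diff[OF Bochner_Integration.integrable_diff[OF i1 i2] i3]], simp)
    finally have "cmod (exp_moment k (z + h) - exp_moment k z - h * exp_moment (Suc k) z) \<le> K * (cmod h)\<^sup>2"
      by (simp add: prob_UNIV)
    then have "cmod (exp_moment k (z + h) - exp_moment k z - h * exp_moment (Suc k) z) / cmod h \<le> K * (cmod h)\<^sup>2 / cmod h"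
      by (rule divide_right_mono) simp
    moreover have "(exp_moment k (z + h) - exp_moment k z) / h - exp_moment (Suc k) z
      = (exp_moment k (z + h) - exp_moment k z - h * exp_moment (Suc k) z) / h"
      using h by (simp add: field_simps)
    ultimately show ?thesis using h by (simp add: norm_divide power2_eq_square)
  qed
  have "((\<lambda>h. (exp_moment k (z + h) - exp_moment k z) / h - exp_moment (Suc k) z) \<longlongrightarrow> 0) (at 0)"
  proof (rule Lim_null_comparison)
    show "\<forall>\<^sub>F h in at 0. norm ((exp_moment k (z + h) - exp_moment k z) / h - exp_moment (Suc k) z) \<le> K * cmod h"
      unfolding eventually_at by (intro exI[of _ 1]) (auto intro!: quot simp: dist_norm)
    show "((\<lambda>h. K * cmod h) \<longlongrightarrow> 0) (at 0)" by (auto intro!: tendsto_eq_intros)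
  qed
  then show ?thesis unfolding DERIV_def by (simp add: LIM_zero_iff)
qed

lemma mgf_le: "(\<integral>x. exp (a * x) \<partial>M) \<le> exp (\<bar>a\<bar> * N)"
proof -
  have ae: "AE x in M. exp (a * x) \<le> exp (\<bar>a\<bar> * N)"
      using bounded
  proof eventually_elim
      case (elim x)
      have "a * x \<le> \<bar>a\<bar> * \<bar>x\<bar>" by (metis abs_ge_self abs_mult)
      also have "\<dots> \<le> \<bar>a\<bar> * N" using elim by (intro mult_left_mono) auto
      finally show ?case by simp
  qed
  have "(\<integral>x. exp (a * x) \<partial>M) \<le> (\<integral>x. exp (\<bar>a\<bar> * N) \<partial>M)"
    by (rule integral_mono_AE[OF integrable_exp _ ae]) simp
  then show ?thesis by (simp add: prob_UNIV)
qed

lemma real_exp_moment_0_pos: "0 < real_exp_moment 0 u"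
proof -
  have "exp (- \<bar>u\<bar> * N) = (\<integral>x. exp (- \<bar>u\<bar> * N) \<partial>M)" by (simp add: prob_UNIV)
  also have "\<dots> \<le> (\<integral>x. exp (u * x) \<partial>M)"
  proof (rule integral_mono_AE)
    show "AE x in M. exp (- \<bar>u\<bar> * N) \<le> exp (u * x)"
      using bounded
    proof eventually_elim
      case (elim x)
      have "\<bar>u * x\<bar> \<le> \<bar>u\<bar> * N" using elim by (simp add: abs_mult mult_left_mono)
      then show ?case by (simp add: abs_le_iff)
    qed
  qed (use integrable_exp in auto)
  finally have "exp (- \<bar>u\<bar> * N) \<le> real_exp_moment 0 u" by (simp add: real_exp_moment_def)
  then show ?thesis using exp_gt_zero less_le_trans by blast
qed

lemma real_exp_moment_at_0: "real_exp_moment k 0 = (\<integral>x. x ^ k \<partial>M)"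
  by (simp add: real_exp_moment_def)

text \<open>The variance of the law tilted by \<open>exp (u x)\<close> is nonnegative.  Equivalently, the logarithm of the
  Laplace transform is convex on the real axis.\<close>

lemma real_exp_moment_Cauchy_Schwarz:
  "(real_exp_moment 1 u)\<^sup>2 \<le> real_exp_moment 2 u * real_exp_moment 0 u"
proof -
  define l where "l = (\<lambda>k. real_exp_moment k u)"
  define c where "c = l 1 / l 0"
  have l0: "0 < l 0" by (simp add: l_def real_exp_moment_0_pos)
  have "0 \<le> (\<integral>x. (x - c)\<^sup>2 * exp (u * x) \<partial>M)" by (intro integral_nonneg_AE) auto
  also have "\<dots> = (\<integral>x. x ^ 2 * exp (u * x) - 2 * c * (x ^ 1 * exp (u * x)) + c\<^sup>2 * (x ^ 0 * exp (u * x)) \<partial>M)"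
    by (intro Bochner_Integration.integral_cong) (auto simp: power2_eq_square algebra_simps)
  also have "\<dots> = l 2 - 2 * c * l 1 + c\<^sup>2 * l 0"
    unfolding l_def real_exp_moment_def
    using integrable_real_exp_moment[of 2 u] integrable_real_exp_moment[of 1 u] integrable_real_exp_moment[of 0 u]
    by simp
  also have "\<dots> = (l 2 * l 0 - (l 1)\<^sup>2) / l 0" using l0 by (simp add: c_def field_simps power2_eq_square)
  finally show ?thesis using l0 by (simp add: l_def zero_le_divide_iff)
qed

text \<open>The ridge property: on vertical lines the modulus is largest on the real axis.\<close>

lemma norm_laplace_le: "cmod (laplace M z) \<le> real_exp_moment 0 (Re z)"
  unfolding laplace_def real_exp_moment_def
  by (rule integral_norm_bound[THEN order_trans]) simp

text \<open>Jensen's inequality, by integrating the tangent line of the exponential at the mean.\<close>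

lemma exp_mean_le_real_exp_moment: "exp (u * (\<integral>x. x \<partial>M)) \<le> real_exp_moment 0 u"
proof -
  define m where "m = (\<integral>x. x \<partial>M)"
  have im: "integrable M (\<lambda>x. x)" using integrable_moment[of 1] by simp
  have "exp (u * m) = (\<integral>x. exp (u * m) * (1 + u * (x - m)) \<partial>M)"
    using im by (simp add: prob_UNIV m_def)
  also have "\<dots> \<le> (\<integral>x. exp (u * x) \<partial>M)"
  proof (rule integral_mono)
    fix x
    have "exp (u * m) * (1 + u * (x - m)) \<le> exp (u * m) * exp (u * (x - m))"
      by (intro mult_left_mono exp_ge_add_one_self) auto
    also have "\<dots> = exp (u * x)" by (simp add: algebra_simps flip: exp_add)
    finally show "exp (u * m) * (1 + u * (x - m)) \<le> exp (u * x)" .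
  qed (use im integrable_exp in auto)
  finally show ?thesis by (simp add: real_exp_moment_def m_def)
qed

end

section \<open>Truncation\<close>

definition truncation :: "real \<Rightarrow> real measure \<Rightarrow> real measure" where
  "truncation N M = distr M borel (\<lambda>x. if \<bar>x\<bar> \<le> N then x else 0)"

context real_distribution
begin

lemma truncation_map_measurable [measurable]: "(\<lambda>x. if \<bar>x\<bar> \<le> N then x else (0::real)) \<in> measurable M borel"
  by measurable

lemma bounded_distribution_truncation: "0 \<le> N \<Longrightarrow> bounded_distribution (truncation N M) N"
  unfolding bounded_distribution_def bounded_distribution_axioms_def truncation_def
  by (auto simp: AE_distr_iff)

lemma integral_truncation:
  fixes f :: "real \<Rightarrow> 'b :: {banach, second_countable_topology}"
  assumes "f \<in> borel_measurable borel"
  shows "(\<integral>x. f x \<partial>truncation N M) = (\<integral>x. f (if \<bar>x\<bar> \<le> N then x else 0) \<partial>M)"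
  unfolding truncation_def using assms by (subst integral_distr) auto

lemma cdf_truncation_diff_le: "\<bar>cdf (truncation N M) x - cdf M x\<bar> \<le> measure M {y. N < \<bar>y\<bar>}"
proof -
  let ?t = "\<lambda>x. if \<bar>x\<bar> \<le> N then x else (0::real)"
  have S: "{y. ?t y \<le> x} \<in> sets M" "{y. N < \<bar>y\<bar>} \<in> sets M" "{..x} \<in> sets M"
    by (simp_all, measurable)
  have "cdf (truncation N M) x = measure M {y. ?t y \<le> x}"
    unfolding cdf_def2 truncation_def by (subst measure_distr) (auto intro!: arg_cong[where f = "measure M"])
  moreover have "measure M {y. ?t y \<le> x} \<le> measure M ({..x} \<union> {y. N < \<bar>y\<bar>})"
    by (intro finite_measure_mono) (use S in auto)
  moreover have "measure M {..x} \<le> measure M ({y. ?t y \<le> x} \<union> {y. N < \<bar>y\<bar>})"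
    by (intro finite_measure_mono) (use S in auto)
  ultimately show ?thesis unfolding cdf_def2
    using measure_Un_le[OF S(3,2)] measure_Un_le[OF S(1,2)] by linarith
qed

lemma truncation_second_moment_le:
  assumes "integrable M (\<lambda>x. x\<^sup>2)" "0 \<le> N"
  shows "(\<integral>x. x\<^sup>2 \<partial>truncation N M) \<le> (\<integral>x. x\<^sup>2 \<partial>M)"
proof -
  have "(\<integral>x. x\<^sup>2 \<partial>truncation N M) = (\<integral>x. (if \<bar>x\<bar> \<le> N then x else 0)\<^sup>2 \<partial>M)"
    by (intro integral_truncation) simp
  also have "\<dots> \<le> (\<integral>x. x\<^sup>2 \<partial>M)"
  proof (rule integral_mono)
    show "integrable M (\<lambda>x. (if \<bar>x\<bar> \<le> N then x else 0)\<^sup>2)"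
      by (rule Bochner_Integration.integrable_bound[OF assms(1)]) auto
  qed (use assms in auto)
  finally show ?thesis .
qed

text \<open>The mean of the law itself is zero, and on the removed part \<open>\<bar>x\<bar> \<le> x\<^sup>2 / N\<close>.\<close>

lemma truncation_mean_le:
  assumes int: "integrable M (\<lambda>x. x)" "integrable M (\<lambda>x. x\<^sup>2)" and mean: "(\<integral>x. x \<partial>M) = 0" and N: "0 < N"
  shows "\<bar>\<integral>x. x \<partial>truncation N M\<bar> \<le> (\<integral>x. x\<^sup>2 \<partial>M) / N"
proof -
  let ?t = "\<lambda>x. if \<bar>x\<bar> \<le> N then x else (0::real)"
  have it: "integrable M ?t" by (rule Bochner_Integration.integrable_bound[OF int(1)]) auto
  have "(\<integral>x. x \<partial>truncation N M) = (\<integral>x. ?t x \<partial>M) - (\<integral>x. x \<partial>M)"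
    unfolding mean by (subst integral_truncation) simp_all
  also have "\<dots> = (\<integral>x. ?t x - x \<partial>M)"
    by (rule Bochner_Integration.integral_diff[symmetric, OF it int(1)])
  finally have eq: "(\<integral>x. x \<partial>truncation N M) = (\<integral>x. ?t x - x \<partial>M)" .
  have "\<bar>\<integral>x. x \<partial>truncation N M\<bar> \<le> (\<integral>x. \<bar>?t x - x\<bar> \<partial>M)" unfolding eq by (rule integral_abs_bound)
  also have "\<dots> \<le> (\<integral>x. x\<^sup>2 / N \<partial>M)"
  proof (rule integral_mono)
    fix x
    show "\<bar>?t x - x\<bar> \<le> x\<^sup>2 / N"
    proof (cases "\<bar>x\<bar> \<le> N")
      case False
      then have "\<bar>x\<bar> * N \<le> \<bar>x\<bar> * \<bar>x\<bar>" by (intro mult_left_mono) linarith+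
      then have "\<bar>x\<bar> * N \<le> x\<^sup>2" by (simp only: abs_mult_self_eq power2_eq_square)
      then have "\<bar>x\<bar> \<le> x\<^sup>2 / N" by (simp only: pos_le_divide_eq[OF N])
      then show ?thesis using False by simp
    qed (use N in simp)
    show "integrable M (\<lambda>x. \<bar>?t x - x\<bar>)"
      by (rule integrable_abs) (rule Bochner_Integration.integrable_diff[OF it int(1)])
    show "integrable M (\<lambda>x. x\<^sup>2 / N)" by (rule integrable_divide) (rule int)
  qed
  finally show ?thesis by simp
qed

text \<open>The factor \<open>\<bar>t\<bar>\<close> makes the bound integrable against \<open>1 / \<bar>t\<bar>\<close> near \<open>0\<close>.  It comes with the truncated first
  absolute moment, which the inequality of arithmetic and geometric means splits into the second moment and
  the tail probability, with a free weight \<open>a\<close>.\<close>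

lemma char_truncation_diff_le:
  assumes int: "integrable M (\<lambda>x. x\<^sup>2)" and a: "0 < a"
  shows "cmod (char M t - char (truncation N M) t)
           \<le> \<bar>t\<bar> * (a * (\<integral>x. x\<^sup>2 \<partial>M) + measure M {x. N < \<bar>x\<bar>} / a) / 2"
proof -
  define A where "A = {x::real. N < \<bar>x\<bar>}"
  define f where "f = (\<lambda>x. if \<bar>x\<bar> \<le> N then x else (0::real))"
  have A: "A \<in> sets M" unfolding A_def by (simp, measurable)
  have [measurable]: "f \<in> borel_measurable M" unfolding f_def by measurable
  have i: "integrable M (\<lambda>x. iexp (t * x))" "integrable M (\<lambda>x. iexp (t * f x))"
    by (rule integrable_iexp; measurable)+
  have iA: "integrable M (\<lambda>x. indicator A x / a)"
    by (intro integrable_divide integrable_real_indicator) (simp_all add: A[simplified] emeasure_eq_measure)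
  have i2: "integrable M (\<lambda>x. a * x\<^sup>2)" by (intro integrable_mult_right int)
  have i3: "integrable M (\<lambda>x. \<bar>t\<bar> * (a * x\<^sup>2 + indicator A x / a) / 2)"
    by (intro integrable_divide integrable_mult_right Bochner_Integration.integrable_add i2 iA)
  have "char (truncation N M) t = (\<integral>x. iexp (t * f x) \<partial>M)"
    unfolding char_def f_def by (rule integral_truncation) simp
  then have "char M t - char (truncation N M) t = (\<integral>x. iexp (t * x) - iexp (t * f x) \<partial>M)"
    unfolding char_def using Bochner_Integration.integral_diff[OF i] by simp
  also have "cmod \<dots> \<le> (\<integral>x. \<bar>t\<bar> * (a * x\<^sup>2 + indicator A x / a) / 2 \<partial>M)"
  proof (rule integral_norm_bound[THEN order_trans], rule integral_mono)
    show "integrable M (\<lambda>x. cmod (iexp (t * x) - iexp (t * f x)))"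
      by (rule integrable_norm) (rule Bochner_Integration.integrable_diff[OF i])
    fix x
    show "cmod (iexp (t * x) - iexp (t * f x)) \<le> \<bar>t\<bar> * (a * x\<^sup>2 + indicator A x / a) / 2"
    proof (cases "\<bar>x\<bar> \<le> N")
      case False
      have "cmod (iexp (t * x) - 1) \<le> \<bar>t * x\<bar>" using iexp_approx1[of "t * x" 0] by simp
      also have "\<dots> = \<bar>t\<bar> * \<bar>x\<bar>" by (rule abs_mult)
      also have "\<bar>x\<bar> \<le> (a * x\<^sup>2 + 1 / a) / 2"
      proof -
        have "0 \<le> (a * \<bar>x\<bar> - 1)\<^sup>2 / a" using a by simp
        also have "\<dots> = a * x\<^sup>2 + 1 / a - 2 * \<bar>x\<bar>"
          using a by (simp add: power2_diff power_mult_distrib add_divide_distrib diff_divide_distrib)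
            (simp add: power2_eq_square)
        finally show ?thesis by simp
      qed
      finally have "cmod (iexp (t * x) - 1) \<le> \<bar>t\<bar> * ((a * x\<^sup>2 + 1 / a) / 2)"
        by (simp add: mult_left_mono)
      moreover have "f x = 0" "indicator A x = (1::real)" using False by (simp_all add: f_def A_def)
      ultimately show ?thesis by simp
    next
      case True
      then have "f x = x" by (simp add: f_def)
      then show ?thesis using a by simp
    qed
  qed (rule i3)
  also have "\<dots> = \<bar>t\<bar> * (a * (\<integral>x. x\<^sup>2 \<partial>M) + measure M A / a) / 2"
    unfolding integral_divide_zero integral_mult_right_zero Bochner_Integration.integral_add[OF i2 iA]
    using A by simp
  finally show ?thesis by (simp add: A_def)
qed

end

section \<open>Laplace transforms from distribution functions\<close>

lemma exp_abs_integral: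
  fixes c :: real
  assumes c: "0 < c"
  shows "integrable lborel (\<lambda>r. exp (- c * \<bar>r\<bar>))" "(\<integral>r. exp (- c * \<bar>r\<bar>) \<partial>lborel) = 2 / c"
proof -
  interpret prob_space "density lborel (exponential_density c)" by (rule prob_space_exponential_density[OF c])
  have "(\<integral>\<^sup>+r. ennreal (exponential_density c r) \<partial>lborel) = 1"
    using emeasure_space_1 by (simp add: emeasure_density)
  then have "has_bochner_integral lborel (exponential_density c) 1"
    by (intro has_bochner_integral_nn_integral) (use c in \<open>auto simp: exponential_density_def\<close>)
  from has_bochner_integral_mult_right[OF this, of "1 / c"]
  have "has_bochner_integral lborel (\<lambda>r. indicator {0..} r *\<^sub>R exp (- c * \<bar>r\<bar>)) (1 / c)"
    by (rule has_bochner_integral_cong[THEN iffD1, rotated -1])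
      (use c in \<open>auto simp: exponential_density_def indicator_def mult.commute\<close>)
  then have "has_bochner_integral lborel (\<lambda>r. exp (- c * \<bar>r\<bar>)) (2 *\<^sub>R (1 / c))"
    by (rule has_bochner_integral_even_function) simp
  then show "integrable lborel (\<lambda>r. exp (- c * \<bar>r\<bar>))" "(\<integral>r. exp (- c * \<bar>r\<bar>) \<partial>lborel) = 2 / c"
    by (auto simp: has_bochner_integral_iff)
qed

lemma integral_cexp_between:
  fixes z :: complex and x :: real
  assumes z: "z \<noteq> 0"
  shows "integrable lborel (\<lambda>r. exp (z * of_real r) * of_real (indicator {0..} r - indicator {x..} r))"
    and "(\<integral>r. exp (z * of_real r) * of_real (indicator {0..} r - indicator {x..} r) \<partial>lborel) = (exp (z * of_real x) - 1) / z"
proof -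
  define E where "E = (\<lambda>r. exp (z * complex_of_real r))"
  define k where "k = (\<lambda>r. E r * of_real (indicator {0..} r - indicator {x..} r))"
  have [measurable]: "E \<in> borel_measurable borel" unfolding E_def by measurable
  have k[measurable]: "k \<in> borel_measurable borel" unfolding k_def by measurable
  have FTC: "has_bochner_integral lborel (\<lambda>r. indicator {a..b} r *\<^sub>R E r) (E b / z - E a / z)" if "a \<le> b" for a b
  proof (rule has_bochner_integral_FTC_Icc[OF that])
    show "((\<lambda>r. E r / z) has_vector_derivative E x) (at x within {a..b})" for x
    proof -
      have "((\<lambda>w. exp (z * w) / z) has_field_derivative exp (z * of_real x)) (at (of_real x))"
        using z by (auto intro!: derivative_eq_intros)
      then show ?thesis
        unfolding E_def by (rule has_vector_derivative_real_field[THEN has_vector_derivative_at_within])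
    qed
  qed (auto simp: E_def intro!: continuous_intros)
  have "has_bochner_integral lborel k ((E x - 1) / z)"
  proof (cases "0 \<le> x")
    case True
    have "AE r in lborel. r \<noteq> x" by (rule AE_lborel_singleton)
    then have "AE r in lborel. indicator {0..x} r *\<^sub>R E r = k r"
      by eventually_elim (use True in \<open>auto simp: k_def indicator_def\<close>)
    with FTC[OF True] show ?thesis
      by (subst (asm) has_bochner_integral_cong_AE[where g = k]) (auto simp: E_def diff_divide_distrib)
  next
    case False
    have "AE r in lborel. r \<noteq> 0" by (rule AE_lborel_singleton)
    then have "AE r in lborel. - (indicator {x..0} r *\<^sub>R E r) = k r"
      by eventually_elim (use False in \<open>auto simp: k_def indicator_def\<close>)
    moreover have "has_bochner_integral lborel (\<lambda>r. - (indicator {x..0} r *\<^sub>R E r)) (- (E 0 / z - E x / z))"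
      using False by (intro has_bochner_integral_minus FTC) simp
    ultimately show ?thesis
      by (subst (asm) has_bochner_integral_cong_AE[where g = k]) (auto simp: E_def diff_divide_distrib)
  qed
  then show "integrable lborel (\<lambda>r. exp (z * of_real r) * of_real (indicator {0..} r - indicator {x..} r))"
    and "(\<integral>r. exp (z * of_real r) * of_real (indicator {0..} r - indicator {x..} r) \<partial>lborel) = (exp (z * of_real x) - 1) / z"
    by (simp_all add: has_bochner_integral_iff k_def E_def)
qed


text \<open>By Fubini, as \<open>(exp (z x) - 1) / z\<close> is the integral of \<open>exp (z r)\<close> between \<open>0\<close> and \<open>x\<close>.  The Chernoff
  tails make the double integral absolutely convergent.\<close>

lemma laplace_by_parts:
  assumes M: "real_distribution M" and int: "integrable M (\<lambda>x. exp (w * x))" "integrable M (\<lambda>x. exp (- w * x))"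
    and le: "(\<integral>x. exp (w * x) \<partial>M) \<le> B" "(\<integral>x. exp (- w * x) \<partial>M) \<le> B"
    and z: "z \<noteq> 0" "\<bar>Re z\<bar> < w"
  shows "integrable lborel (\<lambda>r. exp (z * of_real r) * of_real (indicator {0..} r - cdf M r))"
    and "laplace M z = 1 + z * (\<integral>r. exp (z * of_real r) * of_real (indicator {0..} r - cdf M r) \<partial>lborel)"
proof -
  interpret M: real_distribution M by fact
  interpret P: pair_sigma_finite lborel M ..
  note [measurable] = cdf_measurable[OF M]
  define d where "d = w - \<bar>Re z\<bar>"
  have d: "0 < d" using z by (simp add: d_def)
  define k where "k = (\<lambda>r x. exp (z * complex_of_real r) * of_real (indicator {0..} r - indicator {x..} r))"
  have ind: "indicator {x..} r = (if x \<le> r then 1 else 0 :: real)" for x r :: real by (simp add: indicator_def)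
  have [measurable]: "case_prod k \<in> borel_measurable (lborel \<Otimes>\<^sub>M M)"
    unfolding k_def ind by measurable
  have intind: "integrable M (\<lambda>x. indicator {x..} r :: real)" for r
    by (rule M.integrable_const_bound[of _ 1]) (auto simp: ind)
  have cdf: "(\<integral>x. indicator {x..} r \<partial>M) = cdf M r" for r
  proof -
    have "(\<integral>x. indicat_real {x..} r \<partial>M) = (\<integral>x. indicat_real {..r} x \<partial>M)"
      by (intro Bochner_Integration.integral_cong) (auto simp: indicator_def)
    then show ?thesis by (simp add: cdf_def2)
  qed
  have intk: "integrable M (k r)" for r
    unfolding k_def by (intro integrable_mult_right integrable_of_real Bochner_Integration.integrable_diff intind) simp
  have inner: "(\<integral>x. k r x \<partial>M) = exp (z * of_real r) * of_real (indicator {0..} r - cdf M r)" for r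
  proof -
    have "(\<integral>x. k r x \<partial>M) = exp (z * of_real r) * of_real (\<integral>x. indicator {0..} r - indicator {x..} r \<partial>M)"
      unfolding k_def integral_mult_right_zero integral_complex_of_real ..
    also have "(\<integral>x. indicator {0..} r - indicator {x..} r \<partial>M) = indicator {0..} r - cdf M r"
      using intind by (simp add: cdf M.prob_UNIV)
    finally show ?thesis .
  qed
  have norm_inner: "(\<integral>x. cmod (k r x) \<partial>M) = exp (Re z * r) * \<bar>indicator {0..} r - cdf M r\<bar>" for r
  proof -
    define s where "s = (if 0 \<le> r then 1 else -1 :: real)"
    have "(\<integral>x. cmod (k r x) \<partial>M) = (\<integral>x. exp (Re z * r) * (s * (indicator {0..} r - indicator {x..} r)) \<partial>M)"
      by (intro Bochner_Integration.integral_cong) (auto simp: k_def s_def norm_mult indicator_def)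
    also have "\<dots> = exp (Re z * r) * (s * (indicator {0..} r - cdf M r))"
      using intind by (simp add: cdf M.prob_UNIV)
    also have "s * (indicator {0..} r - cdf M r) = \<bar>indicator {0..} r - cdf M r\<bar>"
      using M.cdf_nonneg[of r] M.cdf_bounded_prob[of r] by (auto simp: s_def)
    finally show ?thesis .
  qed
  have tail: "exp (Re z * r) * \<bar>indicator {0..} r - cdf M r\<bar> \<le> B * exp (- d * \<bar>r\<bar>)" for r
  proof -
    have "Re z * r \<le> \<bar>Re z\<bar> * \<bar>r\<bar>" by (metis abs_ge_self abs_mult)
    then have "exp (Re z * r) * \<bar>indicator {0..} r - cdf M r\<bar> \<le> exp (\<bar>Re z\<bar> * \<bar>r\<bar>) * (B * exp (- w * \<bar>r\<bar>))"
      using z by (intro mult_mono cdf_tail_le_exp[OF M int le]) auto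
    also have "\<dots> = B * exp (- d * \<bar>r\<bar>)"
      by (simp add: d_def algebra_simps flip: exp_add)
    finally show ?thesis .
  qed
  have "integrable (lborel \<Otimes>\<^sub>M M) (case_prod k)"
  proof (rule P.Fubini_integrable)
    show "integrable lborel (\<lambda>r. \<integral>x. norm (case (r, x) of (r, x) \<Rightarrow> k r x) \<partial>M)"
      unfolding prod.case norm_inner
    proof (rule Bochner_Integration.integrable_bound[OF integrable_mult_right[OF exp_abs_integral(1)[OF d], of B]])
      have "exp (Re z * r) * \<bar>indicator {0..} r - cdf M r\<bar> \<le> \<bar>B * exp (- d * \<bar>r\<bar>)\<bar>" for r
        using tail[of r] by linarith
      then show "AE r in lborel. norm (exp (Re z * r) * \<bar>indicator {0..} r - cdf M r\<bar>) \<le> norm (B * exp (- d * \<bar>r\<bar>))"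
        by (intro AE_I2) (simp add: abs_mult)
    qed simp
  qed (use intk in simp_all)
  note Fub = P.Fubini_integral[OF this] and int1 = P.integrable_fst[OF this]
  show "integrable lborel (\<lambda>r. exp (z * of_real r) * of_real (indicator {0..} r - cdf M r))"
    using int1 unfolding inner .
  have intz: "integrable M (\<lambda>x. exp (z * complex_of_real x))"
  proof -
    have "integrable M (\<lambda>x. exp (Re z * x))"
    proof (rule Bochner_Integration.integrable_bound[OF Bochner_Integration.integrable_add[OF int]])
      show "AE x in M. norm (exp (Re z * x)) \<le> norm (exp (w * x) + exp (- w * x))"
      proof (rule AE_I2)
        fix x
        have "Re z * x \<le> \<bar>Re z\<bar> * \<bar>x\<bar>" by (metis abs_ge_self abs_mult)
        also have "\<dots> \<le> w * \<bar>x\<bar>" using z by (intro mult_right_mono) auto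
        finally have "exp (Re z * x) \<le> exp (w * \<bar>x\<bar>)" by simp
        also have "\<dots> \<le> exp (w * x) + exp (- w * x)" by (cases "0 \<le> x") auto
        finally show "norm (exp (Re z * x)) \<le> norm (exp (w * x) + exp (- w * x))" by simp
      qed
    qed simp
    then show ?thesis by (simp add: integrable_cexp_iff[OF M])
  qed
  have "(\<integral>r. exp (z * of_real r) * of_real (indicator {0..} r - cdf M r) \<partial>lborel) = (\<integral>x. (\<integral>r. k r x \<partial>lborel) \<partial>M)"
    unfolding inner[symmetric] by (rule Fub[symmetric])
  also have "\<dots> = (\<integral>x. (exp (z * of_real x) - 1) / z \<partial>M)"
    unfolding k_def integral_cexp_between(2)[OF z(1)] ..
  also have "\<dots> = (laplace M z - 1) / z"
    using intz by (simp add: laplace_def M.prob_UNIV)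
  finally show "laplace M z = 1 + z * (\<integral>r. exp (z * of_real r) * of_real (indicator {0..} r - cdf M r) \<partial>lborel)"
    using z(1) by simp
qed

text \<open>The difference \<open>D\<close> of the distribution functions is at most \<open>\<eta>\<close> and at most \<open>B exp (-3 T \<bar>r\<bar>)\<close>, hence at
  most the geometric mean of both.  This keeps half of the smallness of \<open>\<eta>\<close> and still leaves an integrable
  factor \<open>exp (-T \<bar>r\<bar> / 2)\<close> after multiplication with \<open>exp (z r)\<close>.\<close>

lemma laplace_diff_le:
  assumes M: "real_distribution M" and N: "real_distribution N"
    and intM: "integrable M (\<lambda>x. exp (3 * T * x))" "integrable M (\<lambda>x. exp (- (3 * T) * x))"
    and leM: "(\<integral>x. exp (3 * T * x) \<partial>M) \<le> B" "(\<integral>x. exp (- (3 * T) * x) \<partial>M) \<le> B"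
    and intN: "integrable N (\<lambda>x. exp (3 * T * x))" "integrable N (\<lambda>x. exp (- (3 * T) * x))"
    and leN: "(\<integral>x. exp (3 * T * x) \<partial>N) \<le> B" "(\<integral>x. exp (- (3 * T) * x) \<partial>N) \<le> B"
    and \<eta>: "\<And>x. \<bar>cdf M x - cdf N x\<bar> \<le> \<eta>" and z: "cmod z \<le> T" and T: "0 < T"
  shows "cmod (laplace M z - laplace N z) \<le> 4 * sqrt (\<eta> * B)"
proof (cases "z = 0")
  case True
  interpret M: real_distribution M by fact
  interpret N: real_distribution N by fact
  have "0 \<le> (\<integral>x. exp (3 * T * x) \<partial>M)" by simp
  then have "0 \<le> B" using leM(1) by linarith
  moreover have "0 \<le> \<eta>" using \<eta>[of 0] by linarith
  ultimately show ?thesis using True by (simp add: laplace_def M.prob_UNIV N.prob_UNIV)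
next
  case False
  note [measurable] = cdf_measurable[OF M] cdf_measurable[OF N]
  have B: "0 \<le> B"
  proof -
    have "0 \<le> (\<integral>x. exp (3 * T * x) \<partial>M)" by simp
    then show ?thesis using leM(1) by linarith
  qed
  have \<eta>0: "0 \<le> \<eta>" using \<eta>[of 0] by linarith
  have Rez: "\<bar>Re z\<bar> \<le> T" using z abs_Re_le_cmod[of z] by linarith
  then have Rez': "\<bar>Re z\<bar> < 3 * T" using T by linarith
  define JM where "JM = (\<lambda>r. exp (z * of_real r) * of_real (indicator {0..} r - cdf M r))"
  define JN where "JN = (\<lambda>r. exp (z * of_real r) * of_real (indicator {0..} r - cdf N r))"
  note PM = laplace_by_parts[OF M intM leM False Rez', folded JM_def]
    and PN = laplace_by_parts[OF N intN leN False Rez', folded JN_def]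
  have "laplace M z - laplace N z = z * (\<integral>r. JM r - JN r \<partial>lborel)"
    using PM PN by (simp add: algebra_simps)
  also have "cmod \<dots> \<le> T * (\<integral>r. cmod (JM r - JN r) \<partial>lborel)"
    unfolding norm_mult using z T by (intro mult_mono integral_norm_bound) auto
  also have "(\<integral>r. cmod (JM r - JN r) \<partial>lborel) \<le> (\<integral>r. sqrt (\<eta> * B) * exp (- (T / 2) * \<bar>r\<bar>) \<partial>lborel)"
  proof (rule integral_mono)
    show "integrable lborel (\<lambda>r. cmod (JM r - JN r))"
      using PM(1) PN(1) by (intro integrable_norm Bochner_Integration.integrable_diff)
    show "integrable lborel (\<lambda>r. sqrt (\<eta> * B) * exp (- (T / 2) * \<bar>r\<bar>))"
      using T by (intro integrable_mult_right exp_abs_integral) simp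
    fix r
    define D where "D = \<bar>cdf M r - cdf N r\<bar>"
    have "JM r - JN r = exp (z * of_real r) * of_real (cdf N r - cdf M r)"
      by (simp add: JM_def JN_def algebra_simps)
    then have eq: "cmod (JM r - JN r) = exp (Re z * r) * D"
      by (simp add: norm_mult D_def abs_minus_commute flip: of_real_diff)
    have "D \<le> B * exp (- (3 * T) * \<bar>r\<bar>)"
      unfolding D_def using T by (intro cdf_diff_le_tail M N cdf_tail_le_exp intM intN leM leN) auto
    then have "D * D \<le> \<eta> * (B * exp (- (3 * T) * \<bar>r\<bar>))"
      using \<eta>[of r] \<eta>0 by (intro mult_mono) (auto simp: D_def)
    then have "D\<^sup>2 \<le> \<eta> * B * exp (- (3 * T) * \<bar>r\<bar>)" by (simp add: power2_eq_square)
    also have "\<dots> = (sqrt (\<eta> * B) * exp (- (3 * T / 2) * \<bar>r\<bar>))\<^sup>2"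
      using \<eta>0 B by (simp add: power_mult_distrib flip: exp_double)
    finally have D: "D \<le> sqrt (\<eta> * B) * exp (- (3 * T / 2) * \<bar>r\<bar>)"
      by (rule power2_le_imp_le) (use \<eta>0 B in simp)
    have "Re z * r \<le> \<bar>Re z\<bar> * \<bar>r\<bar>" by (metis abs_ge_self abs_mult)
    also have "\<dots> \<le> T * \<bar>r\<bar>" using Rez by (intro mult_right_mono) auto
    finally have "exp (Re z * r) * D \<le> exp (T * \<bar>r\<bar>) * (sqrt (\<eta> * B) * exp (- (3 * T / 2) * \<bar>r\<bar>))"
      using D by (intro mult_mono) (auto simp: D_def)
    also have "\<dots> = sqrt (\<eta> * B) * exp (- (T / 2) * \<bar>r\<bar>)"
      by (simp add: field_simps flip: exp_add)
    finally show "cmod (JM r - JN r) \<le> sqrt (\<eta> * B) * exp (- (T / 2) * \<bar>r\<bar>)" using eq by simp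
  qed
  also have "(\<integral>r. sqrt (\<eta> * B) * exp (- (T / 2) * \<bar>r\<bar>) \<partial>lborel) = sqrt (\<eta> * B) * (4 / T)"
    using exp_abs_integral(2)[of "T / 2"] T by simp
  finally show ?thesis using T by (simp add: mult_left_mono)
qed

section \<open>The logarithm of a zero-free ridge function\<close>

text \<open>\<open>w \<mapsto> w / (2 M - w)\<close> maps the half-plane \<open>Re w < M\<close> to the unit disc and fixes \<open>0\<close>, so Schwarz's lemma
  applies to its composition with \<open>f\<close>.\<close>

lemma Borel_Caratheodory_zero:
  fixes f :: "complex \<Rightarrow> complex"
  assumes hol: "f holomorphic_on ball 0 R" and f0: "f 0 = 0"
    and Re_less: "\<And>z. cmod z < R \<Longrightarrow> Re (f z) < M"
    and z: "cmod z < R"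
  shows "cmod (f z) \<le> 2 * M * cmod z / (R - cmod z)"
proof -
  have R: "0 < R" using z norm_ge_zero le_less_trans by blast
  have M: "0 < M" using Re_less[of 0] f0 R by simp
  define g where "g = (\<lambda>w. f (of_real R * w) / (of_real (2 * M) - f (of_real R * w)))"
  have in_ball: "cmod (of_real R * w) < R" if "cmod w < 1" for w
    using that R by (simp add: norm_mult)
  have den: "of_real (2 * M) - f (of_real R * w) \<noteq> 0" if "cmod w < 1" for w
  proof
    assume "of_real (2 * M) - f (of_real R * w) = 0"
    then have "Re (f (of_real R * w)) = 2 * M" by (metis Re_complex_of_real eq_iff_diff_eq_0)
    then show False using Re_less[OF in_ball[OF that]] M by simp
  qed
  have small: "cmod (f (of_real R * w)) < cmod (of_real (2 * M) - f (of_real R * w))"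
    if "cmod w < 1" for w
  proof -
    define a where "a = f (of_real R * w)"
    have "Re a < M" using Re_less[OF in_ball[OF that]] by (simp add: a_def)
    then have "M * Re a < M * M" using M by simp
    then have "(cmod a)\<^sup>2 < (cmod (of_real (2 * M) - a))\<^sup>2"
      unfolding cmod_power2 by (simp add: power2_eq_square algebra_simps)
    then have "cmod a < cmod (of_real (2 * M) - a)" by (rule power_less_imp_less_base) simp
    then show ?thesis by (simp add: a_def)
  qed
  have "g holomorphic_on ball 0 1"
    unfolding g_def
    by (intro holomorphic_intros holomorphic_on_compose_gen[OF _ hol, unfolded o_def])
       (use in_ball den in \<open>auto simp: dist_norm\<close>)
  moreover have "g 0 = 0" by (simp add: g_def f0)
  moreover have "cmod (g w) < 1" if "cmod w < 1" for w
    using small[OF that] den[OF that] by (simp add: g_def norm_divide)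
  moreover define w where "w = z / of_real R"
  have w: "cmod w < 1" using z R by (simp add: w_def norm_divide)
  ultimately have gw: "cmod (g w) \<le> cmod w" using Schwarz_Lemma(1) by blast
  have zw: "of_real R * w = z" using R by (simp add: w_def)
  have "f z = g w * (of_real (2 * M) - f z)"
    using den[OF w] by (simp add: g_def zw)
  then have "cmod (f z) = cmod (g w) * cmod (of_real (2 * M) - f z)" by (metis norm_mult)
  also have "\<dots> \<le> cmod w * (2 * M + cmod (f z))"
    by (intro mult_mono gw order_trans[OF norm_triangle_ineq4]) (use M in auto)
  finally have "cmod (f z) * (1 - cmod w) \<le> 2 * M * cmod w" by (simp add: algebra_simps)
  then have "cmod (f z) * (R * (1 - cmod w)) \<le> 2 * M * (R * cmod w)"
    using mult_left_mono[of _ _ R] R by (simp add: mult_ac)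
  moreover have "R * cmod w = cmod z" using R by (simp add: w_def norm_divide)
  ultimately have "cmod (f z) * (R - cmod z) \<le> 2 * M * cmod z" by (simp add: algebra_simps)
  then show ?thesis using z by (simp add: pos_le_divide_eq)
qed

lemma higher_deriv_bound_subball:
  assumes hol: "f holomorphic_on ball 0 R" and r: "0 < r" and sub: "cmod z + r < R"
    and B: "\<And>w. cmod w \<le> cmod z + r \<Longrightarrow> cmod (f w) \<le> B"
  shows "cmod ((deriv ^^ n) f z) \<le> fact n * B / r ^ n"
proof -
  have sub': "cball z r \<subseteq> ball 0 R"
  proof
    fix w assume "w \<in> cball z r"
    then have "cmod w \<le> cmod z + r" using norm_triangle_sub[of w z] by (simp add: dist_norm norm_minus_commute)
    then show "w \<in> ball 0 R" using sub by simp
  qed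
  show ?thesis
  proof (rule Cauchy_inequality[OF _ _ r])
    show "f holomorphic_on ball z r" "continuous_on (cball z r) f"
      using sub' hol ball_subset_cball holomorphic_on_imp_continuous_on
      by (blast intro: holomorphic_on_subset continuous_on_subset)+
    show "cmod (f x) \<le> B" if "cmod (z - x) = r" for x
      using B[of x] norm_triangle_sub[of x z] that by (simp add: norm_minus_commute)
  qed
qed


lemma holomorphic_log_on_ball_0:
  assumes hol: "f holomorphic_on ball 0 R" and nz: "\<And>z. cmod z < R \<Longrightarrow> f z \<noteq> 0"
    and f0: "f 0 = 1" and R: "0 < R"
  obtains p where "p holomorphic_on ball 0 R" "p 0 = 0" "\<And>z. cmod z < R \<Longrightarrow> f z = exp (p z)"
proof -
  obtain g where g: "g holomorphic_on ball 0 R" "\<And>z. z \<in> ball 0 R \<Longrightarrow> exp (g z) = f z"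
    using holomorphic_logarithm_exists[OF convex_ball open_ball hol, of 0] nz R by auto
  show ?thesis
  proof (rule that[of "\<lambda>z. g z - g 0"])
    show "f z = exp (g z - g 0)" if "cmod z < R" for z
      using g(2)[of z] g(2)[of 0] that R f0 by (simp add: exp_diff)
  qed (auto intro!: holomorphic_intros g)
qed

text \<open>Here \<open>l0\<close>, \<open>l1\<close>, \<open>l2\<close> are the values of \<open>\<phi>\<close> and its first two derivatives on the real axis.  A single
  application of Borel-Caratheodory on the disc of radius \<open>T\<close> would give a cubic remainder of size
  \<open>\<bar>z\<bar>\<^sup>3 / T\<close>, which is too weak for small \<open>v\<close>.  The extra factor \<open>v\<close> comes from the convexity of \<open>log \<phi>\<close>
  on the real axis: it shows that \<open>log \<phi>\<close> grows at most like \<open>v\<^sup>2 u\<^sup>2\<close> there, and by the ridge property this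
  bounds its real part on a whole disc of radius of order \<open>v T\<close>, to which Borel-Caratheodory is applied a
  second time.\<close>

lemma log_cubic_remainder:
  fixes \<phi> \<phi>1 \<phi>2 :: "complex \<Rightarrow> complex" and l0 l1 l2 :: "real \<Rightarrow> real"
  assumes d1: "\<And>z. (\<phi> has_field_derivative \<phi>1 z) (at z)"
    and d2: "\<And>z. (\<phi>1 has_field_derivative \<phi>2 z) (at z)"
    and re: "\<And>u. \<phi> (of_real u) = of_real (l0 u)" "\<And>u. \<phi>1 (of_real u) = of_real (l1 u)"
      "\<And>u. \<phi>2 (of_real u) = of_real (l2 u)"
    and pos: "\<And>u. 0 < l0 u" and cauchy_schwarz: "\<And>u. (l1 u)\<^sup>2 \<le> l2 u * l0 u"
    and ridge: "\<And>z. cmod (\<phi> z) \<le> l0 (Re z)"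
    and l00: "l0 0 = 1"
    and nz: "\<And>z. cmod z < T \<Longrightarrow> \<phi> z \<noteq> 0"
    and growth: "\<And>u. \<bar>u\<bar> < T \<Longrightarrow> l0 u \<le> exp (T\<^sup>2)"
    and T: "0 < T" and v: "0 < v" "v \<le> 1" and var: "l2 0 - (l1 0)\<^sup>2 \<le> v\<^sup>2"
    and z: "cmod z \<le> v * T / 16"
  shows "\<exists>r. \<phi> z = exp (of_real (l1 0) * z + of_real (l2 0 - (l1 0)\<^sup>2) * z\<^sup>2 / 2 + r) \<and>
             cmod r \<le> 10 ^ 7 * v * cmod z ^ 3 / T"
proof -
  have hol: "\<phi> holomorphic_on A" for A
    using d1 by (meson has_field_derivative_at_within holomorphic_onI field_differentiable_def)
  have \<phi>0: "\<phi> 0 = 1" using re(1)[of 0] l00 by simp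
  obtain p where p: "p holomorphic_on ball 0 T" "p 0 = 0" "\<And>z. cmod z < T \<Longrightarrow> \<phi> z = exp (p z)"
    using holomorphic_log_on_ball_0[OF hol nz \<phi>0 T] by blast
  define D where "D = (\<lambda>i. (deriv ^^ i) p)"
  have D: "(D i has_field_derivative D (Suc i) w) (at w)" if "cmod w < T" for i w
    using has_field_derivative_higher_deriv[OF p(1) open_ball, of w i] that by (simp add: D_def)
  have D0: "D 0 = p" by (simp add: D_def)
  \<comment> \<open>On the real axis \<open>D 2\<close> is the variance of the tilted law, hence nonnegative.\<close>
  have \<phi>1: "\<phi>1 w = D 1 w * \<phi> w" if w: "cmod w < T" for w
  proof -
    have "((\<lambda>z. exp (p z)) has_field_derivative exp (p w) * D 1 w) (at w)"
      using D[OF w, of 0] D0 by (auto intro!: derivative_eq_intros)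
    then have "(\<phi> has_field_derivative exp (p w) * D 1 w) (at w)"
      by (rule has_field_derivative_transform_within_open[where S = "ball 0 T"]) (use w p in auto)
    then show ?thesis using d1[of w] DERIV_unique p(3)[OF w] by (metis mult.commute)
  qed
  have \<phi>2: "\<phi>2 w = (D 2 w + (D 1 w)\<^sup>2) * \<phi> w" if w: "cmod w < T" for w
  proof -
    have "((\<lambda>z. D 1 z * \<phi> z) has_field_derivative D 2 w * \<phi> w + \<phi>1 w * D 1 w) (at w)"
      using DERIV_mult[OF D[OF w, of 1] d1[of w]] by (simp add: numeral_2_eq_2)
    then have "(\<phi>1 has_field_derivative D 2 w * \<phi> w + \<phi>1 w * D 1 w) (at w)"
      by (rule has_field_derivative_transform_within_open[where S = "ball 0 T"]) (use w \<phi>1 in auto)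
    then have "\<phi>2 w = D 2 w * \<phi> w + \<phi>1 w * D 1 w" using d2[of w] DERIV_unique by blast
    then show ?thesis using \<phi>1[OF w] by (simp add: algebra_simps power2_eq_square)
  qed
  define j where "j = (\<lambda>u. l2 u / l0 u - (l1 u / l0 u)\<^sup>2)"
  have l0nz: "l0 u \<noteq> 0" for u using pos[of u] by simp
  have D1u: "D 1 (of_real u) = of_real (l1 u / l0 u)" if "\<bar>u\<bar> < T" for u
    using \<phi>1[of "of_real u"] that by (simp add: re l0nz)
  have D2u: "D 2 (of_real u) = of_real (j u)" if "\<bar>u\<bar> < T" for u
  proof -
    have "D 2 (of_real u) + (D 1 (of_real u))\<^sup>2 = of_real (l2 u / l0 u)"
      using \<phi>2[of "of_real u"] that by (simp add: re l0nz field_simps)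
    then show ?thesis using D1u[OF that] by (simp add: j_def algebra_simps)
  qed
  have j_nonneg: "0 \<le> j u" for u
  proof -
    have "(l1 u)\<^sup>2 / (l0 u)\<^sup>2 \<le> (l2 u * l0 u) / (l0 u)\<^sup>2"
      by (intro divide_right_mono cauchy_schwarz) simp
    then show ?thesis using l0nz[of u] by (simp add: j_def power_divide power2_eq_square)
  qed
  define m where "m = l1 0"
  have j0: "j 0 = l2 0 - m\<^sup>2" by (simp add: j_def l00 m_def)
  have j0_le: "j 0 \<le> v\<^sup>2" using var j0 m_def by simp
  \<comment> \<open>First use of Borel-Caratheodory: \<open>p\<close> is \<open>O(T\<^sup>2)\<close>, so its fourth derivative is \<open>O(T\<^sup>-\<^sup>2)\<close>.\<close>
  have Re_p_le: "Re (p w) \<le> ln (l0 (Re w))" if w: "cmod w < T" for w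
  proof -
    have "exp (Re (p w)) \<le> l0 (Re w)" using ridge[of w] p(3)[OF w] by simp
    then show ?thesis using pos by (simp add: ln_ge_iff)
  qed
  have Re_p_real: "Re (p (of_real u)) = ln (l0 u)" if "\<bar>u\<bar> < T" for u
  proof -
    have "exp (Re (p (of_real u))) = l0 u"
      using p(3)[of "of_real u"] re(1)[of u] that pos[of u] by (metis abs_of_pos norm_exp_eq_Re norm_of_real)
    then show ?thesis by (metis ln_exp)
  qed
  have Re_p_less: "Re (p w) < 2 * T\<^sup>2" if w: "cmod w < T" for w
  proof -
    have "\<bar>Re w\<bar> < T" using w abs_Re_le_cmod[of w] by simp
    then have "ln (l0 (Re w)) \<le> T\<^sup>2" using growth[of "Re w"] pos[of "Re w"] by (metis ln_exp ln_mono exp_gt_zero)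
    then show ?thesis using Re_p_le[OF w] zero_less_power[OF T, of 2] by linarith
  qed
  have p_le: "cmod (p w) \<le> 4 * T\<^sup>2" if "cmod w \<le> T / 2" for w
  proof -
    have "cmod (p w) \<le> 2 * (2 * T\<^sup>2) * cmod w / (T - cmod w)"
      by (rule Borel_Caratheodory_zero[OF p(1,2) Re_p_less]) (use that T in auto)
    also have "\<dots> \<le> 2 * (2 * T\<^sup>2) * (T / 2) / (T - T / 2)"
      by (intro frac_le mult_left_mono) (use that T in auto)
    finally show ?thesis using T by simp
  qed
  have D4_le: "cmod (D 4 w) \<le> 24576 / T\<^sup>2" if "cmod w \<le> T / 4" for w
  proof -
    have "cmod (D 4 w) \<le> fact 4 * (4 * T\<^sup>2) / (T / 4) ^ 4"
      unfolding D_def by (rule higher_deriv_bound_subball[OF p(1)]) (use that T p_le in auto)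
    also have "\<dots> = 24576 / T\<^sup>2" using T by (simp add: fact_numeral field_simps power_numeral_reduce)
    finally show ?thesis .
  qed
  \<comment> \<open>As \<open>j\<close> is nonnegative at both points \<open>\<rho>\<close> and \<open>-\<rho>\<close>, its slope \<open>b\<close> at \<open>0\<close> is at most \<open>O(v\<^sup>2 / \<rho>)\<close>, so \<open>j\<close>
     stays \<open>O(v\<^sup>2)\<close> on \<open>[-\<rho>, \<rho>]\<close>.  The choice of \<open>\<rho>\<close> proportional to \<open>v T\<close> makes the quadratic remainder
     \<open>\<rho>\<^sup>2 / T\<^sup>2\<close> of the same order \<open>v\<^sup>2\<close>.\<close>
  define b where "b = Re (D 3 0)"
  have j_Taylor: "\<bar>j s - (j 0 + b * s)\<bar> \<le> 24576 / T\<^sup>2 * s\<^sup>2" if s: "\<bar>s\<bar> \<le> T / 4" for s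
  proof -
    have "cmod (D (2 + 0) (of_real s) - (\<Sum>i\<le>1. D (2 + i) 0 * (of_real s - 0) ^ i / fact i))
            \<le> 24576 / T\<^sup>2 * cmod (of_real s - 0) ^ Suc 1 / fact 1"
    proof (rule complex_Taylor[where S = "cball 0 (T / 4)" and f = "\<lambda>i. D (2 + i)"])
      show "(D (2 + i) has_field_derivative D (2 + Suc i) x) (at x within cball 0 (T / 4))"
        if "x \<in> cball 0 (T / 4)" for i x
        using D[of x "2 + i"] that T by (auto intro: has_field_derivative_at_within)
    qed (use s T D4_le in \<open>auto simp: numeral_eq_Suc\<close>)
    then have "cmod (of_real (j s) - (of_real (j 0) + D 3 0 * of_real s)) \<le> 24576 / T\<^sup>2 * s\<^sup>2"
      using D2u[of s] D2u[of 0] s T by (simp add: numeral_eq_Suc)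
    moreover have "\<bar>Re (of_real (j s) - (of_real (j 0) + D 3 0 * of_real s))\<bar>
       \<le> cmod (of_real (j s) - (of_real (j 0) + D 3 0 * of_real s))" by (rule abs_Re_le_cmod)
    ultimately show ?thesis by (simp add: b_def)
  qed
  define \<rho> where "\<rho> = v * T / 4"
  have \<rho>: "0 < \<rho>" "\<rho> \<le> T / 4" using v T by (simp_all add: \<rho>_def)
  have \<rho>2: "24576 / T\<^sup>2 * \<rho>\<^sup>2 = 1536 * v\<^sup>2" using T by (simp add: \<rho>_def power_divide power_mult_distrib)
  have b_le: "\<bar>b\<bar> * \<rho> \<le> 1537 * v\<^sup>2"
  proof -
    have "\<bar>j \<rho> - (j 0 + b * \<rho>)\<bar> \<le> 1536 * v\<^sup>2" "\<bar>j (-\<rho>) - (j 0 - b * \<rho>)\<bar> \<le> 1536 * v\<^sup>2"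
      using j_Taylor[of \<rho>] j_Taylor[of "-\<rho>"] \<rho> by (simp_all add: \<rho>2[simplified])
    then have "\<bar>b * \<rho>\<bar> \<le> 1537 * v\<^sup>2"
      using j_nonneg[of \<rho>] j_nonneg[of "-\<rho>"] j0_le by linarith
    then show ?thesis using \<rho> by (simp add: abs_mult)
  qed
  have j_le: "j s \<le> 3074 * v\<^sup>2" if s: "\<bar>s\<bar> \<le> \<rho>" for s
  proof -
    have "s\<^sup>2 \<le> \<rho>\<^sup>2" using s abs_le_square_iff[of s \<rho>] \<rho> by simp
    then have "24576 / T\<^sup>2 * s\<^sup>2 \<le> 24576 / T\<^sup>2 * \<rho>\<^sup>2" by (intro mult_left_mono) auto
    moreover have "b * s \<le> \<bar>b\<bar> * \<rho>" 
    proof -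
      have "b * s \<le> \<bar>b\<bar> * \<bar>s\<bar>" by (metis abs_ge_self abs_mult)
      also have "\<dots> \<le> \<bar>b\<bar> * \<rho>" using s by (intro mult_left_mono) auto
      finally show ?thesis .
    qed
    ultimately show ?thesis using j_Taylor[of s] s \<rho> \<rho>2 b_le j0_le by linarith
  qed
  have Re_p_quad: "Re (p (of_real u)) \<le> m * u + 3074 * v\<^sup>2 * u\<^sup>2" if u: "\<bar>u\<bar> \<le> \<rho>" for u
  proof -
    have seg: "\<exists>t. x = of_real (t * u) \<and> 0 \<le> t \<and> t \<le> 1" if "x \<in> closed_segment 0 (of_real u)" for x :: complex
      using that by (auto simp: closed_segment_def scaleR_conv_of_real)
    have cm: "cmod x \<le> \<rho>" if "x \<in> closed_segment 0 (of_real u)" for x :: complex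
    proof -
      obtain t where "x = of_real (t * u)" "0 \<le> t" "t \<le> 1" using seg \<open>x \<in> _\<close> by blast
      then show ?thesis using u mult_left_le_one_le[of "\<bar>u\<bar>" t] by (simp add: norm_mult abs_mult)
    qed
    obtain x where x: "x \<in> closed_segment 0 (of_real u)"
      "Re (D 0 (of_real u)) = Re ((\<Sum>i = 0..1. D i 0 * (of_real u - 0) ^ i / fact i)
          + D (Suc 1) x * (of_real u - x) ^ 1 / fact 1 * (of_real u - 0))"
      using complex_Taylor_mvt[of 0 "of_real u" 1 D] D cm \<rho> T by force
    obtain t where t: "x = of_real (t * u)" "0 \<le> t" "t \<le> 1" using seg x(1) by blast
    have tu: "\<bar>t * u\<bar> \<le> \<rho>" using cm[OF x(1)] t by (simp add: norm_mult abs_mult)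
    have D2x: "D (Suc 1) x = of_real (j (t * u))" using D2u[of "t * u"] tu \<rho> T t by (simp add: numeral_2_eq_2)
    have "D 1 0 = of_real m" using D1u[of 0] T by (simp add: m_def l00)
    then have "Re (p (of_real u)) = m * u + j (t * u) * ((1 - t) * u\<^sup>2)"
      using x(2) D2x by (simp add: D0 p(2) t(1) algebra_simps power2_eq_square)
    moreover have "j (t * u) * ((1 - t) * u\<^sup>2) \<le> (3074 * v\<^sup>2) * (1 * u\<^sup>2)"
      by (intro mult_mono j_le tu mult_right_mono) (use t in auto)
    ultimately show ?thesis by simp
  qed
  \<comment> \<open>The linear term is removed first, since the mean need not be of order \<open>v\<^sup>2 \<rho>\<close>.\<close>
  define q where "q = (\<lambda>w. p w - of_real m * w)"
  have holq: "q holomorphic_on ball 0 \<rho>"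
    unfolding q_def by (intro holomorphic_intros holomorphic_on_subset[OF p(1)]) (use \<rho> T in auto)
  have Re_q_less: "Re (q w) < 6148 * v\<^sup>2 * \<rho>\<^sup>2" if w: "cmod w < \<rho>" for w
  proof -
    have u: "\<bar>Re w\<bar> < \<rho>" using w abs_Re_le_cmod[of w] by simp
    then have u2: "(Re w)\<^sup>2 \<le> \<rho>\<^sup>2" using abs_le_square_iff[of "Re w" \<rho>] \<rho> by simp
    have "Re (p w) \<le> Re (p (of_real (Re w)))"
      using Re_p_le[of w] Re_p_real[of "Re w"] w u \<rho> T by simp
    also have "\<dots> \<le> m * Re w + 3074 * v\<^sup>2 * (Re w)\<^sup>2" using Re_p_quad u by simp
    also have "\<dots> \<le> m * Re w + 3074 * v\<^sup>2 * \<rho>\<^sup>2" using u2 by (simp add: mult_left_mono)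
    also have "\<dots> < m * Re w + 6148 * v\<^sup>2 * \<rho>\<^sup>2" using v \<rho> by simp
    finally show ?thesis by (simp add: q_def)
  qed
  have q_le: "cmod (q w) \<le> 12296 * v\<^sup>2 * \<rho>\<^sup>2" if "cmod w \<le> \<rho> / 2" for w
  proof -
    have "cmod (q w) \<le> 2 * (6148 * v\<^sup>2 * \<rho>\<^sup>2) * cmod w / (\<rho> - cmod w)"
      by (rule Borel_Caratheodory_zero[OF holq _ Re_q_less]) (use that \<rho> p in \<open>auto simp: q_def\<close>)
    also have "\<dots> \<le> 2 * (6148 * v\<^sup>2 * \<rho>\<^sup>2) * (\<rho> / 2) / (\<rho> - \<rho> / 2)"
      by (intro frac_le mult_left_mono) (use that \<rho> in auto)
    finally show ?thesis using \<rho> by (simp add: mult_ac)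
  qed
  have D3_le: "cmod (D 3 w) \<le> 2 * 10 ^ 7 * v / T" if w: "cmod w \<le> \<rho> / 4" for w
  proof -
    have "(deriv ^^ 3) q w = D 3 w"
      unfolding q_def D_def
      by (subst higher_deriv_diff[where S = "ball 0 \<rho>"])
        (use w \<rho> T in \<open>auto intro!: holomorphic_intros holomorphic_on_subset[OF p(1)]\<close>)
    moreover have "cmod ((deriv ^^ 3) q w) \<le> fact 3 * (12296 * v\<^sup>2 * \<rho>\<^sup>2) / (\<rho> / 4) ^ 3"
      by (rule higher_deriv_bound_subball[OF holq]) (use w \<rho> q_le in auto)
    moreover have "fact 3 * (12296 * v\<^sup>2 * \<rho>\<^sup>2) / (\<rho> / 4) ^ 3 = 18886656 * v / T"
      using v T by (simp add: \<rho>_def fact_numeral field_simps power_numeral_reduce)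
    moreover have "18886656 * v / T \<le> 2 * 10 ^ 7 * v / T" using v T by (intro divide_right_mono) auto
    ultimately show ?thesis by simp
  qed
  have zr: "cmod z \<le> \<rho> / 4" using z by (simp add: \<rho>_def)
  have zT: "cmod z < T" using zr \<rho> T by simp
  have "cmod (D 0 z - (\<Sum>i\<le>2. D i 0 * (z - 0) ^ i / fact i)) \<le> (2 * 10 ^ 7 * v / T) * cmod (z - 0) ^ Suc 2 / fact 2"
  proof (rule complex_Taylor[where S = "cball 0 (\<rho> / 4)" and f = D])
    show "(D i has_field_derivative D (Suc i) x) (at x within cball 0 (\<rho> / 4))"
      if "x \<in> cball 0 (\<rho> / 4)" for i x
      using D[of x i] that \<rho> T by (auto intro: has_field_derivative_at_within)
  qed (use \<rho> zr D3_le in \<open>auto simp: numeral_eq_Suc\<close>)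
  moreover have "(\<Sum>i\<le>2. D i 0 * (z - 0) ^ i / fact i) = of_real m * z + of_real (j 0) * z\<^sup>2 / 2"
    using D1u[of 0] D2u[of 0] T by (simp add: numeral_eq_Suc D0 p(2) m_def l00)
  ultimately have "cmod (p z - (of_real m * z + of_real (j 0) * z\<^sup>2 / 2)) \<le> 10 ^ 7 * v * cmod z ^ 3 / T"
    by (simp add: D0 power3_eq_cube numeral_eq_Suc)
  moreover have "\<phi> z = exp (of_real m * z + of_real (j 0) * z\<^sup>2 / 2 + (p z - (of_real m * z + of_real (j 0) * z\<^sup>2 / 2)))"
    using p(3)[OF zT] by simp
  ultimately show ?thesis unfolding j0 m_def by blast
qed

section \<open>Moments and tails of sums\<close>

lemma second_moment_convolution_le:
  assumes M: "real_distribution M" and N: "real_distribution N"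
    and int: "integrable M (\<lambda>x. x\<^sup>2)" "integrable N (\<lambda>x. x\<^sup>2)"
  shows "integrable (M \<star> N) (\<lambda>x. x\<^sup>2)" "(\<integral>x. x\<^sup>2 \<partial>(M \<star> N)) \<le> 2 * (\<integral>x. x\<^sup>2 \<partial>M) + 2 * (\<integral>x. x\<^sup>2 \<partial>N)"
proof -
  interpret M: real_distribution M by fact
  interpret N: real_distribution N by fact
  interpret P: pair_prob_space M N ..
  have meas: "(\<lambda>(x, y). x + y :: real) \<in> measurable (M \<Otimes>\<^sub>M N) borel" by measurable
  have prod: "integrable (M \<Otimes>\<^sub>M N) (\<lambda>(x, y). 2 * x\<^sup>2 + 2 * y\<^sup>2)"
  proof (rule P.Fubini_integrable)
    show "(\<lambda>(x, y). 2 * x\<^sup>2 + 2 * y\<^sup>2) \<in> borel_measurable (M \<Otimes>\<^sub>M N)" by measurable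
    show "integrable M (\<lambda>x. \<integral>y. norm (case (x, y) of (x, y) \<Rightarrow> 2 * x\<^sup>2 + 2 * y\<^sup>2) \<partial>N)"
      using int by (simp add: N.prob_UNIV)
    show "AE x in M. integrable N (\<lambda>y. case (x, y) of (x, y) \<Rightarrow> 2 * x\<^sup>2 + 2 * y\<^sup>2)"
      using int by simp
  qed
  have sq: "(x + y)\<^sup>2 \<le> 2 * x\<^sup>2 + 2 * y\<^sup>2" for x y :: real
    using zero_le_power2[of "x - y"] by (simp add: power2_eq_square algebra_simps)
  have i: "integrable (M \<Otimes>\<^sub>M N) (\<lambda>p. (case p of (x, y) \<Rightarrow> x + y)\<^sup>2)"
    by (rule Bochner_Integration.integrable_bound[OF prod]) (auto simp: sq)
  show "integrable (M \<star> N) (\<lambda>x. x\<^sup>2)"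
    unfolding convolution_def using i by (subst integrable_distr_eq[OF meas]) auto
  have "(\<integral>x. x\<^sup>2 \<partial>(M \<star> N)) = (\<integral>p. (case p of (x, y) \<Rightarrow> x + y)\<^sup>2 \<partial>(M \<Otimes>\<^sub>M N))"
    unfolding convolution_def by (rule integral_distr[OF meas]) simp
  also have "\<dots> \<le> (\<integral>(x, y). 2 * x\<^sup>2 + 2 * y\<^sup>2 \<partial>(M \<Otimes>\<^sub>M N))"
    by (rule integral_mono[OF i prod]) (auto simp: sq)
  also have "\<dots> = (\<integral>x. (\<integral>y. 2 * x\<^sup>2 + 2 * y\<^sup>2 \<partial>N) \<partial>M)" using P.integral_fst[OF prod] by simp
  also have "\<dots> = 2 * (\<integral>x. x\<^sup>2 \<partial>M) + 2 * (\<integral>x. x\<^sup>2 \<partial>N)"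
    using int by (simp add: N.prob_UNIV M.prob_UNIV)
  finally show "(\<integral>x. x\<^sup>2 \<partial>(M \<star> N)) \<le> 2 * (\<integral>x. x\<^sup>2 \<partial>M) + 2 * (\<integral>x. x\<^sup>2 \<partial>N)" .
qed

lemma second_moment_normal_law:
  assumes "0 < s"
  shows "integrable (normal_law 0 s) (\<lambda>x. x\<^sup>2)" "(\<integral>x. x\<^sup>2 \<partial>normal_law 0 s) = s"
proof -
  have "has_bochner_integral lborel (\<lambda>x. normal_density 0 (sqrt s) x * (x - 0) ^ (2 * 1)) (fact (2 * 1) / ((2 / (sqrt s)\<^sup>2) ^ 1 * fact 1))"
    using assms by (intro normal_moment_even) simp
  then have "has_bochner_integral lborel (\<lambda>x. normal_density 0 (sqrt s) x * x\<^sup>2) s"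
    using assms by (simp add: fact_numeral)
  then show "integrable (normal_law 0 s) (\<lambda>x. x\<^sup>2)" "(\<integral>x. x\<^sup>2 \<partial>normal_law 0 s) = s"
    unfolding normal_law_def
    by (auto simp: has_bochner_integral_iff integrable_density integral_density)
qed

lemma laplace_of_real: "laplace M (of_real a) = of_real (\<integral>x. exp (a * x) \<partial>M)"
  unfolding laplace_def by (simp add: exp_of_real flip: of_real_mult)

lemma mgf_convolution:
  assumes "real_distribution M" "real_distribution N"
    and "integrable M (\<lambda>x. exp (a * x))" "integrable N (\<lambda>x. exp (a * x))"
  shows "(\<integral>x. exp (a * x) \<partial>(M \<star> N)) = (\<integral>x. exp (a * x) \<partial>M) * (\<integral>x. exp (a * x) \<partial>N)"
    and "integrable (M \<star> N) (\<lambda>x. exp (a * x))"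
  using laplace_convolution[OF assms(1,2), of "of_real a"] assms(3,4)
  by (simp_all add: laplace_of_real flip: of_real_mult)

lemma mgf_normal_law:
  assumes "0 < s"
  shows "(\<integral>x. exp (a * x) \<partial>normal_law 0 s) = exp (s * a\<^sup>2 / 2)"
proof -
  have "complex_of_real (\<integral>x. exp (a * x) \<partial>normal_law 0 s) = exp (of_real s * (of_real a)\<^sup>2 / 2)"
    using laplace_normal_law(2)[OF assms, of "of_real a"] by (simp only: laplace_of_real)
  also have "of_real s * (of_real a)\<^sup>2 / 2 = complex_of_real (s * a\<^sup>2 / 2)" by simp
  finally show ?thesis unfolding exp_of_real of_real_eq_iff .
qed

text \<open>If \<open>\<bar>x\<bar> > 2 r\<close> and \<open>\<bar>y\<bar> \<le> r\<close> then \<open>\<bar>x + y\<bar> > r\<close>: a summand cannot have much heavier tails than the sum.\<close>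

lemma measure_convolution_ge:
  assumes M: "real_distribution M" and N: "real_distribution N"
  shows "measure M {x. 2 * r < \<bar>x\<bar>} * measure N {y. \<bar>y\<bar> \<le> r} \<le> measure (M \<star> N) {s. r < \<bar>s\<bar>}"
proof -
  interpret M: real_distribution M by fact
  interpret N: real_distribution N by fact
  interpret P: pair_prob_space M N ..
  have [measurable]: "{x. 2 * r < \<bar>x\<bar>} \<in> sets M" "{y. \<bar>y\<bar> \<le> r} \<in> sets N" "{s::real. r < \<bar>s\<bar>} \<in> sets borel"
    by (simp_all, measurable)
  have meas: "(\<lambda>(x, y). x + y :: real) \<in> measurable (M \<Otimes>\<^sub>M N) borel" by measurable
  have "measure M {x. 2 * r < \<bar>x\<bar>} * measure N {y. \<bar>y\<bar> \<le> r}
      = measure (M \<Otimes>\<^sub>M N) ({x. 2 * r < \<bar>x\<bar>} \<times> {y. \<bar>y\<bar> \<le> r})"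
    unfolding measure_def by (subst N.emeasure_pair_measure_Times) (simp_all add: enn2real_mult)
  also have "\<dots> \<le> measure (M \<Otimes>\<^sub>M N) ((\<lambda>(x, y). x + y) -` {s. r < \<bar>s\<bar>} \<inter> space (M \<Otimes>\<^sub>M N))"
    by (intro P.finite_measure_mono measurable_sets[OF meas])
      (auto simp: space_pair_measure, measurable)
  also have "\<dots> = measure (M \<star> N) {s. r < \<bar>s\<bar>}"
    unfolding convolution_def by (rule measure_distr[symmetric]) (use meas in auto)
  finally show ?thesis .
qed

lemma measure_abs_gt_le_cdf_tail:
  assumes "real_distribution M" "0 < r"
  shows "measure M {x. r < \<bar>x\<bar>} \<le> \<bar>indicator {0..} (-r) - cdf M (-r)\<bar> + \<bar>indicator {0..} r - cdf M r\<bar>"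
proof -
  interpret real_distribution M by fact
  have "measure M {x. r < \<bar>x\<bar>} \<le> measure M ({..-r} \<union> {r<..})"
    by (intro finite_measure_mono) auto
  also have "\<dots> \<le> measure M {..-r} + measure M {r<..}" by (intro measure_Un_le) auto
  also have "\<dots> = \<bar>indicator {0..} (-r) - cdf M (-r)\<bar> + \<bar>indicator {0..} r - cdf M r\<bar>"
    using cdf_tail_eq[OF assms(1), of "-r"] cdf_tail_eq[OF assms(1), of r] assms(2) by simp
  finally show ?thesis .
qed

section \<open>Two distributions whose sum is almost normal\<close>

text \<open>The hypotheses of the theorem with \<open>\<epsilon> = exp (-L)\<close>, reduced to Kolmogorov distance.  The lower bound on \<open>L\<close>
  makes \<open>T \<ge> 2\<close>.\<close>

locale near_normal_sum =
  F: real_distribution F + G: real_distribution G for F G :: "real measure" +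
  fixes \<sigma> L :: real
  assumes F_int: "integrable F (\<lambda>x. x)" "integrable F (\<lambda>x. x\<^sup>2)" and F_mean: "(\<integral>x. x \<partial>F) = 0"
    and G_int: "integrable G (\<lambda>x. x)" "integrable G (\<lambda>x. x\<^sup>2)" and G_mean: "(\<integral>x. x \<partial>G) = 0"
    and unit_variance: "(\<integral>x. x\<^sup>2 \<partial>F) + (\<integral>x. x\<^sup>2 \<partial>G) = 1"
    and \<sigma>: "0 < \<sigma>" "\<sigma> \<le> 1" and L: "40000 \<le> L"
    and close: "\<And>x. \<bar>cdf ((F \<star> G) \<star> normal_law 0 (2 * \<sigma>\<^sup>2)) x - cdf (normal_law 0 (1 + 2 * \<sigma>\<^sup>2)) x\<bar> \<le> 2 * exp (- L)"
begin

text \<open>The truncation level \<open>N\<close> is large enough for each normal tail beyond \<open>N / 2\<close> to be at most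
  \<open>exp (-L)\<close>.  The radius \<open>T\<close> is so small that \<open>3 N T = 15 L / 100\<close>, which bounds the exponent of the losses
  in \<open>laplace_product_close\<close>, is well below the gain \<open>L / 2\<close>.\<close>

definition N :: real where "N = 5 * sqrt L"
definition T :: real where "T = sqrt L / 100"

lemma T_ge_2: "2 \<le> T"
proof -
  have "sqrt (200\<^sup>2) \<le> sqrt L" using L by (intro real_sqrt_le_mono) simp
  then show ?thesis by (simp add: T_def)
qed

lemma N_eq: "N = 500 * T" by (simp add: N_def T_def)
lemma L_eq: "L = 10000 * T\<^sup>2" using L by (simp add: T_def power_divide)
lemma N_pos: "0 < N" using N_eq T_ge_2 by simp

lemma F_var_nonneg: "0 \<le> (\<integral>x. x\<^sup>2 \<partial>F)" by simp
lemma G_var_nonneg: "0 \<le> (\<integral>x. x\<^sup>2 \<partial>G)" by simp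
lemma F_var_le_1: "(\<integral>x. x\<^sup>2 \<partial>F) \<le> 1" using unit_variance G_var_nonneg by linarith
lemma G_var_le_1: "(\<integral>x. x\<^sup>2 \<partial>G) \<le> 1" using unit_variance F_var_nonneg by linarith
lemma sigma_square: "0 < \<sigma>\<^sup>2" "\<sigma>\<^sup>2 \<le> 1" using \<sigma> by (auto simp: power_le_one)

lemma normal_variances_pos: "0 < 2 * \<sigma>\<^sup>2" "0 < 1 + 2 * \<sigma>\<^sup>2" using sigma_square by linarith+

lemma distributions: "real_distribution F" "real_distribution G"
  "real_distribution (normal_law 0 (2 * \<sigma>\<^sup>2))" "real_distribution (normal_law 0 (1 + 2 * \<sigma>\<^sup>2))"
  using F.real_distribution_axioms G.real_distribution_axioms
    real_distribution_normal_law[OF normal_variances_pos(1)] real_distribution_normal_law[OF normal_variances_pos(2)] .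

lemma swap: "near_normal_sum G F \<sigma> L"
proof -
  have "(F \<star> G) = (G \<star> F)"
    by (intro convolution_commutative real_distribution_finite real_distribution_sets distributions)
  then show ?thesis using close F_int F_mean G_int G_mean unit_variance \<sigma> L by unfold_locales auto
qed

text \<open>Chernoff's bound for the normal law at \<open>N / 2\<close> with the tilting parameter \<open>5 sqrt L / 6\<close>, which is optimal for
  variance \<open>3\<close>, the largest value of \<open>1 + 2 \<sigma>\<^sup>2\<close>.\<close>

lemma sum_tail_le: "measure ((F \<star> G) \<star> normal_law 0 (2 * \<sigma>\<^sup>2)) {s. N / 2 < \<bar>s\<bar>} \<le> 6 * exp (- L)"
proof -
  let ?S = "(F \<star> G) \<star> normal_law 0 (2 * \<sigma>\<^sup>2)" and ?N = "normal_law 0 (1 + 2 * \<sigma>\<^sup>2)"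
  define w r where "w = 5 * sqrt L / 6" and "r = N / 2"
  have r: "0 < r" using N_pos by (simp add: r_def)
  have w: "0 \<le> w" using L by (simp add: w_def)
  have w2: "w\<^sup>2 = 25 * L / 36" using L by (simp add: w_def power_divide power_mult_distrib)
  have wr: "w * r = 25 * L / 12" using L by (simp add: w_def r_def N_def)
  have s: "0 < 1 + 2 * \<sigma>\<^sup>2" using sigma_square by linarith
  have Chernoff: "exp ((1 + 2 * \<sigma>\<^sup>2) * w\<^sup>2 / 2) * exp (- w * r) \<le> exp (- L)"
  proof -
    have "(1 + 2 * \<sigma>\<^sup>2) * w\<^sup>2 \<le> 3 * w\<^sup>2" using sigma_square by (intro mult_right_mono) auto
    then have "(1 + 2 * \<sigma>\<^sup>2) * w\<^sup>2 / 2 + - w * r \<le> - L" using w2 wr L by linarith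
    then show ?thesis unfolding exp_add[symmetric] exp_le_cancel_iff .
  qed
  have "\<bar>indicator {0..} x - cdf ?N x\<bar> \<le> exp ((1 + 2 * \<sigma>\<^sup>2) * w\<^sup>2 / 2) * exp (- w * \<bar>x\<bar>)" for x
    by (rule cdf_tail_le_exp[OF distributions(4) laplace_normal_law(1)[OF s] laplace_normal_law(1)[OF s]])
      (use w in \<open>simp_all only: mgf_normal_law[OF s] power2_minus order_refl\<close>)
  from order_trans[OF this[of r]] order_trans[OF this[of "-r"]] r Chernoff
  have "\<bar>indicator {0..} r - cdf ?N r\<bar> \<le> exp (- L)" "\<bar>indicator {0..} (-r) - cdf ?N (-r)\<bar> \<le> exp (- L)"
    by simp_all
  then have "\<bar>indicator {0..} r - cdf ?S r\<bar> \<le> 3 * exp (- L)" "\<bar>indicator {0..} (-r) - cdf ?S (-r)\<bar> \<le> 3 * exp (- L)"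
    using close[of r] close[of "-r"] r by linarith+
  then have "measure ?S {s. r < \<bar>s\<bar>} \<le> 6 * exp (- L)"
    using measure_abs_gt_le_cdf_tail[OF real_distribution_convolution[OF real_distribution_convolution] r, OF distributions(1-3)]
    by linarith
  then show ?thesis by (simp add: r_def)
qed

text \<open>The other summands together stay in \<open>[-N/2, N/2]\<close> with probability at least \<open>1/2\<close>, by Chebyshev's inequality.\<close>

lemma F_tail_le: "measure F {x. N < \<bar>x\<bar>} \<le> 12 * exp (- L)"
proof -
  let ?Q = "normal_law 0 (2 * \<sigma>\<^sup>2)"
  let ?H = "G \<star> ?Q"
  have s: "0 < 2 * \<sigma>\<^sup>2" using sigma_square by simp
  note H = real_distribution_convolution[OF distributions(2,3)]
  interpret H: real_distribution ?H by (rule H)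
  have H2: "integrable ?H (\<lambda>x. x\<^sup>2)" "(\<integral>x. x\<^sup>2 \<partial>?H) \<le> 6"
    using second_moment_convolution_le[OF distributions(2,3) G_int(2) second_moment_normal_law(1)[OF s]]
      second_moment_normal_law(2)[OF s] G_var_le_1 sigma_square by simp_all
  have "measure ?H {y. N / 2 < \<bar>y\<bar>} \<le> (\<integral>y. y\<^sup>2 \<partial>?H) / (N / 2)\<^sup>2"
  proof (rule measure_le_integral_div[OF H _ H2(1)])
    show "{y. N / 2 < \<bar>y\<bar>} \<in> sets borel" by measurable
    show "(N / 2)\<^sup>2 \<le> y\<^sup>2" if "y \<in> {y. N / 2 < \<bar>y\<bar>}" for y
      using that N_pos abs_le_square_iff[of "N / 2" y] by simp
  qed (use N_pos in auto)
  also have "\<dots> \<le> 6 / (N / 2)\<^sup>2" using H2 by (intro divide_right_mono) auto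
  also have "\<dots> \<le> 1 / 2"
  proof -
    have "1000 \<le> N" using N_eq T_ge_2 by simp
    then have "1000\<^sup>2 \<le> N\<^sup>2" by (intro power_mono) auto
    then show ?thesis using N_pos by (simp add: power_divide field_simps)
  qed
  finally have "measure ?H {y. N / 2 < \<bar>y\<bar>} \<le> 1 / 2" .
  moreover have "measure ?H {y. \<bar>y\<bar> \<le> N / 2} = 1 - measure ?H {y. N / 2 < \<bar>y\<bar>}"
  proof -
    have "space ?H - {y. N / 2 < \<bar>y\<bar>} = {y. \<bar>y\<bar> \<le> N / 2}" by (auto simp: space_borel)
    moreover have "{y. N / 2 < \<bar>y\<bar>} \<in> sets ?H" by (simp, measurable)
    ultimately show ?thesis using H.prob_compl[of "{y. N / 2 < \<bar>y\<bar>}"] by simp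
  qed
  ultimately have half: "1 / 2 \<le> measure ?H {y. \<bar>y\<bar> \<le> N / 2}" by simp
  have "measure F {x. N < \<bar>x\<bar>} * (1 / 2) \<le> measure F {x. N < \<bar>x\<bar>} * measure ?H {y. \<bar>y\<bar> \<le> N / 2}"
    by (intro mult_left_mono half) simp
  also have "\<dots> \<le> measure (F \<star> ?H) {s. N / 2 < \<bar>s\<bar>}"
    using measure_convolution_ge[OF distributions(1) H, of "N / 2"] by simp
  also have "(F \<star> ?H) = ((F \<star> G) \<star> ?Q)"
    by (intro convolution_associative real_distribution_finite real_distribution_sets distributions)
  finally show ?thesis using sum_tail_le by simp
qed

abbreviation F' :: "real measure" where "F' \<equiv> truncation N F"
abbreviation G' :: "real measure" where "G' \<equiv> truncation N G"

sublocale F': bounded_distribution F' N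
  using F.bounded_distribution_truncation N_pos by simp
sublocale G': bounded_distribution G' N
  using G.bounded_distribution_truncation N_pos by simp

lemma truncated_distributions: "real_distribution F'" "real_distribution G'"
  using F'.real_distribution_axioms G'.real_distribution_axioms .

text \<open>Replacing one summand at a time costs its tail probability, \<open>12 exp (-L)\<close>, in Kolmogorov distance.\<close>

lemma truncated_sum_close:
  "\<bar>cdf ((F' \<star> G') \<star> normal_law 0 (2 * \<sigma>\<^sup>2)) x - cdf (normal_law 0 (1 + 2 * \<sigma>\<^sup>2)) x\<bar> \<le> 26 * exp (- L)"
proof -
  let ?Q = "normal_law 0 (2 * \<sigma>\<^sup>2)"
  have p: "measure F {x. N < \<bar>x\<bar>} \<le> 12 * exp (- L)" "measure G {x. N < \<bar>x\<bar>} \<le> 12 * exp (- L)"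
    by (rule F_tail_le, rule near_normal_sum.F_tail_le[OF swap])
  have cF: "\<bar>cdf F' x - cdf F x\<bar> \<le> 12 * exp (- L)" and cG: "\<bar>cdf G' x - cdf G x\<bar> \<le> 12 * exp (- L)" for x
    using F.cdf_truncation_diff_le[of N x] G.cdf_truncation_diff_le[of N x] p by linarith+
  have comm1: "(F \<star> G') = (G' \<star> F)"
    by (intro convolution_commutative real_distribution_finite real_distribution_sets distributions truncated_distributions)
  have comm2: "(F \<star> G) = (G \<star> F)"
    by (intro convolution_commutative real_distribution_finite real_distribution_sets distributions)
  have "\<bar>cdf ((F' \<star> G') \<star> ?Q) x - cdf ((F \<star> G') \<star> ?Q) x\<bar> \<le> 12 * exp (- L)"
    by (intro cdf_diff_convolution_le real_distribution_convolution distributions truncated_distributions cF)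
  moreover have "\<bar>cdf ((F \<star> G') \<star> ?Q) x - cdf ((F \<star> G) \<star> ?Q) x\<bar> \<le> 12 * exp (- L)"
    unfolding comm1 comm2 by (intro cdf_diff_convolution_le real_distribution_convolution distributions truncated_distributions cG)
  ultimately show ?thesis using close[of x] by linarith
qed

text \<open>The truncated sum is compared with the normal law by \<open>laplace_diff_le\<close>.  The exponential moments of the
  truncated variables are at most \<open>exp (3 T N)\<close> each.  Dividing by the Laplace transform of the normal law
  removes the contribution of \<open>\<sigma>\<close> and costs at most \<open>exp (3 T\<^sup>2 / 2)\<close>.\<close>

lemma laplace_product_close:
  assumes z: "cmod z \<le> T"
  shows "cmod (laplace F' z * laplace G' z * exp (- (z\<^sup>2 / 2)) - 1) \<le> 1 / 2"
proof -
  let ?Q = "normal_law 0 (2 * \<sigma>\<^sup>2)" and ?N = "normal_law 0 (1 + 2 * \<sigma>\<^sup>2)"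
  let ?S = "(F' \<star> G') \<star> ?Q"
  have T: "0 < T" using T_ge_2 by simp
  have s: "0 < 2 * \<sigma>\<^sup>2" "0 < 1 + 2 * \<sigma>\<^sup>2" using sigma_square by linarith+
  note FG = real_distribution_convolution[OF truncated_distributions]
  note S = real_distribution_convolution[OF FG distributions(3)]
  note i = F'.integrable_exp G'.integrable_exp
  note mFG = mgf_convolution[OF truncated_distributions i]
  note mS = mgf_convolution[OF FG distributions(3) mFG(2) laplace_normal_law(1)[OF s(1)]]
  define B where "B = exp (6 * T * N + 14 * T\<^sup>2)"
  have mgfS: "(\<integral>x. exp (a * x) \<partial>?S) \<le> B" if a: "\<bar>a\<bar> = 3 * T" for a
  proof -
    have "\<bar>a\<bar>\<^sup>2 = 9 * T\<^sup>2" unfolding a by (simp add: power_mult_distrib)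
    then have a2: "a\<^sup>2 = 9 * T\<^sup>2" by simp
    have "(\<integral>x. exp (a * x) \<partial>?S) = (\<integral>x. exp (a * x) \<partial>F') * (\<integral>x. exp (a * x) \<partial>G') * exp (2 * \<sigma>\<^sup>2 * a\<^sup>2 / 2)"
      by (simp only: mS mFG mgf_normal_law[OF s(1)])
    also have "\<dots> \<le> exp (\<bar>a\<bar> * N) * exp (\<bar>a\<bar> * N) * exp (9 * T\<^sup>2)"
    proof (intro mult_mono F'.mgf_le G'.mgf_le)
      have "\<sigma>\<^sup>2 * (9 * T\<^sup>2) \<le> 1 * (9 * T\<^sup>2)" by (intro mult_right_mono sigma_square) simp
      then show "exp (2 * \<sigma>\<^sup>2 * a\<^sup>2 / 2) \<le> exp (9 * T\<^sup>2)" by (simp add: a2)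
    qed auto
    also have "\<dots> \<le> B" using a by (simp add: B_def flip: exp_add)
    finally show ?thesis .
  qed
  have mgfN: "(\<integral>x. exp (a * x) \<partial>?N) \<le> B" if a: "\<bar>a\<bar> = 3 * T" for a
  proof -
    have "\<bar>a\<bar>\<^sup>2 = 9 * T\<^sup>2" unfolding a by (simp add: power_mult_distrib)
    then have a2: "a\<^sup>2 = 9 * T\<^sup>2" by simp
    have "(1 + 2 * \<sigma>\<^sup>2) * (9 * T\<^sup>2) \<le> 3 * (9 * T\<^sup>2)" using sigma_square by (intro mult_right_mono) auto
    moreover have "0 \<le> 6 * T * N" using T N_pos by simp
    moreover have "0 \<le> T\<^sup>2" by simp
    ultimately have "(1 + 2 * \<sigma>\<^sup>2) * a\<^sup>2 / 2 \<le> 6 * T * N + 14 * T\<^sup>2" unfolding a2 by linarith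
    then show ?thesis by (simp only: mgf_normal_law[OF s(2)] B_def exp_le_cancel_iff)
  qed
  define e where "e = exp (of_real (1 / 2 + \<sigma>\<^sup>2) * z\<^sup>2)"
  have "cmod (laplace ?S z - laplace ?N z) \<le> 4 * sqrt (26 * exp (- L) * B)"
    by (rule laplace_diff_le[OF S distributions(4) mS(2) mS(2) _ _ laplace_normal_law(1)[OF s(2)] laplace_normal_law(1)[OF s(2)]
        _ _ truncated_sum_close z T])
      (rule mgfS mgfN, use T in simp)+
  moreover have "laplace ?S z = laplace F' z * laplace G' z * exp (- (z\<^sup>2 / 2)) * e"
  proof -
    have "laplace ?S z = laplace F' z * laplace G' z * exp (of_real (2 * \<sigma>\<^sup>2) * z\<^sup>2 / 2)"
      by (simp only: laplace_convolution(1)[OF FG distributions(3) mFG(2) laplace_normal_law(1)[OF s(1)]]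
          laplace_convolution(1)[OF truncated_distributions i] laplace_normal_law(2)[OF s(1)])
    also have "exp (of_real (2 * \<sigma>\<^sup>2) * z\<^sup>2 / 2) = exp (- (z\<^sup>2 / 2)) * e"
      unfolding e_def exp_add[symmetric] by (rule arg_cong[where f = exp]) (simp add: field_simps)
    finally show ?thesis by (simp add: mult.assoc)
  qed
  moreover have "laplace ?N z = e"
    unfolding laplace_normal_law(2)[OF s(2)] e_def by (rule arg_cong[where f = exp]) (simp add: field_simps)
  ultimately have "cmod (laplace F' z * laplace G' z * exp (- (z\<^sup>2 / 2)) * e - e) \<le> 4 * sqrt (26 * exp (- L) * B)"
    by (simp only:)
  moreover have "laplace F' z * laplace G' z * exp (- (z\<^sup>2 / 2)) * e - e
      = (laplace F' z * laplace G' z * exp (- (z\<^sup>2 / 2)) - 1) * e"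
    by (simp only: left_diff_distrib mult_1_left)
  ultimately have "cmod ((laplace F' z * laplace G' z * exp (- (z\<^sup>2 / 2)) - 1) * e) \<le> 4 * sqrt (26 * exp (- L) * B)"
    by (simp only:)
  then have 1: "cmod (laplace F' z * laplace G' z * exp (- (z\<^sup>2 / 2)) - 1) * cmod e \<le> 4 * sqrt (26 * exp (- L) * B)"
    by (simp only: norm_mult)
  have e: "exp (- (3 / 2 * T\<^sup>2)) \<le> cmod e"
  proof -
    have "\<bar>Re (of_real (1 / 2 + \<sigma>\<^sup>2) * z\<^sup>2)\<bar> \<le> cmod (of_real (1 / 2 + \<sigma>\<^sup>2) * z\<^sup>2)" by (rule abs_Re_le_cmod)
    also have "\<dots> = (1 / 2 + \<sigma>\<^sup>2) * (cmod z)\<^sup>2"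
      using sigma_square unfolding norm_mult norm_power norm_of_real by simp
    also have "\<dots> \<le> (3 / 2) * T\<^sup>2" using sigma_square z by (intro mult_mono power_mono) auto
    finally have "- (3 / 2 * T\<^sup>2) \<le> Re (of_real (1 / 2 + \<sigma>\<^sup>2) * z\<^sup>2)" by (simp add: abs_le_iff)
    then show ?thesis unfolding e_def norm_exp_eq_Re exp_le_cancel_iff .
  qed
  have "4 * sqrt (26 * exp (- L) * B) \<le> 1 / 2 * exp (- (3 / 2 * T\<^sup>2))"
  proof -
    define X where "X = 6000 * T\<^sup>2"
    have TN: "T * N = 500 * T\<^sup>2" by (simp add: N_eq power2_eq_square)
    have X: "1664 \<le> exp X"
    proof -
      have "2\<^sup>2 \<le> T\<^sup>2" using T_ge_2 by (intro power_mono) auto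
      then have "1664 \<le> 1 + X" by (simp add: X_def)
      then show ?thesis using exp_ge_add_one_self[of X] by linarith
    qed
    have "6 * T * N + 14 * T\<^sup>2 = 3014 * T\<^sup>2" using TN by linarith
    then have "exp (- L) * B = exp (- L + 3014 * T\<^sup>2)" by (simp only: B_def exp_add)
    also have "- L + 3014 * T\<^sup>2 = - 6986 * T\<^sup>2" using L_eq by linarith
    also have "\<dots> \<le> - X + - (3 * T\<^sup>2)" by (simp add: X_def)
    finally have "exp (- L) * B \<le> exp (- X) * exp (- (3 * T\<^sup>2))" by (simp only: exp_le_cancel_iff exp_add)
    then have "26 * exp (- L) * B \<le> 1664 * exp (- X) * (1 / 64 * exp (- (3 * T\<^sup>2)))" by simp
    also have "\<dots> \<le> 1 * (1 / 64 * exp (- (3 * T\<^sup>2)))"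
    proof (rule mult_right_mono)
      have "1664 * exp (- X) \<le> exp X * exp (- X)" by (intro mult_right_mono X) simp
      also have "\<dots> = 1" by (simp flip: exp_add)
      finally show "1664 * exp (- X) \<le> 1" .
    qed simp
    also have "\<dots> = (1 / 8 * exp (- (3 / 2 * T\<^sup>2)))\<^sup>2"
    proof -
      have "exp (- (3 * T\<^sup>2)) = (exp (- (3 / 2 * T\<^sup>2)))\<^sup>2"
        unfolding power2_eq_square[of "exp _"] exp_add[symmetric] by (rule arg_cong[where f = exp]) simp
      then show ?thesis by (simp add: power_mult_distrib power_divide)
    qed
    finally have "sqrt (26 * exp (- L) * B) \<le> 1 / 8 * exp (- (3 / 2 * T\<^sup>2))"
      by (rule real_le_lsqrt[rotated -1]) simp_all
    then show ?thesis by simp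
  qed
  also have "\<dots> \<le> 1 / 2 * cmod e" using e by simp
  finally have "cmod (laplace F' z * laplace G' z * exp (- (z\<^sup>2 / 2)) - 1) * cmod e \<le> 1 / 2 * cmod e"
    using 1 by linarith
  moreover have "0 < cmod e" by (simp add: e_def)
  ultimately show ?thesis using mult_le_cancel_right_pos by blast
qed


lemma mean_truncation_le: "\<bar>\<integral>x. x \<partial>F'\<bar> \<le> (\<integral>x. x\<^sup>2 \<partial>F) / N"
  by (rule F.truncation_mean_le[OF F_int F_mean N_pos])

lemma second_moment_truncation_le: "(\<integral>x. x\<^sup>2 \<partial>F') \<le> (\<integral>x. x\<^sup>2 \<partial>F)"
  using F.truncation_second_moment_le[OF F_int(2)] N_pos by simp

text \<open>A bound on tail probabilities leaves open whether truncation loses a large part of the variance.  The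
  loss is in fact small: the second derivative at \<open>0\<close> of the function in \<open>laplace_product_close\<close> shows,
  by Cauchy's estimate, that the truncated second moments still add up to \<open>1\<close> up to \<open>O(T\<^sup>-\<^sup>2)\<close>, and neither of
  them can exceed the original one.\<close>

lemma variance_truncation_ge: "(\<integral>x. x\<^sup>2 \<partial>F) \<le> (\<integral>x. x\<^sup>2 \<partial>F') + 2 / T\<^sup>2"
proof -
  have T: "0 < T" using T_ge_2 by simp
  define \<phi> \<psi> where "\<phi> = F'.exp_moment" and "\<psi> = G'.exp_moment"
  define E where "E = (\<lambda>z::complex. exp (- (z\<^sup>2 / 2)))"
  define f0 where "f0 = (\<lambda>z. \<phi> 0 z * \<psi> 0 z * E z - 1)"
  define f1 where "f1 = (\<lambda>z. (\<phi> 1 z * \<psi> 0 z + \<phi> 0 z * \<psi> 1 z - z * (\<phi> 0 z * \<psi> 0 z)) * E z)"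
  define f2 where "f2 = (\<lambda>z. (\<phi> 2 z * \<psi> 0 z + 2 * (\<phi> 1 z * \<psi> 1 z) + \<phi> 0 z * \<psi> 2 z - \<phi> 0 z * \<psi> 0 z
      - 2 * z * (\<phi> 1 z * \<psi> 0 z + \<phi> 0 z * \<psi> 1 z) + z\<^sup>2 * (\<phi> 0 z * \<psi> 0 z)) * E z)"
  have d\<phi>: "(\<phi> 0 has_field_derivative \<phi> 1 z) (at z)" "(\<phi> 1 has_field_derivative \<phi> 2 z) (at z)"
    and d\<psi>: "(\<psi> 0 has_field_derivative \<psi> 1 z) (at z)" "(\<psi> 1 has_field_derivative \<psi> 2 z) (at z)" for z
    using F'.DERIV_exp_moment[of 0 z] F'.DERIV_exp_moment[of 1 z] G'.DERIV_exp_moment[of 0 z] G'.DERIV_exp_moment[of 1 z]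
    by (simp_all add: \<phi>_def \<psi>_def numeral_2_eq_2)
  have dE: "(E has_field_derivative - z * E z) (at z)" for z
    unfolding E_def by (auto intro!: derivative_eq_intros)
  have d0: "(f0 has_field_derivative f1 z) (at z)" for z
    unfolding f0_def f1_def
    by (rule derivative_eq_intros d\<phi> d\<psi> dE refl)+ (simp add: algebra_simps)
  have d1: "(f1 has_field_derivative f2 z) (at z)" for z
    unfolding f1_def f2_def
    by (rule derivative_eq_intros d\<phi> d\<psi> dE refl)+ (simp add: algebra_simps power2_eq_square)
  have "deriv f0 = f1" "deriv f1 = f2" using d0 d1 DERIV_imp_deriv by blast+
  then have "(deriv ^^ 2) f0 0 = f2 0" by (simp add: numeral_2_eq_2)
  moreover have "cmod ((deriv ^^ 2) f0 0) \<le> fact 2 * (1 / 2) / T ^ 2"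
  proof (rule Cauchy_inequality)
    have "f0 holomorphic_on A" for A using d0 by (meson has_field_derivative_at_within holomorphic_onI field_differentiable_def)
    then show "f0 holomorphic_on ball 0 T" "continuous_on (cball 0 T) f0"
      by (auto intro: holomorphic_on_imp_continuous_on)
    show "cmod (f0 x) \<le> 1 / 2" if "cmod (0 - x) = T" for x
      using laplace_product_close[of x] that
      by (simp add: f0_def \<phi>_def \<psi>_def E_def F'.exp_moment_0 G'.exp_moment_0)
  qed (rule T)
  ultimately have le: "cmod (f2 0) \<le> 1 / T\<^sup>2" by simp
  define m n a b where "m = (\<integral>x. x \<partial>F')" and "n = (\<integral>x. x \<partial>G')"
    and "a = (\<integral>x. x\<^sup>2 \<partial>F')" and "b = (\<integral>x. x\<^sup>2 \<partial>G')"
  have at0: "\<phi> 0 0 = 1" "\<phi> 1 0 = of_real m" "\<phi> 2 0 = of_real a"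
     "\<psi> 0 0 = 1" "\<psi> 1 0 = of_real n" "\<psi> 2 0 = of_real b"
    using F'.exp_moment_of_real[of _ 0] G'.exp_moment_of_real[of _ 0]
    by (simp_all add: \<phi>_def \<psi>_def F'.real_exp_moment_at_0 G'.real_exp_moment_at_0 F'.prob_UNIV G'.prob_UNIV
        m_def n_def a_def b_def)
  have "f2 0 = of_real (a + 2 * (m * n) + b - 1)" by (simp only: f2_def at0 E_def) simp
  then have 1: "\<bar>a + 2 * (m * n) + b - 1\<bar> \<le> 1 / T\<^sup>2" using le by (simp only: norm_of_real)
  have mn: "\<bar>m\<bar> \<le> 1 / N" "\<bar>n\<bar> \<le> 1 / N"
  proof -
    have "\<bar>m\<bar> \<le> (\<integral>x. x\<^sup>2 \<partial>F) / N" using mean_truncation_le by (simp add: m_def)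
    also have "\<dots> \<le> 1 / N" using F_var_le_1 N_pos by (intro divide_right_mono) auto
    finally show "\<bar>m\<bar> \<le> 1 / N" .
    have "\<bar>n\<bar> \<le> (\<integral>x. x\<^sup>2 \<partial>G) / N"
      using G.truncation_mean_le[OF G_int G_mean N_pos] by (simp add: n_def)
    also have "\<dots> \<le> 1 / N" using G_var_le_1 N_pos by (intro divide_right_mono) auto
    finally show "\<bar>n\<bar> \<le> 1 / N" .
  qed
  have "\<bar>m * n\<bar> \<le> 1 / N * (1 / N)" unfolding abs_mult using N_pos by (intro mult_mono mn) auto
  also have "\<dots> = 1 / T\<^sup>2 / 250000" by (simp add: N_eq power2_eq_square)
  finally have "\<bar>m * n\<bar> \<le> 1 / T\<^sup>2 / 250000" .
  moreover have "b \<le> (\<integral>x. x\<^sup>2 \<partial>G)"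
    using G.truncation_second_moment_le[OF G_int(2)] N_pos by (simp add: b_def)
  moreover have "0 \<le> 1 / T\<^sup>2" by simp
  moreover define q where "q = 1 / T\<^sup>2"
  ultimately have "\<bar>m * n\<bar> \<le> q / 250000" "b \<le> (\<integral>x. x\<^sup>2 \<partial>G)" "0 \<le> q" by (simp_all only: q_def)
  moreover have "\<bar>a + 2 * (m * n) + b - 1\<bar> \<le> q" using 1 by (simp only: q_def)
  ultimately have "(\<integral>x. x\<^sup>2 \<partial>F) \<le> a + 2 * q" using unit_variance by arith
  then show ?thesis by (simp add: a_def q_def)
qed

lemma laplace_truncation_nonzero: "cmod z \<le> T \<Longrightarrow> laplace F' z \<noteq> 0"
  using laplace_product_close[of z] by auto

text \<open>The product of both moment generating functions is of order \<open>exp (u\<^sup>2 / 2)\<close>, and the factor belonging to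
  \<open>G\<close> is not small, by Jensen's inequality and because the mean of the truncated law is tiny.\<close>

lemma mgf_truncation_le:
  assumes u: "\<bar>u\<bar> < T"
  shows "F'.real_exp_moment 0 u \<le> exp (T\<^sup>2)"
proof -
  define x y where "x = F'.real_exp_moment 0 u" and "y = G'.real_exp_moment 0 u"
  have pos: "0 < x" "0 < y" by (simp_all add: x_def y_def F'.real_exp_moment_0_pos G'.real_exp_moment_0_pos)
  have l: "laplace F' (of_real u) = of_real x" "laplace G' (of_real u) = of_real y"
    unfolding x_def y_def F'.exp_moment_of_real[symmetric] G'.exp_moment_of_real[symmetric]
    by (simp_all only: F'.exp_moment_0 G'.exp_moment_0)
  have "exp (- ((complex_of_real u)\<^sup>2 / 2)) = of_real (exp (- (u\<^sup>2 / 2)))"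
    unfolding exp_of_real[symmetric] by simp
  then have "laplace F' (of_real u) * laplace G' (of_real u) * exp (- ((of_real u)\<^sup>2 / 2)) - 1
      = complex_of_real (x * y * exp (- (u\<^sup>2 / 2)) - 1)" by (simp add: l)
  then have "\<bar>x * y * exp (- (u\<^sup>2 / 2)) - 1\<bar> \<le> 1 / 2"
    using laplace_product_close[of "of_real u"] u by (simp only: norm_of_real)
  then have xy: "x * y * exp (- (u\<^sup>2 / 2)) \<le> 3 / 2" by linarith
  have y: "exp (- (1 / 4)) \<le> y"
  proof -
    have "\<bar>u * (\<integral>x. x \<partial>G')\<bar> \<le> T * (1 / N)"
    proof -
      have "\<bar>\<integral>x. x \<partial>G'\<bar> \<le> (\<integral>x. x\<^sup>2 \<partial>G) / N" by (rule G.truncation_mean_le[OF G_int G_mean N_pos])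
      also have "\<dots> \<le> 1 / N" using G_var_le_1 N_pos by (intro divide_right_mono) auto
      finally show ?thesis unfolding abs_mult using u by (intro mult_mono) auto
    qed
    also have "\<dots> \<le> 1 / 4" using T_ge_2 by (simp add: N_eq)
    finally have "exp (- (1 / 4)) \<le> exp (u * (\<integral>x. x \<partial>G'))" by (simp add: abs_le_iff)
    also have "\<dots> \<le> y" unfolding y_def by (rule G'.exp_mean_le_real_exp_moment)
    finally show ?thesis .
  qed
  have "x * exp (- (1 / 4)) * exp (- (u\<^sup>2 / 2)) \<le> x * y * exp (- (u\<^sup>2 / 2))"
    using y pos by (intro mult_right_mono mult_left_mono) auto
  also have "\<dots> \<le> 3 / 2" by (rule xy)
  also have "(3 / 2 :: real) \<le> exp (1 / 2)" using exp_ge_add_one_self[of "1 / 2"] by simp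
  finally have "x * exp (- (1 / 4)) * exp (- (u\<^sup>2 / 2)) \<le> exp (1 / 2)" .
  moreover have "exp (- (1 / 4)) * exp (- (u\<^sup>2 / 2)) * exp (1 / 4 + u\<^sup>2 / 2) = 1"
    by (simp flip: exp_add)
  ultimately have "x \<le> exp (1 / 2) * exp (1 / 4 + u\<^sup>2 / 2)"
    using mult_right_mono[of "x * exp (- (1 / 4)) * exp (- (u\<^sup>2 / 2))" "exp (1 / 2)" "exp (1 / 4 + u\<^sup>2 / 2)"]
    by (simp only: mult.assoc mult_1_right exp_ge_zero)
  also have "\<dots> = exp (1 / 2 + (1 / 4 + u\<^sup>2 / 2))" by (rule exp_add[symmetric])
  also have "\<dots> \<le> exp (T\<^sup>2)"
  proof -
    have "u\<^sup>2 \<le> T\<^sup>2" using u abs_le_square_iff[of u T] by simp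
    moreover have "2\<^sup>2 \<le> T\<^sup>2" using T_ge_2 by (intro power_mono) auto
    ultimately show ?thesis by simp
  qed
  finally show ?thesis by (simp add: x_def)
qed

text \<open>The three error terms come from the mean of the truncated law, from its loss of variance, and from the
  cubic remainder of the logarithm.\<close>

lemma char_truncation_expansion:
  assumes v: "0 < v" "(\<integral>x. x\<^sup>2 \<partial>F) = v\<^sup>2" and t: "\<bar>t\<bar> \<le> v * T / 16"
  shows "\<exists>r. char F' t = exp (- of_real (v\<^sup>2 * t\<^sup>2 / 2) + r) \<and>
      cmod r \<le> v\<^sup>2 / N * \<bar>t\<bar> + 2 * t\<^sup>2 / T\<^sup>2 + 10 ^ 7 * v * \<bar>t\<bar> ^ 3 / T"
proof -
  have T: "0 < T" using T_ge_2 by simp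
  have v1: "v \<le> 1" using v F_var_le_1 by (metis abs_of_pos abs_square_le_1)
  define m a where "m = (\<integral>x. x \<partial>F')" and "a = (\<integral>x. x\<^sup>2 \<partial>F')"
  have l: "F'.real_exp_moment 0 0 = 1" "F'.real_exp_moment 1 0 = m" "F'.real_exp_moment 2 0 = a"
    by (simp_all add: F'.real_exp_moment_at_0 m_def a_def F'.prob_UNIV)
  have a_le: "a \<le> v\<^sup>2" using second_moment_truncation_le v by (simp add: a_def)
  have ge: "v\<^sup>2 \<le> a + 2 / T\<^sup>2" using variance_truncation_ge v by (simp add: a_def)
  have m_le: "\<bar>m\<bar> \<le> v\<^sup>2 / N" using mean_truncation_le v by (simp add: m_def)
  have "\<exists>r. F'.exp_moment 0 (\<i> * of_real t) = exp (of_real (F'.real_exp_moment 1 0) * (\<i> * of_real t)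
        + of_real (F'.real_exp_moment 2 0 - (F'.real_exp_moment 1 0)\<^sup>2) * (\<i> * of_real t)\<^sup>2 / 2 + r) \<and>
      cmod r \<le> 10 ^ 7 * v * cmod (\<i> * of_real t) ^ 3 / T"
  proof (rule log_cubic_remainder[where ?\<phi>1.0 = "F'.exp_moment 1" and ?\<phi>2.0 = "F'.exp_moment 2" and ?l0.0 = "F'.real_exp_moment 0"])
    show "(F'.exp_moment 0 has_field_derivative F'.exp_moment 1 z) (at z)"
      "(F'.exp_moment 1 has_field_derivative F'.exp_moment 2 z) (at z)" for z
      using F'.DERIV_exp_moment[of 0 z] F'.DERIV_exp_moment[of 1 z] by (simp_all add: numeral_2_eq_2)
    show "F'.real_exp_moment 2 0 - (F'.real_exp_moment 1 0)\<^sup>2 \<le> v\<^sup>2"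
      using a_le zero_le_power2[of m] unfolding l by linarith
    show "cmod (F'.exp_moment 0 z) \<le> F'.real_exp_moment 0 (Re z)" for z
      using F'.norm_laplace_le by (simp add: F'.exp_moment_0)
    show "F'.exp_moment 0 z \<noteq> 0" if "cmod z < T" for z
      using laplace_truncation_nonzero that by (simp add: F'.exp_moment_0)
    show "cmod (\<i> * of_real t) \<le> v * T / 16" using t by (simp add: norm_mult)
    show "(F'.real_exp_moment 1 u)\<^sup>2 \<le> F'.real_exp_moment 2 u * F'.real_exp_moment 0 u" for u
      by (rule F'.real_exp_moment_Cauchy_Schwarz)
  qed (use T v v1 l mgf_truncation_le F'.exp_moment_of_real F'.real_exp_moment_0_pos in simp_all)
  then obtain r where r: "char F' t = exp (of_real m * (\<i> * of_real t) + of_real (a - m\<^sup>2) * (\<i> * of_real t)\<^sup>2 / 2 + r)"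
      "cmod r \<le> 10 ^ 7 * v * \<bar>t\<bar> ^ 3 / T"
    unfolding l F'.exp_moment_0 char_eq_laplace by (auto simp: norm_mult)
  define R where "R = of_real m * (\<i> * of_real t) + of_real ((v\<^sup>2 - a + m\<^sup>2) * t\<^sup>2 / 2) + r"
  have "of_real m * (\<i> * of_real t) + of_real (a - m\<^sup>2) * (\<i> * of_real t)\<^sup>2 / 2 + r = - of_real (v\<^sup>2 * t\<^sup>2 / 2) + R"
    by (simp add: R_def power_mult_distrib field_simps)
  with r have "char F' t = exp (- of_real (v\<^sup>2 * t\<^sup>2 / 2) + R)" by simp
  moreover have "cmod R \<le> v\<^sup>2 / N * \<bar>t\<bar> + 2 * t\<^sup>2 / T\<^sup>2 + 10 ^ 7 * v * \<bar>t\<bar> ^ 3 / T"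
  proof -
    have m2: "m\<^sup>2 \<le> 1 / T\<^sup>2"
    proof -
      have "\<bar>m\<bar> \<le> 1 / T"
      proof (rule order_trans[OF m_le frac_le])
        show "v\<^sup>2 \<le> 1" using v1 v by (simp add: power_le_one)
      qed (use T N_eq in auto)
      then have "\<bar>m\<bar>\<^sup>2 \<le> (1 / T)\<^sup>2" by (rule power_mono) simp
      then show ?thesis by (simp add: power_divide)
    qed
    have "\<bar>v\<^sup>2 - a + m\<^sup>2\<bar> \<le> 4 * (1 / T\<^sup>2)" using m2 a_le ge by simp
    then have "\<bar>v\<^sup>2 - a + m\<^sup>2\<bar> * (t\<^sup>2 / 2) \<le> 4 * (1 / T\<^sup>2) * (t\<^sup>2 / 2)" by (rule mult_right_mono) simp
    then have 2: "cmod (of_real ((v\<^sup>2 - a + m\<^sup>2) * t\<^sup>2 / 2)) \<le> 2 * t\<^sup>2 / T\<^sup>2"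
      unfolding norm_of_real by (simp add: abs_mult)
    have 1: "cmod (of_real m * (\<i> * of_real t)) \<le> v\<^sup>2 / N * \<bar>t\<bar>"
      using mult_right_mono[OF m_le, of "\<bar>t\<bar>"] by (simp add: norm_mult)
    show ?thesis unfolding R_def
      by (intro norm_triangle_ineq[THEN order_trans] add_mono 1 2 r(2))
  qed
  ultimately show ?thesis by blast
qed

end

section \<open>From characteristic functions to total variation\<close>

lemma gaussian_integral:
  fixes \<beta> :: real
  assumes \<beta>: "0 < \<beta>"
  shows "integrable lborel (\<lambda>t. exp (- \<beta> * t\<^sup>2))" "(\<integral>t. exp (- \<beta> * t\<^sup>2) \<partial>lborel) = sqrt (pi / \<beta>)"
proof -
  define s where "s = sqrt (1 / (2 * \<beta>))"
  have s: "0 < s" "s\<^sup>2 = 1 / (2 * \<beta>)" using \<beta> by (simp_all add: s_def)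
  have "sqrt (pi / \<beta>) * normal_density 0 s t = exp (- \<beta> * t\<^sup>2)" for t
    unfolding normal_density_def s(2) using \<beta> by simp
  then have eq: "(\<lambda>t. exp (- \<beta> * t\<^sup>2)) = (\<lambda>t. sqrt (pi / \<beta>) * normal_density 0 s t)" by simp
  show "integrable lborel (\<lambda>t. exp (- \<beta> * t\<^sup>2))" "(\<integral>t. exp (- \<beta> * t\<^sup>2) \<partial>lborel) = sqrt (pi / \<beta>)"
    unfolding eq using s(1) by simp_all
qed

lemma char_normal_law: "0 < s \<Longrightarrow> char (normal_law 0 s) t = of_real (exp (- s * t\<^sup>2 / 2))"
  unfolding char_eq_laplace laplace_normal_law(2) exp_of_real[symmetric]
  by (rule arg_cong[where f = exp]) (simp add: power_mult_distrib)

lemma char_convolution_eq: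
  assumes M: "real_distribution M" and N: "real_distribution N"
  shows "char (M \<star> N) t = char M t * char N t"
proof -
  interpret M: real_distribution M by fact
  interpret N: real_distribution N by fact
  show ?thesis unfolding char_eq_laplace by (rule laplace_convolution[OF M N]) simp_all
qed

context near_normal_sum
begin

text \<open>In terms of \<open>u = v \<bar>t\<bar>\<close>, the range of \<open>t\<close> is chosen such that the cubic error is at most \<open>u\<^sup>2 / 8\<close>, a quarter
  of the Gaussian exponent.  All errors carry the factor \<open>\<bar>t\<bar> / (v T)\<close>, and the remaining powers of \<open>u\<close> are
  absorbed by another \<open>exp (u\<^sup>2 / 8)\<close>.\<close>

lemma char_truncation_close:
  assumes v: "0 < v" "(\<integral>x. x\<^sup>2 \<partial>F) = v\<^sup>2" and t: "\<bar>t\<bar> \<le> v * T / (8 * 10 ^ 7)"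
  shows "cmod (char F' t - of_real (exp (- (v\<^sup>2 * t\<^sup>2 / 2)))) \<le> 9 * 10 ^ 8 / (v * T) * \<bar>t\<bar> * exp (- (v\<^sup>2 / 4) * t\<^sup>2)"
proof -
  have T: "1 \<le> T" "0 < T" using T_ge_2 by simp_all
  have "v\<^sup>2 \<le> 1" using v F_var_le_1 by simp
  then have v1: "v \<le> 1" using v(1) by (simp add: abs_square_le_1)
  define u where "u = v * \<bar>t\<bar>"
  have u: "0 \<le> u" "u\<^sup>2 = v\<^sup>2 * t\<^sup>2" using v by (simp_all add: u_def power_mult_distrib)
  have t': "\<bar>t\<bar> \<le> v * T / 16"
    by (rule order_trans[OF t divide_left_mono]) (use v T in auto)
  obtain r where r: "char F' t = exp (- of_real (v\<^sup>2 * t\<^sup>2 / 2) + r)"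
      "cmod r \<le> v\<^sup>2 / N * \<bar>t\<bar> + 2 * t\<^sup>2 / T\<^sup>2 + 10 ^ 7 * v * \<bar>t\<bar> ^ 3 / T"
    using char_truncation_expansion[OF v t'] by blast
  have tT: "\<bar>t\<bar> / T \<le> v / (8 * 10 ^ 7)"
    using t T by (simp add: field_simps)
  have tT1: "\<bar>t\<bar> / T \<le> 1 / 2"
    by (rule order_trans[OF tT]) (use v1 in simp)
  have a1: "v\<^sup>2 / N * \<bar>t\<bar> \<le> \<bar>t\<bar> / T"
  proof -
    have "v\<^sup>2 / N \<le> 1 / T" by (rule frac_le) (use \<open>v\<^sup>2 \<le> 1\<close> T N_eq in auto)
    from mult_right_mono[OF this, of "\<bar>t\<bar>"] show ?thesis by simp
  qed
  have a2: "2 * t\<^sup>2 / T\<^sup>2 = 2 * (\<bar>t\<bar> / T) * (\<bar>t\<bar> / T)" by (simp add: power2_eq_square)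
  have a3: "10 ^ 7 * v * \<bar>t\<bar> ^ 3 / T = 10 ^ 7 * v * t\<^sup>2 * (\<bar>t\<bar> / T)"
    by (simp add: power3_eq_cube power2_eq_square)
  have r_small: "cmod r \<le> u\<^sup>2 / 8 + 2"
  proof -
    have "2 * (\<bar>t\<bar> / T) * (\<bar>t\<bar> / T) \<le> 2 * (1 / 2) * (1 / 2)"
      using tT1 T by (intro mult_mono) auto
    moreover have "10 ^ 7 * v * t\<^sup>2 * (\<bar>t\<bar> / T) \<le> 10 ^ 7 * v * t\<^sup>2 * (v / (8 * 10 ^ 7))"
      using tT v by (intro mult_left_mono) auto
    moreover have "10 ^ 7 * v * t\<^sup>2 * (v / (8 * 10 ^ 7)) = u\<^sup>2 / 8"
      unfolding u(2) by (simp add: power2_eq_square)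
    ultimately show ?thesis using r(2) a1 a2 a3 tT1 by linarith
  qed
  have r_le: "cmod r \<le> 10 ^ 8 / (v * T) * \<bar>t\<bar> * exp (u\<^sup>2 / 8)"
  proof -
    define q where "q = \<bar>t\<bar> / (v * T)"
    have q: "0 \<le> q" using v T by (simp add: q_def)
    have "\<bar>t\<bar> / T = q * v" using v by (simp add: q_def)
    then have b1: "\<bar>t\<bar> / T \<le> q * 1" using q v1 by (simp add: mult_left_le)
    have b2: "2 * (\<bar>t\<bar> / T) * (\<bar>t\<bar> / T) \<le> q * (2 * u)"
    proof -
      have "2 * (\<bar>t\<bar> / T) * (\<bar>t\<bar> / T) = q * (2 * u) * (1 / T)" using v by (simp add: q_def u_def)
      also have "\<dots> \<le> q * (2 * u) * 1" using q u T by (intro mult_left_mono) auto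
      finally show ?thesis by simp
    qed
    have b3: "10 ^ 7 * v * t\<^sup>2 * (\<bar>t\<bar> / T) = q * (10 ^ 7 * u\<^sup>2)"
      unfolding u(2) q_def using v(1) by (simp add: field_simps power2_eq_square)
    have "cmod r \<le> q * 1 + q * (2 * u) + q * (10 ^ 7 * u\<^sup>2)" using r(2) a1 a2 a3 b1 b2 b3 by linarith
    also have "\<dots> = q * (1 + 2 * u + 10 ^ 7 * u\<^sup>2)" by (simp add: algebra_simps)
    also have "\<dots> \<le> q * (10 ^ 8 * exp (u\<^sup>2 / 8))"
    proof (intro mult_left_mono q)
      have ten: "(10::real) ^ 7 = 10000000" "(10::real) ^ 8 = 100000000" by simp_all
      have "2 * u \<le> 1 + u\<^sup>2" using zero_le_power2[of "u - 1"] by (simp add: power2_eq_square algebra_simps)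
      moreover define y where "y = u\<^sup>2"
      ultimately have "2 * u \<le> 1 + y" "0 \<le> y" by simp_all
      then have "1 + 2 * u + 10000000 * y \<le> 100000000 + 12500000 * y" by linarith
      then have "1 + 2 * u + 10 ^ 7 * u\<^sup>2 \<le> 10 ^ 8 * (1 + u\<^sup>2 / 8)" unfolding ten y_def by simp
      also have "\<dots> \<le> 10 ^ 8 * exp (u\<^sup>2 / 8)" by (intro mult_left_mono exp_ge_add_one_self) simp
      finally show "1 + 2 * u + 10 ^ 7 * u\<^sup>2 \<le> 10 ^ 8 * exp (u\<^sup>2 / 8)" .
    qed
    finally show ?thesis by (simp add: q_def mult_ac)
  qed
  define A where "A = u\<^sup>2 / 2"
  have "char F' t - of_real (exp (- (v\<^sup>2 * t\<^sup>2 / 2))) = of_real (exp (- A)) * (exp r - 1)"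
    unfolding r(1) exp_add A_def u(2) by (simp add: exp_of_real[symmetric] right_diff_distrib)
  then have "cmod (char F' t - of_real (exp (- (v\<^sup>2 * t\<^sup>2 / 2)))) = exp (- A) * cmod (exp r - 1)"
    by (simp add: norm_mult)
  also have "\<dots> \<le> exp (- A) * (exp (u\<^sup>2 / 8 + 2) * (10 ^ 8 / (v * T) * \<bar>t\<bar> * exp (u\<^sup>2 / 8)))"
  proof (intro mult_left_mono)
    have "cmod (exp r - 1) \<le> exp \<bar>Re r\<bar> * cmod r" using Taylor_exp[of r 0] by simp
    also have "\<dots> \<le> exp (u\<^sup>2 / 8 + 2) * (10 ^ 8 / (v * T) * \<bar>t\<bar> * exp (u\<^sup>2 / 8))"
      using r_small r_le abs_Re_le_cmod[of r] by (intro mult_mono) auto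
    finally show "cmod (exp r - 1) \<le> exp (u\<^sup>2 / 8 + 2) * (10 ^ 8 / (v * T) * \<bar>t\<bar> * exp (u\<^sup>2 / 8))" .
  qed simp
  also have "\<dots> = exp 2 * (10 ^ 8 / (v * T) * \<bar>t\<bar>) * (exp (- A) * exp (u\<^sup>2 / 8) * exp (u\<^sup>2 / 8))"
    by (simp only: exp_add mult_ac)
  also have "exp (- A) * exp (u\<^sup>2 / 8) * exp (u\<^sup>2 / 8) = exp (- (v\<^sup>2 / 4) * t\<^sup>2)"
    unfolding exp_add[symmetric] A_def u(2) by (rule arg_cong[where f = exp]) simp
  also have "exp 2 * (10 ^ 8 / (v * T) * \<bar>t\<bar>) * exp (- (v\<^sup>2 / 4) * t\<^sup>2)
      \<le> 9 * (10 ^ 8 / (v * T) * \<bar>t\<bar>) * exp (- (v\<^sup>2 / 4) * t\<^sup>2)"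
  proof (intro mult_right_mono)
    have "exp (2::real) = exp 1 * exp 1" by (simp flip: exp_add)
    also have "\<dots> \<le> 3 * 3" by (intro mult_mono exp_le) auto
    finally show "exp (2::real) \<le> 9" by simp
  qed (use v T in auto)
  finally show ?thesis by simp
qed

text \<open>The weight \<open>a = exp (-L/2)\<close> in \<open>char_truncation_diff_le\<close> balances the second moment against the tail
  probability of order \<open>exp (-L)\<close>.\<close>

lemma char_close:
  assumes v: "0 < v" "(\<integral>x. x\<^sup>2 \<partial>F) = v\<^sup>2" and t: "\<bar>t\<bar> \<le> v * T / (8 * 10 ^ 7)"
  shows "cmod (char F t - of_real (exp (- (v\<^sup>2 * t\<^sup>2 / 2))))
     \<le> \<bar>t\<bar> * (9 * 10 ^ 8 / (v * T) * exp (- (v\<^sup>2 / 4) * t\<^sup>2) + 7 / T\<^sup>2)"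
proof -
  have T: "0 < T" using T_ge_2 by simp
  define a where "a = exp (- (L / 2))"
  have a: "0 < a" "a * a = exp (- L)" by (simp_all add: a_def flip: exp_add)
  have aT: "a \<le> 1 / T\<^sup>2"
  proof -
    have "T\<^sup>2 \<le> 1 + L / 2" using L_eq zero_le_power2[of T] by linarith
    also have "\<dots> \<le> exp (L / 2)" by (rule exp_ge_add_one_self)
    finally have "1 / exp (L / 2) \<le> 1 / T\<^sup>2" using T by (intro divide_left_mono) auto
    then show ?thesis unfolding a_def exp_minus inverse_eq_divide .
  qed
  have "cmod (char F t - char F' t) \<le> \<bar>t\<bar> * (a * v\<^sup>2 + measure F {x. N < \<bar>x\<bar>} / a) / 2"
    using F.char_truncation_diff_le[OF F_int(2) a(1), of t N] v(2) by simp
  also have "\<dots> \<le> \<bar>t\<bar> * (a * 1 + 12 * a) / 2"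
  proof (intro divide_right_mono mult_left_mono add_mono)
    show "v\<^sup>2 \<le> 1" using F_var_le_1 v(2) by linarith
    have "measure F {x. N < \<bar>x\<bar>} \<le> 12 * a * a" using F_tail_le a(2) by (simp only: mult.assoc)
    then show "measure F {x. N < \<bar>x\<bar>} / a \<le> 12 * a" using a(1) by (simp only: pos_divide_le_eq)
  qed (use a(1) in simp_all)
  also have "\<dots> = \<bar>t\<bar> * (13 / 2 * a)" by simp
  also have "\<dots> \<le> \<bar>t\<bar> * (7 / T\<^sup>2)" using aT a(1) by (intro mult_left_mono) linarith+
  finally have 1: "cmod (char F t - char F' t) \<le> \<bar>t\<bar> * (7 / T\<^sup>2)" .
  have "cmod (char F t - of_real (exp (- (v\<^sup>2 * t\<^sup>2 / 2))))
      \<le> cmod (char F t - char F' t) + cmod (char F' t - of_real (exp (- (v\<^sup>2 * t\<^sup>2 / 2))))"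
    using norm_triangle_ineq[of "char F t - char F' t" "char F' t - of_real (exp (- (v\<^sup>2 * t\<^sup>2 / 2)))"] by simp
  also have "\<dots> \<le> \<bar>t\<bar> * (7 / T\<^sup>2) + 9 * 10 ^ 8 / (v * T) * \<bar>t\<bar> * exp (- (v\<^sup>2 / 4) * t\<^sup>2)"
    by (intro add_mono 1 char_truncation_close[OF v t])
  finally show ?thesis by (simp add: algebra_simps)
qed


text \<open>For \<open>\<bar>t\<bar> \<le> \<rho>\<close> the difference of the characteristic functions is controlled by \<open>char_close\<close>.  Beyond \<open>\<rho>\<close> it is
  only known to be at most \<open>2\<close>, and there the smoothing factor \<open>exp (-d t\<^sup>2 / 2)\<close> is used: half of its exponent
  is kept for integrability, the other half gives \<open>exp (-\<rho>\<^sup>2 / (8 T))\<close>, where \<open>\<rho>\<^sup>2 / T\<close> is a multiple of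
  \<open>v\<^sup>2 T\<close>.\<close>

lemma smoothed_cdf_close:
  assumes v: "0 < v" "(\<integral>x. x\<^sup>2 \<partial>F) = v\<^sup>2"
  defines "d \<equiv> 1 / (2 * T)"
  shows "\<bar>cdf (F \<star> normal_law 0 d) x - cdf (normal_law 0 (v\<^sup>2 + d)) x\<bar> \<le> 10 ^ 18 / (v\<^sup>2 * T)"
proof -
  have T: "1 \<le> T" "0 < T" using T_ge_2 by simp_all
  have d: "0 < d" using T by (simp add: d_def)
  have v2: "v\<^sup>2 \<le> 1" using F_var_le_1 v(2) by linarith
  have vd: "0 < v\<^sup>2 + d" using v(1) d by (simp add: add_pos_pos)
  define \<kappa> where "\<kappa> = v\<^sup>2 * T"
  have \<kappa>: "0 < \<kappa>" using v(1) T by (simp add: \<kappa>_def)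
  define \<rho> where "\<rho> = v * T / (8 * 10 ^ 7)"
  have \<rho>: "0 < \<rho>" using v(1) T by (simp add: \<rho>_def)
  define C1 C2 C3 where "C1 = 9 * 10 ^ 8 / (v * T)" and "C2 = 7 / T\<^sup>2"
    and "C3 = 2 / \<rho> * exp (- (\<rho>\<^sup>2 / (8 * T)))"
  have C: "0 \<le> C1" "0 \<le> C2" "0 \<le> C3" using v(1) T \<rho> by (simp_all add: C1_def C2_def C3_def)
  define g1 g2 g3 where "g1 = (\<lambda>t. exp (- (v\<^sup>2 / 4) * t\<^sup>2))" and "g2 = (\<lambda>t. exp (- (1 / (4 * T)) * t\<^sup>2))"
    and "g3 = (\<lambda>t. exp (- (1 / (8 * T)) * t\<^sup>2))"
  define g where "g = (\<lambda>t. C1 * g1 t + C2 * g2 t + C3 * g3 t)"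
  have int1: "integrable lborel g1" "(\<integral>t. g1 t \<partial>lborel) = sqrt (4 * pi) / v"
    using gaussian_integral[of "v\<^sup>2 / 4"] v(1) by (simp_all add: g1_def real_sqrt_divide mult.commute)
  have int2: "integrable lborel g2" "(\<integral>t. g2 t \<partial>lborel) = sqrt (4 * T * pi)"
    using gaussian_integral[of "1 / (4 * T)"] T by (simp_all add: g2_def mult.commute)
  have int3: "integrable lborel g3" "(\<integral>t. g3 t \<partial>lborel) = sqrt (8 * T * pi)"
    using gaussian_integral[of "1 / (8 * T)"] T by (simp_all add: g3_def mult.commute)
  have intg: "integrable lborel g" unfolding g_def
    by (intro Bochner_Integration.integrable_add integrable_mult_right int1 int2 int3)
  have Ig: "(\<integral>t. g t \<partial>lborel) = C1 * (sqrt (4 * pi) / v) + C2 * sqrt (4 * T * pi) + C3 * sqrt (8 * T * pi)"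
    unfolding g_def using int1 int2 int3 by simp
  note N = real_distribution_normal_law[OF d, of 0]
  have diff: "cmod (char (F \<star> normal_law 0 d) t - char (normal_law 0 (v\<^sup>2 + d)) t)
      = cmod (char F t - of_real (exp (- (v\<^sup>2 * t\<^sup>2 / 2)))) * g2 t" for t
  proof -
    have "char (F \<star> normal_law 0 d) t = char F t * of_real (g2 t)"
      unfolding char_convolution_eq[OF distributions(1) N] char_normal_law[OF d] by (simp add: g2_def d_def)
    moreover have "char (normal_law 0 (v\<^sup>2 + d)) t = of_real (exp (- (v\<^sup>2 * t\<^sup>2 / 2))) * of_real (g2 t)"
    proof -
      have "exp (- (v\<^sup>2 + d) * t\<^sup>2 / 2) = exp (- (v\<^sup>2 * t\<^sup>2 / 2)) * g2 t"
        unfolding g2_def exp_add[symmetric] d_def by (rule arg_cong[where f = exp]) (simp add: field_simps)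
      then show ?thesis unfolding char_normal_law[OF vd] by simp
    qed
    ultimately have "char (F \<star> normal_law 0 d) t - char (normal_law 0 (v\<^sup>2 + d)) t
        = (char F t - of_real (exp (- (v\<^sup>2 * t\<^sup>2 / 2)))) * of_real (g2 t)"
      by (simp only: left_diff_distrib)
    then show ?thesis by (simp add: norm_mult g2_def)
  qed
  have pos: "0 \<le> g1 t" "0 \<le> g2 t" "g2 t \<le> 1" "0 \<le> g3 t" for t
    using T by (simp_all add: g1_def g2_def g3_def)
  have bound: "cmod (char (F \<star> normal_law 0 d) t - char (normal_law 0 (v\<^sup>2 + d)) t) / \<bar>t\<bar> \<le> g t"
    if t: "t \<noteq> 0" for t
  proof (cases "\<bar>t\<bar> \<le> \<rho>")
    case True
    have "cmod (char F t - of_real (exp (- (v\<^sup>2 * t\<^sup>2 / 2)))) * g2 t \<le> \<bar>t\<bar> * (C1 * g1 t + C2) * g2 t"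
      using char_close[OF v, of t] True pos
      by (intro mult_right_mono) (simp_all add: \<rho>_def C1_def C2_def g1_def)
    also have "\<dots> = \<bar>t\<bar> * (C1 * g1 t * g2 t + C2 * g2 t)" by (simp add: algebra_simps)
    also have "\<dots> \<le> \<bar>t\<bar> * (C1 * g1 t * 1 + C2 * g2 t + C3 * g3 t)"
    proof (intro mult_left_mono)
      have "C1 * g1 t * g2 t \<le> C1 * g1 t * 1" using C pos by (intro mult_left_mono) auto
      moreover have "0 \<le> C3 * g3 t" using C pos by simp
      ultimately show "C1 * g1 t * g2 t + C2 * g2 t \<le> C1 * g1 t * 1 + C2 * g2 t + C3 * g3 t" by linarith
    qed simp
    also have "\<dots> = \<bar>t\<bar> * g t" by (simp add: g_def)
    finally show ?thesis unfolding diff using t by (simp add: pos_divide_le_eq mult.commute)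
  next
    case False
    have h: "cmod (of_real (exp (- (v\<^sup>2 * t\<^sup>2 / 2)))) \<le> 1" by simp
    have "cmod (char F t - of_real (exp (- (v\<^sup>2 * t\<^sup>2 / 2)))) \<le> 1 + 1"
      by (rule order_trans[OF norm_triangle_ineq4 add_mono[OF F.cmod_char_le_1 h]])
    then have "cmod (char F t - of_real (exp (- (v\<^sup>2 * t\<^sup>2 / 2)))) * g2 t / \<bar>t\<bar> \<le> 2 * g2 t / \<rho>"
      using False \<rho> pos by (intro frac_le mult_right_mono) auto
    also have "\<dots> \<le> C3 * g3 t"
    proof -
      have "\<rho>\<^sup>2 \<le> t\<^sup>2" using False \<rho> abs_le_square_iff[of \<rho> t] by simp
      then have "\<rho>\<^sup>2 / (8 * T) \<le> t\<^sup>2 / (8 * T)" using T by (intro divide_right_mono) auto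
      moreover have "- (1 / (4 * T)) * t\<^sup>2 = - (t\<^sup>2 / (8 * T)) - t\<^sup>2 / (8 * T)" "- (1 / (8 * T)) * t\<^sup>2 = - (t\<^sup>2 / (8 * T))"
        by simp_all
      ultimately have "- (1 / (4 * T)) * t\<^sup>2 \<le> - (\<rho>\<^sup>2 / (8 * T)) + - (1 / (8 * T)) * t\<^sup>2" by linarith
      then have "g2 t \<le> exp (- (\<rho>\<^sup>2 / (8 * T))) * g3 t" unfolding g2_def g3_def exp_add[symmetric] exp_le_cancel_iff .
      then have "2 / \<rho> * g2 t \<le> 2 / \<rho> * (exp (- (\<rho>\<^sup>2 / (8 * T))) * g3 t)" using \<rho> by (intro mult_left_mono) auto
      then show ?thesis by (simp add: C3_def mult.assoc)
    qed
    also have "\<dots> \<le> g t" using C pos by (simp add: g_def)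
    finally show ?thesis unfolding diff .
  qed
  have "\<bar>cdf (F \<star> normal_law 0 d) x - cdf (normal_law 0 (v\<^sup>2 + d)) x\<bar> \<le> (\<integral>t. g t \<partial>lborel)"
    by (rule cdf_diff_le_integral_char_diff[OF real_distribution_convolution[OF distributions(1) N]
          real_distribution_normal_law[OF vd] measure_singleton_convolution_normal_law[OF distributions(1) d] _ intg bound])
      (simp_all add: measure_def measure_singleton_normal_law[OF vd])
  also have "\<dots> \<le> 10 ^ 18 / \<kappa>"
  proof -
    define p where "p = sqrt pi"
    have p: "0 < p" "p \<le> 2"
      using pi_less_4 real_sqrt_le_mono[of pi 4] by (simp_all add: p_def)
    have s: "sqrt (4 * pi) = 2 * p" "sqrt (4 * T * pi) = 2 * sqrt T * p"
      by (simp_all add: p_def real_sqrt_mult)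
    have "C1 * (sqrt (4 * pi) / v) = 18 * 10 ^ 8 * p / \<kappa>"
      using v(1) by (simp add: C1_def s \<kappa>_def power2_eq_square)
    also have "\<dots> \<le> 36 * 10 ^ 8 / \<kappa>" using p \<kappa> by (intro divide_right_mono) auto
    finally have 1: "C1 * (sqrt (4 * pi) / v) \<le> 36 * 10 ^ 8 / \<kappa>" .
    have "C2 * sqrt (4 * T * pi) = 14 * p / T * (sqrt T / T)" by (simp add: C2_def s power2_eq_square)
    also have "\<dots> \<le> 14 * 2 / \<kappa> * 1"
    proof (intro mult_mono frac_le mult_left_mono)
      show "\<kappa> \<le> T" using v2 T by (simp add: \<kappa>_def mult_left_le_one_le)
      have "sqrt T * 1 \<le> sqrt T * sqrt T" using T by (intro mult_left_mono) auto
      then show "sqrt T / T \<le> 1" using T by (simp add: pos_divide_le_eq)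
    qed (use p \<kappa> T in auto)
    finally have 2: "C2 * sqrt (4 * T * pi) \<le> 28 / \<kappa>" by simp
    have "C3 * sqrt (8 * T * pi) \<le> 512 * 10 ^ 15 / \<kappa>"
    proof -
      define y where "y = \<rho>\<^sup>2 / (8 * T)"
      have y: "0 < y" using \<rho> T by (simp add: y_def)
      have "sqrt y \<le> 1 + y" 
      proof (rule real_le_lsqrt)
        show "y \<le> (1 + y)\<^sup>2" using y by (simp add: power2_eq_square algebra_simps)
      qed (use y in auto)
      also have "\<dots> \<le> exp y" by (rule exp_ge_add_one_self)
      finally have "exp (- y) \<le> 1 / sqrt y"
        using y by (simp add: exp_minus field_simps)
      moreover have sy: "sqrt y = \<rho> / sqrt (8 * T)" using \<rho> by (simp add: y_def real_sqrt_divide)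
      ultimately have "exp (- y) \<le> sqrt (8 * T) / \<rho>" by simp
      then have "C3 * sqrt (8 * T * pi) \<le> 2 / \<rho> * (sqrt (8 * T) / \<rho>) * sqrt (8 * T * pi)"
        unfolding C3_def y_def[symmetric] using \<rho> T by (intro mult_right_mono mult_left_mono) auto
      also have "\<dots> = 2 / \<rho> / \<rho> * p * (sqrt (8 * T) * sqrt (8 * T))" by (simp add: real_sqrt_mult p_def)
      also have "sqrt (8 * T) * sqrt (8 * T) = 8 * T" using T by simp
      also have "2 / \<rho> / \<rho> * p * (8 * T) = p * (1024 * 10 ^ 14) / \<kappa>"
        using v(1) T by (simp add: \<rho>_def \<kappa>_def power2_eq_square mult_ac)
      also have "\<dots> \<le> 2 * (1024 * 10 ^ 14) / \<kappa>" using p \<kappa> by (intro divide_right_mono mult_right_mono) auto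
      also have "\<dots> \<le> 512 * 10 ^ 15 / \<kappa>" using \<kappa> by (intro divide_right_mono) auto
      finally show ?thesis .
    qed
    then have "(\<integral>t. g t \<partial>lborel) \<le> 36 * 10 ^ 8 / \<kappa> + 28 / \<kappa> + 512 * 10 ^ 15 / \<kappa>" unfolding Ig using 1 2 by linarith
    also have "\<dots> = (36 * 10 ^ 8 + 28 + 512 * 10 ^ 15) / \<kappa>" by (simp only: add_divide_distrib)
    also have "\<dots> \<le> 10 ^ 18 / \<kappa>" using \<kappa> by (intro divide_right_mono) auto
    finally show ?thesis .
  qed
  finally show ?thesis by (simp add: \<kappa>_def)
qed

text \<open>A part \<open>d\<close> of the variance \<open>\<sigma>\<^sup>2\<close> is spent on the estimate of the distribution functions, the rest turns it
  into an estimate in total variation.\<close>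

lemma tv_dist_regularized_le:
  assumes v: "0 < v" "(\<integral>x. x\<^sup>2 \<partial>F) = v\<^sup>2" and large: "1 / T \<le> \<sigma>\<^sup>2"
  shows "tv_dist (F \<star> normal_law 0 (\<sigma>\<^sup>2)) (normal_law 0 (v\<^sup>2 + \<sigma>\<^sup>2)) \<le> ereal (2 * 10 ^ 19 / (\<sigma> * sqrt T))"
proof -
  have T: "1 \<le> T" "0 < T" using T_ge_2 by simp_all
  define d where "d = 1 / (2 * T)"
  have d: "0 < d" using T by (simp add: d_def)
  have vd: "0 < v\<^sup>2 + d" using v(1) d by (simp add: add_pos_pos)
  define \<mu> \<nu> where "\<mu> = (F \<star> normal_law 0 d)" and "\<nu> = normal_law 0 (v\<^sup>2 + d)"
  note N = real_distribution_normal_law[OF d, of 0]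
  have \<mu>: "real_distribution \<mu>" unfolding \<mu>_def by (rule real_distribution_convolution[OF distributions(1) N])
  have \<nu>: "real_distribution \<nu>" unfolding \<nu>_def by (rule real_distribution_normal_law[OF vd])
  define V2 where "V2 = 2 * v\<^sup>2 + 1 / T"
  have \<mu>2: "integrable \<mu> (\<lambda>x. x\<^sup>2)" "(\<integral>x. x\<^sup>2 \<partial>\<mu>) \<le> V2"
  proof -
    note sm = second_moment_convolution_le[OF distributions(1) N F_int(2) second_moment_normal_law(1)[OF d], folded \<mu>_def]
    show "integrable \<mu> (\<lambda>x. x\<^sup>2)" by (rule sm)
    have "2 * v\<^sup>2 + 2 * d = V2" by (simp add: V2_def d_def)
    then show "(\<integral>x. x\<^sup>2 \<partial>\<mu>) \<le> V2"
      using sm(2) unfolding second_moment_normal_law(2)[OF d] v(2) by linarith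
  qed
  have \<nu>2: "integrable \<nu> (\<lambda>x. x\<^sup>2)" "(\<integral>x. x\<^sup>2 \<partial>\<nu>) \<le> V2"
  proof -
    have "2 * d = 1 / T" by (simp add: d_def)
    then have le: "v\<^sup>2 + d \<le> V2" using d zero_le_power2[of v] unfolding V2_def by linarith
    show "integrable \<nu> (\<lambda>x. x\<^sup>2)" "(\<integral>x. x\<^sup>2 \<partial>\<nu>) \<le> V2"
      unfolding \<nu>_def second_moment_normal_law(2)[OF vd] by (rule second_moment_normal_law(1)[OF vd], rule le)
  qed
  define D where "D = (\<lambda>x. cdf \<mu> x - cdf \<nu> x)"
  have "integrable lborel D \<and> (\<integral>x. \<bar>D x\<bar> \<partial>lborel) \<le> 2 * pi * ((10 ^ 18 + 3) / sqrt T)"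
  proof -
    \<comment> \<open>\<open>A\<close> balances \<open>s * A\<close> against the tail term \<open>V2 / A\<close>, both becoming \<open>O(1 / sqrt T)\<close>.\<close>
    define s A where "s = (if 1 \<le> v\<^sup>2 * T then 10 ^ 18 / (v\<^sup>2 * T) else 1)"
      and "A = (if 1 \<le> v\<^sup>2 * T then v\<^sup>2 * sqrt T else 1 / sqrt T)"
    have A: "0 < A" using v(1) T by (simp add: A_def)
    have "\<bar>cdf \<mu> x - cdf \<nu> x\<bar> \<le> s" for x
    proof (cases "1 \<le> v\<^sup>2 * T")
      case True
      then show ?thesis using smoothed_cdf_close[OF v, of x] by (simp add: s_def \<mu>_def \<nu>_def d_def)
    next
      case False
      interpret \<mu>: real_distribution \<mu> by (rule \<mu>)
      interpret \<nu>: real_distribution \<nu> by (rule \<nu>)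
      show ?thesis using False \<mu>.cdf_nonneg[of x] \<mu>.cdf_bounded_prob[of x] \<nu>.cdf_nonneg[of x] \<nu>.cdf_bounded_prob[of x]
        by (simp add: s_def abs_le_iff)
    qed
    note * = integral_cdf_diff_le[OF \<mu> \<nu> \<mu>2 \<nu>2 this A]
    have sqT: "sqrt T * sqrt T = T" "0 < sqrt T" using T by simp_all
    have "s * A + V2 / A \<le> (10 ^ 18 + 3) / sqrt T"
    proof (cases "1 \<le> v\<^sup>2 * T")
      case True
      have "s * A = 10 ^ 18 / sqrt T"
        using True v(1) T sqT by (simp add: s_def A_def field_simps)
      moreover have "V2 / A \<le> (3 * v\<^sup>2) / (v\<^sup>2 * sqrt T)"
        using True v(1) T by (simp add: A_def V2_def divide_right_mono field_simps)
      moreover have "(3 * v\<^sup>2) / (v\<^sup>2 * sqrt T) = 3 / sqrt T" using v(1) by simp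
      ultimately show ?thesis by (simp add: add_divide_distrib)
    next
      case False
      then have "v\<^sup>2 \<le> 1 / T" using T by (simp add: field_simps)
      then have "V2 \<le> 3 * (1 / T)" by (simp add: V2_def)
      then have "V2 * sqrt T \<le> 3 * (1 / T) * sqrt T" using sqT by (intro mult_right_mono) auto
      also have "\<dots> = 3 / sqrt T" using sqT T by (simp add: field_simps)
      finally have "V2 / A \<le> 3 / sqrt T" using False by (simp add: A_def)
      moreover have "s * A = 1 / sqrt T" using False by (simp add: s_def A_def)
      moreover have "(1 + 3) / sqrt T \<le> (10 ^ 18 + 3) / sqrt T" using sqT by (intro divide_right_mono) auto
      ultimately show ?thesis by (simp add: add_divide_distrib)
    qed
    then have "2 * pi * (s * A + V2 / A) \<le> 2 * pi * ((10 ^ 18 + 3) / sqrt T)"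
      by (rule mult_left_mono) simp
    then show ?thesis using * unfolding D_def by linarith
  qed
  then have intD: "integrable lborel D" and leD: "(\<integral>x. \<bar>D x\<bar> \<partial>lborel) \<le> 10 ^ 19 / sqrt T"
  proof -
    assume *: "integrable lborel D \<and> (\<integral>x. \<bar>D x\<bar> \<partial>lborel) \<le> 2 * pi * ((10 ^ 18 + 3) / sqrt T)"
    have "2 * pi * ((10 ^ 18 + 3) / sqrt T) \<le> 8 * ((10 ^ 18 + 3) / sqrt T)"
      using pi_less_4 T by (intro mult_right_mono) auto
    also have "\<dots> = 8 * (10 ^ 18 + 3) / sqrt T" by simp
    also have "\<dots> \<le> 10 ^ 19 / sqrt T" using T by (intro divide_right_mono) auto
    finally show "integrable lborel D" "(\<integral>x. \<bar>D x\<bar> \<partial>lborel) \<le> 10 ^ 19 / sqrt T" using * by auto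
  qed
  define s where "s = \<sigma>\<^sup>2 - d"
  have s_ge: "\<sigma>\<^sup>2 / 2 \<le> s" using large by (simp add: s_def d_def)
  have s: "0 < s" using s_ge \<sigma> zero_less_power[of \<sigma> 2] by linarith
  have "(\<mu> \<star> normal_law 0 s) = (F \<star> (normal_law 0 d \<star> normal_law 0 s))"
    unfolding \<mu>_def
    by (intro convolution_associative[symmetric] real_distribution_finite real_distribution_sets distributions N
        real_distribution_normal_law s)
  also have "(normal_law 0 d \<star> normal_law 0 s) = normal_law 0 (\<sigma>\<^sup>2)"
    unfolding normal_law_convolution[OF d s] by (simp add: s_def)
  finally have eq1: "(\<mu> \<star> normal_law 0 s) = (F \<star> normal_law 0 (\<sigma>\<^sup>2))" .
  have eq2: "(\<nu> \<star> normal_law 0 s) = normal_law 0 (v\<^sup>2 + \<sigma>\<^sup>2)"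
    unfolding \<nu>_def normal_law_convolution[OF vd s] by (simp add: s_def)
  have "tv_dist (F \<star> normal_law 0 (\<sigma>\<^sup>2)) (normal_law 0 (v\<^sup>2 + \<sigma>\<^sup>2))
      \<le> ereal (2 / (sqrt s * sqrt (2 * pi)) * (\<integral>x. \<bar>D x\<bar> \<partial>lborel))"
    unfolding eq1[symmetric] eq2[symmetric] D_def
    by (rule tv_dist_convolution_normal_law_le[OF \<mu> \<nu> s intD[unfolded D_def]])
  also have "\<dots> \<le> ereal (2 / \<sigma> * (10 ^ 19 / sqrt T))"
  proof -
    have "\<sigma>\<^sup>2 \<le> s * (2 * pi)"
    proof -
      have "\<sigma>\<^sup>2 \<le> s * 2" using s_ge by simp
      also have "\<dots> \<le> s * (2 * pi)" using s pi_ge_two by (intro mult_left_mono) auto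
      finally show ?thesis .
    qed
    then have "sqrt (\<sigma>\<^sup>2) \<le> sqrt (s * (2 * pi))" by (rule real_sqrt_le_mono)
    then have "\<sigma> \<le> sqrt s * sqrt (2 * pi)" using \<sigma> by (simp add: real_sqrt_mult)
    then have "2 / (sqrt s * sqrt (2 * pi)) \<le> 2 / \<sigma>" using \<sigma> by (intro divide_left_mono) (auto simp: s)
    then show ?thesis using leD \<sigma> by (intro ereal_less_eq(3)[THEN iffD2] mult_mono) auto
  qed
  finally show ?thesis by simp
qed

end


section \<open>The theorem\<close>

lemma regularized_convolution:
  assumes F: "real_distribution F" and G: "real_distribution G" and \<sigma>: "0 < \<sigma>"
  shows "(regularized F \<sigma> \<star> regularized G \<sigma>) = ((F \<star> G) \<star> normal_law 0 (2 * \<sigma>\<^sup>2))"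
proof -
  define Q where "Q = normal_law 0 (\<sigma>\<^sup>2)"
  have Q: "real_distribution Q" unfolding Q_def by (rule real_distribution_normal_law) (use \<sigma> in simp)
  note assoc = convolution_associative[OF real_distribution_finite real_distribution_finite real_distribution_finite
      real_distribution_sets real_distribution_sets real_distribution_sets]
  note conv = real_distribution_convolution
  have "((F \<star> Q) \<star> (G \<star> Q)) = (F \<star> (Q \<star> (G \<star> Q)))"
    using assoc[of Q "G \<star> Q" F] F Q conv[OF G Q] by simp
  also have "(Q \<star> (G \<star> Q)) = ((G \<star> Q) \<star> Q)"
    by (intro convolution_commutative real_distribution_finite real_distribution_sets Q conv G)
  also have "((G \<star> Q) \<star> Q) = (G \<star> (Q \<star> Q))" using assoc[of Q Q G] G Q by simp
  also have "(F \<star> (G \<star> (Q \<star> Q))) = ((F \<star> G) \<star> (Q \<star> Q))"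
    using assoc[of G "Q \<star> Q" F] F G conv[OF Q Q] by simp
  also have "(Q \<star> Q) = normal_law 0 (2 * \<sigma>\<^sup>2)"
    unfolding Q_def using \<sigma> by (subst normal_law_convolution) auto
  finally show ?thesis by (simp only: regularized_def Q_def)
qed

lemma has_mean_variance_0:
  assumes F: "real_distribution F" and mv: "has_mean_variance F 0 s"
  shows "integrable F (\<lambda>x. x)" "integrable F (\<lambda>x. x\<^sup>2)" "(\<integral>x. x \<partial>F) = 0" "(\<integral>x. x\<^sup>2 \<partial>F) = s"
  using mv unfolding has_mean_variance_def by auto

lemma tv_dist_regularized_le_2:
  assumes "real_distribution F" "0 < \<sigma>" "0 < s"
  shows "tv_dist (regularized F \<sigma>) (normal_law 0 (s + \<sigma>\<^sup>2)) \<le> 2"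
  unfolding regularized_def
  using assms by (intro tv_dist_le_2 real_distribution_convolution real_distribution_normal_law) (auto intro: add_pos_pos)

theorem theorem5p1:
  shows "\<exists>C::real. C > 0 \<and>
    (\<forall>(F::real measure) (G::real measure) (v1::real) (v2::real) (\<sigma>::real) (\<epsilon>::real).
      real_distribution F \<longrightarrow> real_distribution G \<longrightarrow>
      v1 > 0 \<longrightarrow> v2 > 0 \<longrightarrow>
      has_mean_variance F 0 (v1\<^sup>2) \<longrightarrow> has_mean_variance G 0 (v2\<^sup>2) \<longrightarrow>
      v1\<^sup>2 + v2\<^sup>2 = 1 \<longrightarrow>
      0 < \<sigma> \<longrightarrow> \<sigma> \<le> 1 \<longrightarrow> 0 < \<epsilon> \<longrightarrow> \<epsilon> \<le> 1 \<longrightarrow>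
      ereal (1/2) * tv_dist (regularized F \<sigma> \<star> regularized G \<sigma>) (normal_law 0 (1 + 2 * \<sigma>\<^sup>2)) \<le> ereal \<epsilon> \<longrightarrow>
      tv_dist (regularized F \<sigma>) (normal_law 0 (v1\<^sup>2 + \<sigma>\<^sup>2)) \<le> ereal (C / \<sigma>) * inv_log_root \<epsilon> \<and>
      tv_dist (regularized G \<sigma>) (normal_law 0 (v2\<^sup>2 + \<sigma>\<^sup>2)) \<le> ereal (C / \<sigma>) * inv_log_root \<epsilon>)"
proof -
  \<comment> \<open>As \<open>sqrt T = root 4 L / 10\<close>, this is ten times the constant of \<open>tv_dist_regularized_le\<close>.\<close>
  define C :: real where "C = 2 * 10 ^ 20"
  have "tv_dist (regularized F \<sigma>) (normal_law 0 (v1\<^sup>2 + \<sigma>\<^sup>2)) \<le> ereal (C / \<sigma>) * inv_log_root \<epsilon> \<and>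
      tv_dist (regularized G \<sigma>) (normal_law 0 (v2\<^sup>2 + \<sigma>\<^sup>2)) \<le> ereal (C / \<sigma>) * inv_log_root \<epsilon>"
    if F: "real_distribution F" and G: "real_distribution G" and v1: "v1 > 0" and v2: "v2 > 0"
      and mF: "has_mean_variance F 0 (v1\<^sup>2)" and mG: "has_mean_variance G 0 (v2\<^sup>2)"
      and unit: "v1\<^sup>2 + v2\<^sup>2 = 1" and \<sigma>: "0 < \<sigma>" "\<sigma> \<le> 1" and \<epsilon>: "0 < \<epsilon>" "\<epsilon> \<le> 1"
      and tv: "ereal (1/2) * tv_dist (regularized F \<sigma> \<star> regularized G \<sigma>) (normal_law 0 (1 + 2 * \<sigma>\<^sup>2)) \<le> ereal \<epsilon>"
    for F G :: "real measure" and v1 v2 \<sigma> \<epsilon> :: real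
  proof -
    have two: "tv_dist (regularized F \<sigma>) (normal_law 0 (v1\<^sup>2 + \<sigma>\<^sup>2)) \<le> 2"
        "tv_dist (regularized G \<sigma>) (normal_law 0 (v2\<^sup>2 + \<sigma>\<^sup>2)) \<le> 2"
      using tv_dist_regularized_le_2[OF F \<sigma>(1), of "v1\<^sup>2"] tv_dist_regularized_le_2[OF G \<sigma>(1), of "v2\<^sup>2"] v1 v2
      by simp_all
    show ?thesis
    proof (cases "\<epsilon> < 1")
      case False
      then have "ereal (C / \<sigma>) * inv_log_root \<epsilon> = \<infinity>"
        using \<sigma> by (simp add: inv_log_root_def C_def)
      then show ?thesis by (simp only: ereal_less_eq simp_thms)
    next
      case True
      define L where "L = ln (1 / \<epsilon>)"
      have L: "0 < L" using \<epsilon> True by (simp add: L_def ln_div)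
      have expL: "exp (- L) = \<epsilon>" using \<epsilon> by (simp add: L_def ln_div)
      define q where "q = sqrt (sqrt L)"
      have q: "0 < q" using L by (simp add: q_def)
      have "(1 / L) powr (1 / 4) = 1 / q"
      proof -
        have "L powr (1 / 4) = (L powr (1 / 2)) powr (1 / 2)" by (simp add: powr_powr)
        also have "\<dots> = q" using L by (simp add: q_def powr_half_sqrt)
        finally show ?thesis using L by (simp add: powr_divide)
      qed
      then have rhs: "ereal (C / \<sigma>) * inv_log_root \<epsilon> = ereal (C / (\<sigma> * q))"
        using True by (simp add: inv_log_root_def flip: L_def)
      show ?thesis
      \<comment> \<open>The second condition is \<open>1 / T \<le> \<sigma>\<^sup>2\<close> for \<open>T = sqrt L / 100\<close>.\<close>
      proof (cases "40000 \<le> L \<and> 100 / sqrt L \<le> \<sigma>\<^sup>2")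
        case False
        \<comment> \<open>In this range the claimed bound exceeds \<open>2\<close>.\<close>
        have "\<sigma> * q \<le> 15"
        proof (cases "40000 \<le> L")
          case True
          with False have "\<sigma>\<^sup>2 < 100 / sqrt L" by simp
          then have "\<sigma>\<^sup>2 * q\<^sup>2 < 100" using L by (simp add: q_def pos_less_divide_eq)
          then have "(\<sigma> * q)\<^sup>2 < 10\<^sup>2" by (simp add: power_mult_distrib)
          then have "\<sigma> * q < 10" by (rule power_less_imp_less_base) simp
          then show ?thesis by simp
        next
          case False
          then have "sqrt (sqrt L) \<le> sqrt (sqrt (15 ^ 4))" by (intro real_sqrt_le_mono) simp
          also have "sqrt (15 ^ 4 :: real) = 225" by (rule real_sqrt_unique) simp_all
          also have "sqrt (225 :: real) = 15" by (rule real_sqrt_unique) simp_all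
          finally have "1 * q \<le> 15" by (simp add: q_def)
          moreover have "\<sigma> * q \<le> 1 * q" using \<sigma> q by (intro mult_right_mono) auto
          ultimately show ?thesis by simp
        qed
        then have "2 * (\<sigma> * q) \<le> C" by (simp add: C_def)
        then have "2 \<le> C / (\<sigma> * q)" using \<sigma> q by (simp add: pos_le_divide_eq)
        then have "2 \<le> ereal (C / \<sigma>) * inv_log_root \<epsilon>" unfolding rhs by simp
        then show ?thesis using two order_trans by blast
      next
        case large: True
        note F2 = has_mean_variance_0[OF F mF] and G2 = has_mean_variance_0[OF G mG]
        have s: "0 < 1 + 2 * \<sigma>\<^sup>2" by (intro add_pos_nonneg) auto
        have "tv_dist (regularized F \<sigma> \<star> regularized G \<sigma>) (normal_law 0 (1 + 2 * \<sigma>\<^sup>2)) \<le> ereal (2 * \<epsilon>)"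
          using tv by (cases "tv_dist (regularized F \<sigma> \<star> regularized G \<sigma>) (normal_law 0 (1 + 2 * \<sigma>\<^sup>2))") auto
        then have tv': "tv_dist ((F \<star> G) \<star> normal_law 0 (2 * \<sigma>\<^sup>2)) (normal_law 0 (1 + 2 * \<sigma>\<^sup>2)) \<le> ereal (2 * exp (- L))"
          unfolding expL regularized_convolution[OF F G \<sigma>(1)] .
        have "0 < 2 * \<sigma>\<^sup>2" using \<sigma> by simp
        then have close: "\<bar>cdf ((F \<star> G) \<star> normal_law 0 (2 * \<sigma>\<^sup>2)) x - cdf (normal_law 0 (1 + 2 * \<sigma>\<^sup>2)) x\<bar> \<le> 2 * exp (- L)" for x
          by (intro cdf_diff_le_tv_dist[OF _ _ tv'] real_distribution_convolution F G real_distribution_normal_law s)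
        interpret near_normal_sum F G \<sigma> L
          using F G F2 G2 unit \<sigma> large close
          by (auto simp: near_normal_sum_def near_normal_sum_axioms_def)
        have T': "1 / T \<le> \<sigma>\<^sup>2" using large by (simp add: T_def)
        have "q = 10 * sqrt T" by (simp add: T_def q_def real_sqrt_divide)
        then have C: "2 * 10 ^ 19 / (\<sigma> * sqrt T) = C / (\<sigma> * q)" by (simp add: C_def)
        show ?thesis unfolding rhs C[symmetric] regularized_def
          using tv_dist_regularized_le[OF v1 F2(4) T'] near_normal_sum.tv_dist_regularized_le[OF swap v2 G2(4) T'] by simp
      qed
    qed
  qed
  then show ?thesis by (intro exI[of _ C]) (auto simp: C_def)
qed

end
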